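(* Let $G$ be a connected non-compact Lie group. Consider a left-invariant and a right-invariant Riemannian metric on $G$ that coincide on the Lie algebra of $G$ (the tangent space at the identity). Let $d$ be the distance function on $G$ induced by the left-invariant metric and let $\rho$ be the measure on $G$ induced by the right-invariant metric (so $\rho$ is a right Haar measure). Let $w$ be an arbitrary radius-weight. Then for all $f\in\mathcal{F}_{loc}(G)$ and all $1\le p\le q\le\infty$, $$\|I_{p,w}f\|_{\mathcal{L}_q(G)}\le\|w\|^{\frac1p}\,\|f\|_{\mathcal{L}_q(G)},$$ where $\frac1\infty=0$ by convention.
   Context: $\mathcal{B}_{x,r}$ denotes the open $d$-ball with center $x$ and radius $r>0$; $\mathcal{L}_q(G)=\mathcal{L}_q(G,\rho)$ (norms may be $+\infty$). $\mathcal{F}_{loc}(G)$ is the set of measurable real-valued functions $f$ on $G$ with $\int_U|f|\,d\rho<\infty$ for every bounded Borel set $U$. For $f\in\mathcal{F}_{loc}(G)$, $Af(x,r):=\frac{1}{\rho(\mathcal{B}_{x,r})}\int_{\mathcal{B}_{x,r}}|f|\,d\rho$. A radius-weight is a nonnegative measurable function $w$ on $(0,\infty)$ with $\|w\|:=\int_0^\infty w(r)\,dr<\infty$ and $w\ne0$ almost everywhere. $I_{p,w}f(x):=\big(\int_0^\infty w(r)(Af(x,r))^p\,dr\big)^{1/p}$ for $1\le p<\infty$, and $I_{\infty,w}f(x)$ is the $\mathcal{L}_\infty$-norm of $r\mapsto Af(x,r)$ with respect to the measure $w(r)\,dr$, which equals $\sup_{r>0}Af(x,r)$. *)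

theory Defs
  imports "HOL-Probability.Essential_Supremum"
begin

section \<open>Smooth manifolds and Lie groups\<close>

primrec Ck_on :: "nat \<Rightarrow> ('e::euclidean_space \<Rightarrow> 'f::euclidean_space) \<Rightarrow> 'e set \<Rightarrow> bool" where
  "Ck_on 0 f S \<longleftrightarrow> continuous_on S f"
| "Ck_on (Suc k) f S \<longleftrightarrow>
     (\<forall>x\<in>S. f differentiable (at x)) \<and> (\<forall>v. Ck_on k (\<lambda>x. frechet_derivative f (at x) v) S)"

text \<open>Intended for open sets \<open>S\<close> only.\<close>

definition smooth_on :: "'e set \<Rightarrow> ('e::euclidean_space \<Rightarrow> 'f::euclidean_space) \<Rightarrow> bool" where
  "smooth_on S f \<longleftrightarrow> (\<forall>k. Ck_on k f S)"

text \<open>A chart is a coordinate domain together with a coordinate map; the values of the map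
  outside the domain are irrelevant.\<close>

type_synonym ('a, 'e) chart = "'a set \<times> ('a \<Rightarrow> 'e)"

abbreviation chart_dom :: "('a, 'e) chart \<Rightarrow> 'a set" where
  "chart_dom \<equiv> fst"

abbreviation chart_map :: "('a, 'e) chart \<Rightarrow> 'a \<Rightarrow> 'e" where
  "chart_map \<equiv> snd"

definition chart_inv :: "('a, 'e) chart \<Rightarrow> 'e \<Rightarrow> 'a" where
  "chart_inv c = inv_into (chart_dom c) (chart_map c)"

definition is_chart :: "('a::topological_space, 'e::euclidean_space) chart \<Rightarrow> bool" where
  "is_chart c \<longleftrightarrow> open (chart_dom c) \<and> open (chart_map c ` chart_dom c) \<and>
     homeomorphism (chart_dom c) (chart_map c ` chart_dom c) (chart_map c) (chart_inv c)"

text \<open>The atlas need not be maximal. The manifold is the whole type \<open>'a\<close>; the requirements that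
  it be Hausdorff and second countable are expressed by the sort of \<open>'a\<close>.\<close>

definition smooth_atlas :: "('a::topological_space, 'e::euclidean_space) chart set \<Rightarrow> bool" where
  "smooth_atlas A \<longleftrightarrow> (\<forall>c\<in>A. is_chart c) \<and> (\<Union>c\<in>A. chart_dom c) = UNIV \<and>
     (\<forall>c\<in>A. \<forall>c'\<in>A. smooth_on (chart_map c ` (chart_dom c \<inter> chart_dom c')) (chart_map c' \<circ> chart_inv c))"

definition prod_atlas ::
  "('a, 'e) chart set \<Rightarrow> ('b, 'f) chart set \<Rightarrow> ('a \<times> 'b, 'e \<times> 'f) chart set" where
  "prod_atlas A B =
     {(chart_dom c \<times> chart_dom c', map_prod (chart_map c) (chart_map c')) | c c'. c \<in> A \<and> c' \<in> B}"

definition smooth_map ::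
  "('a::topological_space, 'e::euclidean_space) chart set \<Rightarrow>
   ('b::topological_space, 'f::euclidean_space) chart set \<Rightarrow> ('a \<Rightarrow> 'b) \<Rightarrow> bool" where
  "smooth_map A B F \<longleftrightarrow> continuous_on UNIV F \<and>
     (\<forall>a\<in>A. \<forall>b\<in>B. smooth_on (chart_map a ` (chart_dom a \<inter> F -` chart_dom b))
                              (chart_map b \<circ> F \<circ> chart_inv a))"

locale lie_group = group mul e iv
  for mul :: "'a \<Rightarrow> 'a \<Rightarrow> 'a::{t2_space, second_countable_topology}"
    and e :: 'a and iv :: "'a \<Rightarrow> 'a" +
  fixes A :: "('a, 'e::euclidean_space) chart set"
  assumes smooth_atlas: "smooth_atlas A"
    and smooth_mult: "smooth_map (prod_atlas A A) A (\<lambda>(x, y). mul x y)"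
    and smooth_inverse: "smooth_map A A iv"

section \<open>Tangent vectors\<close>

text \<open>A tangent vector at \<open>p\<close> is a family of coordinate vectors, one for each chart around \<open>p\<close>,
  that transforms under coordinate changes by the derivative of the transition map.\<close>

type_synonym ('a, 'e) tangent = "('a, 'e) chart \<Rightarrow> 'e"

definition tangent_space ::
  "('a, 'e::euclidean_space) chart set \<Rightarrow> 'a \<Rightarrow> ('a, 'e) tangent set" where
  "tangent_space A p = {v.
     (\<forall>c\<in>A. \<forall>c'\<in>A. p \<in> chart_dom c \<longrightarrow> p \<in> chart_dom c' \<longrightarrow>
        v c' = frechet_derivative (chart_map c' \<circ> chart_inv c) (at (chart_map c p)) (v c)) \<and>
     (\<forall>c. c \<notin> A \<or> p \<notin> chart_dom c \<longrightarrow> v c = 0)}"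

text \<open>The tangent vector at \<open>p\<close> whose coordinate vector in the chart \<open>c\<close> is \<open>u\<close>.\<close>

definition coord_vector ::
  "('a, 'e::euclidean_space) chart set \<Rightarrow> ('a, 'e) chart \<Rightarrow> 'a \<Rightarrow> 'e \<Rightarrow> ('a, 'e) tangent" where
  "coord_vector A c p u = (\<lambda>c'. if c' \<in> A \<and> p \<in> chart_dom c'
     then frechet_derivative (chart_map c' \<circ> chart_inv c) (at (chart_map c p)) u else 0)"

text \<open>The differential of \<open>F\<close> at \<open>p\<close>. By the chain rule it does not depend on the chart chosen
  around \<open>p\<close>.\<close>

definition differential ::
  "('a, 'e::euclidean_space) chart set \<Rightarrow> ('b, 'f::euclidean_space) chart set \<Rightarrow>
   ('a \<Rightarrow> 'b) \<Rightarrow> 'a \<Rightarrow> ('a, 'e) tangent \<Rightarrow> ('b, 'f) tangent" where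
  "differential A B F p v = (\<lambda>c'. let c = (SOME c. c \<in> A \<and> p \<in> chart_dom c) in
     if c' \<in> B \<and> F p \<in> chart_dom c'
     then frechet_derivative (chart_map c' \<circ> F \<circ> chart_inv c) (at (chart_map c p)) (v c) else 0)"

section \<open>Riemannian metrics\<close>

type_synonym ('a, 'e) metric = "'a \<Rightarrow> ('a, 'e) tangent \<Rightarrow> ('a, 'e) tangent \<Rightarrow> real"

definition riemannian_metric ::
  "('a, 'e::euclidean_space) chart set \<Rightarrow> ('a, 'e) metric \<Rightarrow> bool" where
  "riemannian_metric A g \<longleftrightarrow>
     (\<forall>p. \<forall>u\<in>tangent_space A p. \<forall>v\<in>tangent_space A p. g p u v = g p v u) \<and>
     (\<forall>p. \<forall>u\<in>tangent_space A p. \<forall>v\<in>tangent_space A p. \<forall>w\<in>tangent_space A p. \<forall>a b.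
        g p (\<lambda>c. a *\<^sub>R u c + b *\<^sub>R v c) w = a * g p u w + b * g p v w) \<and>
     (\<forall>p. \<forall>u\<in>tangent_space A p. u \<noteq> (\<lambda>c. 0) \<longrightarrow> g p u u > 0) \<and>
     (\<forall>c\<in>A. \<forall>u v. smooth_on (chart_map c ` chart_dom c)
        (\<lambda>y. let p = chart_inv c y in g p (coord_vector A c p u) (coord_vector A c p v)))"

definition isometric ::
  "('a, 'e::euclidean_space) chart set \<Rightarrow> ('a, 'e) metric \<Rightarrow> ('a \<Rightarrow> 'a) \<Rightarrow> bool" where
  "isometric A g F \<longleftrightarrow> (\<forall>p. \<forall>u\<in>tangent_space A p. \<forall>v\<in>tangent_space A p.
     g (F p) (differential A A F p u) (differential A A F p v) = g p u v)"

definition left_invariant ::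
  "('a \<Rightarrow> 'a \<Rightarrow> 'a) \<Rightarrow> ('a, 'e::euclidean_space) chart set \<Rightarrow> ('a, 'e) metric \<Rightarrow> bool" where
  "left_invariant mul A g \<longleftrightarrow> (\<forall>a. isometric A g (\<lambda>x. mul a x))"

definition right_invariant ::
  "('a \<Rightarrow> 'a \<Rightarrow> 'a) \<Rightarrow> ('a, 'e::euclidean_space) chart set \<Rightarrow> ('a, 'e) metric \<Rightarrow> bool" where
  "right_invariant mul A g \<longleftrightarrow> (\<forall>a. isometric A g (\<lambda>x. mul x a))"

subsection \<open>The distance function\<close>

definition C1_curve ::
  "('a::topological_space, 'e::euclidean_space) chart set \<Rightarrow> real \<Rightarrow> real \<Rightarrow> (real \<Rightarrow> 'a) \<Rightarrow> bool" where
  "C1_curve A a b \<gamma> \<longleftrightarrow> continuous_on {a..b} \<gamma> \<and>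
     (\<forall>c\<in>A. \<exists>D. (\<forall>t\<in>{a..b} \<inter> \<gamma> -` chart_dom c.
                     ((chart_map c \<circ> \<gamma>) has_vector_derivative D t) (at t within {a..b})) \<and>
                 continuous_on ({a..b} \<inter> \<gamma> -` chart_dom c) D)"

definition piecewise_C1_curve ::
  "('a::topological_space, 'e::euclidean_space) chart set \<Rightarrow> (real \<Rightarrow> 'a) \<Rightarrow> bool" where
  "piecewise_C1_curve A \<gamma> \<longleftrightarrow> (\<exists>T. finite T \<and> {0, 1} \<subseteq> T \<and> T \<subseteq> {0..1} \<and>
     (\<forall>a\<in>T. \<forall>b\<in>T. a < b \<and> {a<..<b} \<inter> T = {} \<longrightarrow> C1_curve A a b \<gamma>))"

definition velocity ::
  "('a, 'e::euclidean_space) chart set \<Rightarrow> (real \<Rightarrow> 'a) \<Rightarrow> real \<Rightarrow> ('a, 'e) tangent" where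
  "velocity A \<gamma> t = (\<lambda>c. if c \<in> A \<and> \<gamma> t \<in> chart_dom c
     then vector_derivative (chart_map c \<circ> \<gamma>) (at t) else 0)"

text \<open>The velocity is meaningless at the finitely many break points of a piecewise \<open>C\<^sup>1\<close> curve,
  which the integral does not see.\<close>

definition curve_length ::
  "('a, 'e::euclidean_space) chart set \<Rightarrow> ('a, 'e) metric \<Rightarrow> (real \<Rightarrow> 'a) \<Rightarrow> real" where
  "curve_length A g \<gamma> =
     integral {0..1} (\<lambda>t. sqrt (g (\<gamma> t) (velocity A \<gamma> t) (velocity A \<gamma> t)))"

text \<open>For connected manifolds, where the infimum is over a nonempty set.\<close>

definition riemannian_distance ::
  "('a::topological_space, 'e::euclidean_space) chart set \<Rightarrow> ('a, 'e) metric \<Rightarrow> 'a \<Rightarrow> 'a \<Rightarrow> real" where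
  "riemannian_distance A g x y =
     Inf {curve_length A g \<gamma> | \<gamma>. piecewise_C1_curve A \<gamma> \<and> \<gamma> 0 = x \<and> \<gamma> 1 = y}"

subsection \<open>The Riemannian measure\<close>

definition gram_matrix ::
  "('a, real^'n) chart set \<Rightarrow> ('a, real^'n) metric \<Rightarrow> ('a, real^'n) chart \<Rightarrow> 'a \<Rightarrow> real^'n^'n" where
  "gram_matrix A g c p =
     (\<chi> i j. g p (coord_vector A c p (axis i 1)) (coord_vector A c p (axis j 1)))"

text \<open>The Riemannian measure is the Borel measure that is given by
  \<open>sqrt (det (g\<^sub>i\<^sub>j)) dx\<^sub>1 \<dots> dx\<^sub>n\<close> in every chart of the atlas. These conditions determine it uniquely,
  because countably many chart domains cover the manifold.\<close>

definition riemannian_measure ::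
  "('a::topological_space, real^'n) chart set \<Rightarrow> ('a, real^'n) metric \<Rightarrow> 'a measure \<Rightarrow> bool" where
  "riemannian_measure A g \<rho> \<longleftrightarrow> sets \<rho> = sets borel \<and>
     (\<forall>c\<in>A. \<forall>U\<in>sets borel. U \<subseteq> chart_dom c \<longrightarrow>
        emeasure \<rho> U = (\<integral>\<^sup>+y\<in>chart_map c ` U. ennreal (sqrt (det (gram_matrix A g c (chart_inv c y)))) \<partial>lborel))"

section \<open>Norms and averaging operators\<close>

text \<open>Powers with real exponent \<open>a \<ge> 0\<close>; used with \<open>a = 0\<close> only for bases in \<open>(0, \<infinity>)\<close>.\<close>

definition ennpowr :: "ennreal \<Rightarrow> real \<Rightarrow> ennreal" where
  "ennpowr x a = (if x = \<infinity> then (if a = 0 then 1 else \<infinity>) else ennreal (enn2real x powr a))"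

text \<open>The \<open>L\<^sub>q\<close>-norm of a function with values in \<open>[0, \<infinity>]\<close>, for \<open>1 \<le> q \<le> \<infinity>\<close>; the norm of a
  real-valued \<open>f\<close> is that of \<open>\<bar>f\<bar>\<close>.\<close>

definition Lq_norm :: "'a measure \<Rightarrow> ennreal \<Rightarrow> ('a \<Rightarrow> ennreal) \<Rightarrow> ennreal" where
  "Lq_norm M q F = (if q = \<infinity> then esssup M F
     else ennpowr (\<integral>\<^sup>+x. ennpowr (F x) (enn2real q) \<partial>M) (1 / enn2real q))"

definition dball :: "('a \<Rightarrow> 'a \<Rightarrow> real) \<Rightarrow> 'a \<Rightarrow> real \<Rightarrow> 'a set" where
  "dball d x r = {y. d x y < r}"

definition F_loc ::
  "('a::topological_space \<Rightarrow> 'a \<Rightarrow> real) \<Rightarrow> 'a measure \<Rightarrow> ('a \<Rightarrow> real) set" where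
  "F_loc d \<rho> = {f \<in> borel_measurable \<rho>.
     \<forall>U\<in>sets borel. (\<exists>x r. U \<subseteq> dball d x r) \<longrightarrow> (\<integral>\<^sup>+x\<in>U. ennreal \<bar>f x\<bar> \<partial>\<rho>) < \<infinity>}"

definition average ::
  "('a \<Rightarrow> 'a \<Rightarrow> real) \<Rightarrow> 'a measure \<Rightarrow> ('a \<Rightarrow> real) \<Rightarrow> 'a \<Rightarrow> real \<Rightarrow> ennreal" where
  "average d \<rho> f x r = (\<integral>\<^sup>+y\<in>dball d x r. ennreal \<bar>f y\<bar> \<partial>\<rho>) / emeasure \<rho> (dball d x r)"

text \<open>Weights are functions on \<open>(0, \<infinity>)\<close>; their values on \<open>(-\<infinity>, 0]\<close> are irrelevant.\<close>

definition weight_norm :: "(real \<Rightarrow> real) \<Rightarrow> ennreal" where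
  "weight_norm w = (\<integral>\<^sup>+r. ennreal (w r) \<partial>lebesgue_on {0<..})"

definition radius_weight :: "(real \<Rightarrow> real) \<Rightarrow> bool" where
  "radius_weight w \<longleftrightarrow> w \<in> borel_measurable (lebesgue_on {0<..}) \<and> (\<forall>r>0. w r \<ge> 0) \<and>
     weight_norm w < \<infinity> \<and> (AE r in lebesgue_on {0<..}. w r \<noteq> 0)"

definition I_op ::
  "('a \<Rightarrow> 'a \<Rightarrow> real) \<Rightarrow> 'a measure \<Rightarrow> ennreal \<Rightarrow> (real \<Rightarrow> real) \<Rightarrow> ('a \<Rightarrow> real) \<Rightarrow> 'a \<Rightarrow> ennreal" where
  "I_op d \<rho> p w f x =
     (if p = \<infinity> then esssup (density (lebesgue_on {0<..}) (\<lambda>r. ennreal (w r))) (average d \<rho> f x)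
      else ennpowr (\<integral>\<^sup>+r. ennreal (w r) * ennpowr (average d \<rho> f x r) (enn2real p) \<partial>lebesgue_on {0<..})
             (1 / enn2real p))"

end

theory Submission
  imports Defs
begin

text \<open>Left translations are isometries of \<open>d\<close>, so \<open>B(x, r) = x B(e, r)\<close>, and right translations
  preserve \<open>\<rho>\<close>. By Jensen's inequality the bound for a single radius reduces to
  \<open>\<integral> \<rho>(xB)\<inverse> d\<rho>(x) \<le> 1\<close>, the integral being over the \<open>x\<close> with \<open>y \<in> xB\<close>.
  Invariance of \<open>\<rho> \<times> \<rho>\<close> under \<open>(x, y) \<mapsto> (xy, x\<inverse>)\<close> gives
  \<open>\<rho>(B) \<integral> H d\<rho> = \<integral> H(x\<inverse>) \<rho>(x\<inverse>B) d\<rho>(x)\<close>; for \<open>H(x) = \<rho>(xB)\<inverse>\<close> on \<open>{x. y \<in> xB}\<close> the right-hand side is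
  at most \<open>\<rho>(By\<inverse>) = \<rho>(B)\<close>. This avoids the modular function and the uniqueness of Haar measure.
  Balls of measure \<open>0\<close> or \<open>\<infinity>\<close> are harmless, because their averages are \<open>0\<close> in \<open>ennreal\<close>
  (\<open>x / \<infinity> = 0\<close>, \<open>0 / 0 = 0\<close>); hence no compactness of balls is needed. A second application of
  Jensen's inequality, to the measure \<open>w(r) dr\<close>, yields the theorem.\<close>

section \<open>Powers and Jensen's inequality in the extended nonnegative reals\<close>

text \<open>In a unimodular group \<rho>(xB) = \<rho>(B), and the integral of \<rho>(xB)^{-1} over
  the x with y in xB is \<rho>(yB^{-1})/\<rho>(B) = 1. In general left translations rescale \<rho>
  and inversion distorts it; the two effects cancel, and the shear map shows this without computing
  either of them. Division by \<rho>(B) makes sense only for 0 < \<rho>(B) < \<infinity>; in the two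
  remaining cases the weight \<rho>(xB)^{-1}, read as 0 at the values 0 and \<infinity>, vanishes
  almost everywhere. Geometry has to supply that N(z) = d(e, z) is Borel and that \<rho> is
  sigma-finite and right invariant. Measurability of N comes from the openness of balls, hence from
  a bound for the length of short coordinate segments and from joining curves. Invariance of \<rho>
  is a change of variables in charts, where the density sqrt(det g) absorbs the Jacobian of an
  isometry.\<close>

lemma ennpowr_ennreal: "0 \<le> x \<Longrightarrow> ennpowr (ennreal x) a = ennreal (x powr a)"
  by (simp add: ennpowr_def)

lemma ennpowr_top: "0 < a \<Longrightarrow> ennpowr top a = top"
  by (simp add: ennpowr_def)

lemma ennpowr_mono: "x \<le> y \<Longrightarrow> 0 \<le> a \<Longrightarrow> ennpowr x a \<le> ennpowr y a"
proof (cases "x = top \<or> y = top")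
  case True
  assume *: "x \<le> y" "0 \<le> a"
  with True have y: "y = top" by (auto simp: top_unique)
  show ?thesis
  \<comment> \<open>With exponent 0 the values are 0 at the base 0, since
    \<open>0 powr 0 = 0\<close>, and 1 at every other base including \<open>top\<close>; so
    monotonicity survives.\<close>
  proof (cases "a = 0")
    case True
    then show ?thesis using y by (cases x) (auto simp: ennpowr_def powr_def intro: ennreal_leI)
  next
    case False
    then show ?thesis using y * by (simp add: ennpowr_top)
  qed
next
  case False
  assume *: "x \<le> y" "0 \<le> a"
  with False show ?thesis
    by (cases x; cases y) (auto simp: ennpowr_ennreal intro!: ennreal_leI powr_mono2)
qed

lemma ennpowr_mult: "0 < a \<Longrightarrow> ennpowr (x * y) a = ennpowr x a * ennpowr y a"
proof -
  assume a: "0 < a"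
  consider "x = 0" | "y = 0" | "x \<noteq> 0" "y \<noteq> 0" "x = top \<or> y = top" | "x \<noteq> top" "y \<noteq> top" by blast
  then show ?thesis
  proof cases
    case 3
    have "ennpowr z a \<noteq> 0" if "z \<noteq> 0" for z
      using a that by (cases z) (auto simp: ennpowr_ennreal ennpowr_top ennreal_eq_0_iff powr_def)
    from this[OF 3(1)] this[OF 3(2)] show ?thesis using 3 a
      by (elim disjE) (simp_all add: ennreal_top_mult ennreal_mult_top ennpowr_top)
  next
    case 4
    then show ?thesis
      by (cases x; cases y) (auto simp: ennpowr_ennreal powr_mult ennreal_mult[symmetric])
  qed (auto simp: ennpowr_def)
qed

lemma ennpowr_ennpowr: "0 < a \<Longrightarrow> 0 < b \<Longrightarrow> ennpowr (ennpowr x a) b = ennpowr x (a * b)"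
  by (cases x) (auto simp: ennpowr_ennreal ennpowr_top powr_powr)

lemma ennpowr_add: "0 < a \<Longrightarrow> 0 \<le> b \<Longrightarrow> ennpowr x (a + b) = ennpowr x a * ennpowr x b"
  by (cases x) (auto simp: ennpowr_def powr_add ennreal_mult ennreal_top_mult)

lemma ennpowr_one: "ennpowr x 1 = x"
  by (cases x) (auto simp: ennpowr_def)

lemma borel_measurable_ennpowr [measurable]: "(\<lambda>x. ennpowr x a) \<in> borel_measurable borel"
  unfolding ennpowr_def by (rule measurable_If) auto

text \<open>By convexity the graph of x^s lies above its tangent at m. The terms are arranged so
  that nothing is subtracted, because the inequality is going to be integrated in
  \<open>ennreal\<close>.\<close>

lemma powr_tangent:
  fixes x m s :: real
  assumes "0 \<le> x" "0 < m" "1 \<le> s"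
  shows "s * m powr (s - 1) * x \<le> x powr s + (s - 1) * m powr s"
proof (cases "x = 0")
  case True
  then show ?thesis using assms by simp
next
  case False
  \<comment> \<open>Dividing by m^s leaves Bernoulli's inequality 1 + s (t - 1) \<le> t^s.\<close>
  define t where "t = x / m"
  have t: "t > 0" using False assms by (simp add: t_def)
  have *: "1 + s * (t - 1) \<le> t powr s"
  proof (cases "1 + s * (t - 1) > 0")
    case True
    have "ln (1 + s * (t - 1)) \<le> s * ln t"
    proof -
      \<comment> \<open>Concavity of ln at t, written as the average of 1 + s (t - 1) and 1 with
        weights 1/s and 1 - 1/s.\<close>
      have "(1 - (1 - 1 / s)) * ln (1 + s * (t - 1)) + (1 - 1 / s) * ln 1
              \<le> ln ((1 - (1 - 1 / s)) *\<^sub>R (1 + s * (t - 1)) + (1 - 1 / s) *\<^sub>R 1)"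
        using True assms by (intro concave_onD[OF ln_concave]) (auto simp: field_simps)
      moreover have "(1 - (1 - 1 / s)) *\<^sub>R (1 + s * (t - 1)) + (1 - 1 / s) *\<^sub>R 1 = t"
        using assms by (simp add: field_simps)
      ultimately show ?thesis using assms by (simp add: field_simps)
    qed
    then have "exp (ln (1 + s * (t - 1))) \<le> exp (s * ln t)" by simp
    then show ?thesis using True t by (simp add: powr_def)
  next
    case False
    then show ?thesis by (smt (verit) powr_ge_zero)
  qed
  have "m powr s * (1 + s * (t - 1)) \<le> m powr s * t powr s"
    using * by (intro mult_left_mono) auto
  also have "\<dots> = x powr s" using assms t by (simp add: t_def powr_mult[symmetric])
  finally have "m powr s * (1 + s * (t - 1)) \<le> x powr s" .
  moreover have "m powr s = m powr (s - 1) * m"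
    using assms by (simp add: powr_mult_base[symmetric] mult.commute powr_diff)
  moreover have "m * t = x" using assms by (simp add: t_def)
  then have "m powr (s - 1) * m * (1 + s * (t - 1)) = s * m powr (s - 1) * x - (s - 1) * (m powr (s - 1) * m)"
    by (simp add: algebra_simps)
  ultimately show ?thesis by simp
qed

text \<open>Jensen's inequality for a measure of any finite mass V: the tangent inequality is
  integrated with the mean value of F as point of tangency, and V^{s-1} is the price of not
  normalising. The degenerate cases are split off so that this mean is a positive real
  number.\<close>

lemma nn_integral_power_mean:
  assumes [measurable]: "F \<in> borel_measurable M" and fin: "emeasure M (space M) < \<infinity>" and s: "1 \<le> s"
  shows "ennpowr (\<integral>\<^sup>+x. F x \<partial>M) s
    \<le> ennpowr (emeasure M (space M)) (s - 1) * (\<integral>\<^sup>+x. ennpowr (F x) s \<partial>M)"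
proof -
  define V where "V = enn2real (emeasure M (space M))"
  have V: "emeasure M (space M) = ennreal V" "0 \<le> V" using fin by (auto simp: V_def)
  consider "(\<integral>\<^sup>+x. F x \<partial>M) = 0" | "(\<integral>\<^sup>+x. ennpowr (F x) s \<partial>M) = top" "(\<integral>\<^sup>+x. F x \<partial>M) \<noteq> 0"
    | "(\<integral>\<^sup>+x. F x \<partial>M) \<noteq> 0" "(\<integral>\<^sup>+x. ennpowr (F x) s \<partial>M) \<noteq> top" by blast
  then show ?thesis
  proof cases
    case 1
    then show ?thesis using s by (simp add: ennpowr_def)
  next
    case 2
    have "V \<noteq> 0"
    proof
      assume "V = 0"
      then have "(\<integral>\<^sup>+x. F x \<partial>M) = 0" using V by (subst nn_integral_0_iff_AE) (auto intro!: AE_I[where N="space M"])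
      then show False using 2 by simp
    qed
    then show ?thesis using 2 V s by (simp add: ennpowr_ennreal ennreal_mult_top)
  next
    case 3
    have "V \<noteq> 0"
    proof
      assume "V = 0"
      then have "(\<integral>\<^sup>+x. F x \<partial>M) = 0" using V by (subst nn_integral_0_iff_AE) (auto intro!: AE_I[where N="space M"])
      then show False using 3 by simp
    qed
    with V have Vp: "V > 0" by simp
    \<comment> \<open>On a finite measure space F \<le> 1 + F^s makes F integrable, so the mean
      value is finite.\<close>
    have "(\<integral>\<^sup>+x. F x \<partial>M) \<le> (\<integral>\<^sup>+x. 1 + ennpowr (F x) s \<partial>M)"
    proof (rule nn_integral_mono)
      fix x
      show "F x \<le> 1 + ennpowr (F x) s"
      proof (cases "F x")
        case (real r)
        have "r \<le> 1 + r powr s"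
        proof (cases "r \<le> 1")
          case False
          then have "r powr 1 \<le> r powr s" using s by (intro powr_mono) auto
          then show ?thesis using False by simp
        qed (smt (verit) powr_ge_zero)
        then have "ennreal r \<le> ennreal (1 + r powr s)" by (rule ennreal_leI)
        then show ?thesis using real by (simp add: ennpowr_ennreal ennreal_plus)
      qed (use s in \<open>simp add: ennpowr_top\<close>)
    qed
    also have "\<dots> = emeasure M (space M) + (\<integral>\<^sup>+x. ennpowr (F x) s \<partial>M)"
      by (subst nn_integral_add) auto
    also have "\<dots> < top" using fin 3 by (simp add: less_top)
    finally obtain I where I: "(\<integral>\<^sup>+x. F x \<partial>M) = ennreal I" "0 \<le> I"
      by (metis less_top ennreal_cases less_irrefl)
    with 3 have Ip: "I > 0" by (cases "I = 0") auto
    obtain J where J: "(\<integral>\<^sup>+x. ennpowr (F x) s \<partial>M) = ennreal J" "0 \<le> J"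
      using 3 by (metis ennreal_cases)
    define m where "m = I / V"
    have m: "m > 0" using Ip Vp by (simp add: m_def)
    have "ennreal (s * m powr (s - 1)) * (\<integral>\<^sup>+x. F x \<partial>M) = (\<integral>\<^sup>+x. ennreal (s * m powr (s - 1)) * F x \<partial>M)"
      by (subst nn_integral_cmult) auto
    also have "\<dots> \<le> (\<integral>\<^sup>+x. ennpowr (F x) s + ennreal ((s - 1) * m powr s) \<partial>M)"
    proof (rule nn_integral_mono)
      fix x
      show "ennreal (s * m powr (s - 1)) * F x \<le> ennpowr (F x) s + ennreal ((s - 1) * m powr s)"
      proof (cases "F x")
        case (real r)
        then have "ennreal (s * m powr (s - 1) * r) \<le> ennreal (r powr s + (s - 1) * m powr s)"
          using powr_tangent m s by (intro ennreal_leI) auto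
        then show ?thesis using real s by (simp add: ennpowr_ennreal ennreal_plus ennreal_mult)
      qed (use s in \<open>simp add: ennpowr_top\<close>)
    qed
    also have "\<dots> = ennreal J + ennreal ((s - 1) * m powr s) * ennreal V"
      using V J by (subst nn_integral_add) auto
    finally have "ennreal (s * m powr (s - 1) * I) \<le> ennreal (J + (s - 1) * m powr s * V)"
      using I J V s by (simp add: ennreal_mult ennreal_plus)
    then have "s * m powr (s - 1) * I \<le> J + (s - 1) * m powr s * V"
      using J V s by (subst (asm) ennreal_le_iff) auto
    moreover have mm: "m powr s = m powr (s - 1) * m"
      using m by (simp add: powr_diff)
    moreover have "I = m * V" using Vp by (simp add: m_def)
    \<comment> \<open>The linear term s m^{s-1} I equals s m^s V and exceeds the constant term (s -
      1) m^s V by exactly m^s V.\<close>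
    ultimately have "m powr s * V \<le> J" by (simp add: algebra_simps)
    then have "V powr (s - 1) * (m powr s * V) \<le> V powr (s - 1) * J"
      by (intro mult_left_mono) auto
    moreover have "V powr (s - 1) * (m powr s * V) = I powr s"
    proof -
      have "m powr s * V powr s = I powr s"
        using Vp m by (simp add: powr_mult[symmetric] m_def)
      moreover have "V powr (s - 1) * V = V powr s" using Vp by (simp add: powr_diff)
      then have "V powr (s - 1) * (m powr s * V) = V powr s * m powr s"
        by (simp add: ac_simps)
      ultimately show ?thesis by (simp add: mult.commute)
    qed
    ultimately have "ennreal (I powr s) \<le> ennreal (V powr (s - 1) * J)" by (intro ennreal_leI) simp
    then show ?thesis using I J V by (simp add: ennpowr_ennreal ennreal_mult)
  qed
qed

section \<open>Averages over left translates of a set\<close>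

text \<open>The interface between geometry and averaging. Sigma-finiteness is there for Fubini,
  second countability makes the continuous group operations jointly Borel measurable, and the
  invariance is stated with preimages to match \<open>distr\<close>.\<close>

locale right_haar = group mul e iv + sigma_finite_measure \<rho>
  for mul :: "'a \<Rightarrow> 'a \<Rightarrow> 'a::second_countable_topology" and e iv and \<rho> :: "'a measure" +
  assumes sets_rho [measurable_cong]: "sets \<rho> = sets borel"
    and continuous_mul: "continuous_on UNIV (\<lambda>(x, y). mul x y)"
    and continuous_iv: "continuous_on UNIV iv"
    and right_invariance: "U \<in> sets borel \<Longrightarrow> emeasure \<rho> ((\<lambda>x. mul x a) -` U) = emeasure \<rho> U"
begin

lemma space_rho [simp]: "space \<rho> = UNIV"
  using sets_eq_imp_space_eq[OF sets_rho] by simp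

lemma measurable_mul [measurable (raw)]:
  "f \<in> borel_measurable M \<Longrightarrow> g \<in> borel_measurable M \<Longrightarrow> (\<lambda>x. mul (f x) (g x)) \<in> borel_measurable M"
  by (rule borel_measurable_continuous_Pair[where H=mul])
    (use continuous_mul in \<open>simp_all only: case_prod_beta'\<close>)

lemma measurable_iv [measurable (raw)]:
  "f \<in> borel_measurable M \<Longrightarrow> (\<lambda>x. iv (f x)) \<in> borel_measurable M"
  using borel_measurable_continuous_onI[OF continuous_iv] by measurable

lemma nn_integral_right_translate:
  assumes [measurable]: "F \<in> borel_measurable borel"
  shows "(\<integral>\<^sup>+x. F (mul x a) \<partial>\<rho>) = (\<integral>\<^sup>+x. F x \<partial>\<rho>)"
proof -
  have "distr \<rho> borel (\<lambda>x. mul x a) = \<rho>"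
    by (rule measure_eqI) (auto simp: sets_rho emeasure_distr right_invariance)
  then have "(\<integral>\<^sup>+x. F x \<partial>\<rho>) = (\<integral>\<^sup>+x. F x \<partial>distr \<rho> borel (\<lambda>x. mul x a))" by simp
  also have "\<dots> = (\<integral>\<^sup>+x. F (mul x a) \<partial>\<rho>)" by (subst nn_integral_distr) auto
  finally show ?thesis ..
qed

lemma Fubini_rho:
  assumes "(\<lambda>(x, y). F x y) \<in> borel_measurable (borel \<Otimes>\<^sub>M borel)"
  shows "(\<integral>\<^sup>+x. \<integral>\<^sup>+y. F x y \<partial>\<rho> \<partial>\<rho>) = (\<integral>\<^sup>+y. \<integral>\<^sup>+x. F x y \<partial>\<rho> \<partial>\<rho>)"
proof -
  interpret pair_sigma_finite \<rho> \<rho> ..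
  have "(\<lambda>(x, y). F x y) \<in> borel_measurable (\<rho> \<Otimes>\<^sub>M \<rho>)"
    using assms by measurable
  from Fubini'[OF this] show ?thesis ..
qed

text \<open>The map \<open>(x, y) \<mapsto> (xy, x\<inverse>)\<close> preserves \<open>\<rho> \<times> \<rho>\<close>, because it is composed of right
  translations in one variable by an element that depends on the other.\<close>

lemma nn_integral_shear:
  assumes [measurable]: "(\<lambda>(x, y). F x y) \<in> borel_measurable (borel \<Otimes>\<^sub>M borel)"
  shows "(\<integral>\<^sup>+x. \<integral>\<^sup>+y. F x y \<partial>\<rho> \<partial>\<rho>) = (\<integral>\<^sup>+x. \<integral>\<^sup>+y. F (mul x y) (iv x) \<partial>\<rho> \<partial>\<rho>)"
proof -
  have "(\<integral>\<^sup>+x. \<integral>\<^sup>+y. F x y \<partial>\<rho> \<partial>\<rho>) = (\<integral>\<^sup>+x. \<integral>\<^sup>+y. F x (mul y (iv x)) \<partial>\<rho> \<partial>\<rho>)"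
    by (subst nn_integral_right_translate) auto
  also have "\<dots> = (\<integral>\<^sup>+y. \<integral>\<^sup>+x. F x (mul y (iv x)) \<partial>\<rho> \<partial>\<rho>)"
    by (rule Fubini_rho) measurable
  also have "\<dots> = (\<integral>\<^sup>+y. \<integral>\<^sup>+x. F (mul x y) (mul y (iv (mul x y))) \<partial>\<rho> \<partial>\<rho>)"
    by (rule nn_integral_cong, rule nn_integral_right_translate[symmetric]) measurable
  also have "\<dots> = (\<integral>\<^sup>+y. \<integral>\<^sup>+x. F (mul x y) (iv x) \<partial>\<rho> \<partial>\<rho>)"
    by (simp add: inverse_distrib_swap assoc[symmetric])
  also have "\<dots> = (\<integral>\<^sup>+x. \<integral>\<^sup>+y. F (mul x y) (iv x) \<partial>\<rho> \<partial>\<rho>)"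
    by (rule Fubini_rho) measurable
  finally show ?thesis .
qed

text \<open>The measure \<rho>(xB), since y lies in xB iff \<open>mul (iv x) y\<close> lies in B.
  Written as an integral with parameter x, it is visibly measurable in x.\<close>

definition left_translate_measure :: "'a set \<Rightarrow> 'a \<Rightarrow> ennreal" where
  "left_translate_measure B x = (\<integral>\<^sup>+y. indicator B (mul (iv x) y) \<partial>\<rho>)"

lemma left_translate_measure_eq:
  "B \<in> sets borel \<Longrightarrow> left_translate_measure B x = emeasure \<rho> {y. mul (iv x) y \<in> B}"
proof -
  assume [measurable]: "B \<in> sets borel"
  have "left_translate_measure B x = (\<integral>\<^sup>+y. indicator {y. mul (iv x) y \<in> B} y \<partial>\<rho>)"
    unfolding left_translate_measure_def by (simp add: indicator_def)
  also have "\<dots> = emeasure \<rho> {y. mul (iv x) y \<in> B}"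
    by (rule nn_integral_indicator) (use sets_rho in measurable)
  finally show ?thesis .
qed

lemma measurable_left_translate_measure [measurable]:
  assumes [measurable]: "B \<in> sets borel"
  shows "left_translate_measure B \<in> borel_measurable borel"
  unfolding left_translate_measure_def[abs_def] by measurable

text \<open>The shear is applied to the product of 1_B(x) and H(y). It turns the integrand into
  1_B(xy) H(x^{-1}), whose inner integral over y is H(x^{-1}) \<rho>(x^{-1}B).\<close>

lemma nn_integral_left_translate_measure:
  assumes [measurable]: "B \<in> sets borel" "H \<in> borel_measurable borel"
  shows "emeasure \<rho> B * (\<integral>\<^sup>+x. H x \<partial>\<rho>) = (\<integral>\<^sup>+x. H (iv x) * left_translate_measure B (iv x) \<partial>\<rho>)"
proof -
  have "emeasure \<rho> B * (\<integral>\<^sup>+x. H x \<partial>\<rho>) = (\<integral>\<^sup>+x. indicator B x * (\<integral>\<^sup>+y. H y \<partial>\<rho>) \<partial>\<rho>)"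
    by (subst nn_integral_multc) (auto simp: sets_rho)
  also have "\<dots> = (\<integral>\<^sup>+x. \<integral>\<^sup>+y. indicator B x * H y \<partial>\<rho> \<partial>\<rho>)"
    by (subst nn_integral_cmult) auto
  also have "\<dots> = (\<integral>\<^sup>+x. \<integral>\<^sup>+y. indicator B (mul x y) * H (iv x) \<partial>\<rho> \<partial>\<rho>)"
    by (rule nn_integral_shear) measurable
  also have "\<dots> = (\<integral>\<^sup>+x. H (iv x) * left_translate_measure B (iv x) \<partial>\<rho>)"
    unfolding left_translate_measure_def
    by (subst nn_integral_multc) (auto simp: mult.commute)
  finally show ?thesis .
qed

text \<open>Unlike \<open>inverse\<close>, this is 0 at translates of measure 0. Hence its product
  with \<rho>(xB) never exceeds 1, and null translates, like infinite ones, carry no weight.\<close>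

definition inv_measure :: "'a set \<Rightarrow> 'a \<Rightarrow> ennreal" where
  "inv_measure B x = (if 0 < left_translate_measure B x then inverse (left_translate_measure B x) else 0)"

lemma measurable_inv_measure [measurable]:
  assumes [measurable]: "B \<in> sets borel"
  shows "inv_measure B \<in> borel_measurable borel"
  unfolding inv_measure_def[abs_def] by measurable

lemma inv_measure_mult_le_1: "inv_measure B x * left_translate_measure B x \<le> 1"
  by (cases "left_translate_measure B x = top")
    (auto simp: inv_measure_def ennreal_divide_times divide_ennreal_def[symmetric] ennreal_divide_self mult.commute less_top)

text \<open>Inversion preserves null functions: for B = UNIV the preceding identity reads \<rho>(G)
  \<integral> F(x) d\<rho>(x) = \<rho>(G) \<integral> F(x^{-1}) d\<rho>(x). A product that is 0 has
  a factor 0, also when \<rho>(G) = \<infinity>, and \<rho>(G) = 0 makes every integral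
  vanish.\<close>

lemma nn_integral_iv_eq_0:
  assumes [measurable]: "F \<in> borel_measurable borel" and "(\<integral>\<^sup>+x. F (iv x) \<partial>\<rho>) = 0"
  shows "(\<integral>\<^sup>+x. F x \<partial>\<rho>) = 0"
proof -
  have "emeasure \<rho> UNIV * (\<integral>\<^sup>+x. F x \<partial>\<rho>) = (\<integral>\<^sup>+x. F (iv x) * emeasure \<rho> UNIV \<partial>\<rho>)"
    by (subst nn_integral_left_translate_measure) (auto simp: left_translate_measure_eq)
  also have "\<dots> = 0" using assms by (subst nn_integral_multc) auto
  finally have "emeasure \<rho> (space \<rho>) = 0 \<or> ?thesis" by simp
  then show ?thesis by (auto simp: nn_integral_0_iff_AE intro!: AE_I[where N=UNIV])
qed

text \<open>For 0 < \<rho>(B) < \<infinity> the factor \<rho>(B) can be cancelled. If \<rho>(B) is 0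
  or \<infinity>, so is \<rho>(xB) for almost every x, and the weight \<open>inv_measure B\<close>
  vanishes almost everywhere.\<close>

lemma nn_integral_inv_measure_le_1:
  assumes [measurable]: "B \<in> sets borel"
  shows "(\<integral>\<^sup>+x. inv_measure B x * indicator B (mul (iv x) y) \<partial>\<rho>) \<le> 1"
proof -
  consider "emeasure \<rho> B = 0" | "emeasure \<rho> B = top" | "emeasure \<rho> B \<noteq> 0" "emeasure \<rho> B \<noteq> top" by blast
  then show ?thesis
  proof cases
    case 1
    \<comment> \<open>The choice H = 1 shows that \<rho>(x^{-1}B) = 0 for almost every x; the next
      line removes the inversion.\<close>
    have "(\<integral>\<^sup>+x. left_translate_measure B (iv x) \<partial>\<rho>) = 0"
      using nn_integral_left_translate_measure[of B "\<lambda>_. 1"] 1 by simp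
    then have "(\<integral>\<^sup>+x. left_translate_measure B x \<partial>\<rho>) = 0" by (rule nn_integral_iv_eq_0[rotated]) measurable
    then have "AE x in \<rho>. left_translate_measure B x = 0" by (subst (asm) nn_integral_0_iff_AE) auto
    then have "AE x in \<rho>. inv_measure B x * indicator B (mul (iv x) y) = 0" by (auto simp: inv_measure_def)
    then have "(\<integral>\<^sup>+x. inv_measure B x * indicator B (mul (iv x) y) \<partial>\<rho>) = 0" by (subst nn_integral_0_iff_AE) auto
    then show ?thesis by simp
  next
    case 2
    obtain D :: "nat \<Rightarrow> 'a set" where D: "range D \<subseteq> sets \<rho>" "(\<Union>i. D i) = space \<rho>" "\<And>i. emeasure \<rho> (D i) \<noteq> \<infinity>"
      using sigma_finite by blast
    have [measurable]: "D i \<in> sets borel" for i using D sets_rho by auto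
    \<comment> \<open>With the factor \<rho>(B) = \<infinity> on the left, a finite right-hand side
      forces the integral of H to be 0. Cutting H off to those x with x^{-1} in \<open>D i\<close>
      bounds the right-hand side by the finite measure of \<open>D i\<close>, and these sets exhaust
      the group.\<close>
    have "AE x in \<rho>. inv_measure B x * indicator (D i) (iv x) = 0" for i
    proof -
      have "top * (\<integral>\<^sup>+x. inv_measure B x * indicator (D i) (iv x) \<partial>\<rho>) =
        (\<integral>\<^sup>+x. inv_measure B (iv x) * indicator (D i) x * left_translate_measure B (iv x) \<partial>\<rho>)"
        using nn_integral_left_translate_measure[of B "\<lambda>x. inv_measure B x * indicator (D i) (iv x)"] 2 by simp
      also have "\<dots> \<le> (\<integral>\<^sup>+x. indicator (D i) x \<partial>\<rho>)"
        using inv_measure_mult_le_1 by (intro nn_integral_mono) (auto simp: indicator_def)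
      also have "\<dots> = emeasure \<rho> (D i)" using sets_rho by simp
      also have "\<dots> < top" using D by (simp add: less_top)
      finally have "(\<integral>\<^sup>+x. inv_measure B x * indicator (D i) (iv x) \<partial>\<rho>) = 0"
        by (auto simp: ennreal_top_mult split: if_splits)
      then show ?thesis by (subst (asm) nn_integral_0_iff_AE) auto
    qed
    then have "AE x in \<rho>. \<forall>i. inv_measure B x * indicator (D i) (iv x) = 0" by (subst AE_all_countable) blast
    then have "AE x in \<rho>. inv_measure B x * indicator B (mul (iv x) y) = 0"
    proof (rule AE_mp, intro AE_I2 impI)
      fix x assume *: "\<forall>i. inv_measure B x * indicator (D i) (iv x) = 0"
      have "iv x \<in> (\<Union>i. D i)" using D(2) by simp
      then obtain i where "iv x \<in> D i" by blast
      with * have "inv_measure B x = 0" by (auto dest!: spec[of _ i])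
      then show "inv_measure B x * indicator B (mul (iv x) y) = 0" by simp
    qed
    then have "(\<integral>\<^sup>+x. inv_measure B x * indicator B (mul (iv x) y) \<partial>\<rho>) = 0" by (subst nn_integral_0_iff_AE) auto
    then show ?thesis by simp
  next
    case 3
    have "emeasure \<rho> B * (\<integral>\<^sup>+x. inv_measure B x * indicator B (mul (iv x) y) \<partial>\<rho>) =
      (\<integral>\<^sup>+x. inv_measure B (iv x) * indicator B (mul x y) * left_translate_measure B (iv x) \<partial>\<rho>)"
      by (subst nn_integral_left_translate_measure) auto
    also have "\<dots> \<le> (\<integral>\<^sup>+x. indicator B (mul x y) \<partial>\<rho>)"
      using inv_measure_mult_le_1 by (intro nn_integral_mono) (auto simp: indicator_def)
    also have "\<dots> = (\<integral>\<^sup>+x. indicator B x \<partial>\<rho>)" by (rule nn_integral_right_translate) measurable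
    also have "\<dots> = emeasure \<rho> B * 1" using sets_rho by simp
    finally show ?thesis using 3 by (subst (asm) ennreal_mult_le_mult_iff) (auto simp: less_top)
  qed
qed

section \<open>Bounds for averages over xB\<close>

definition translate_average :: "'a set \<Rightarrow> ('a \<Rightarrow> ennreal) \<Rightarrow> 'a \<Rightarrow> ennreal" where
  "translate_average B g x =
     (\<integral>\<^sup>+y. g y * indicator B (mul (iv x) y) \<partial>\<rho>) / left_translate_measure B x"

text \<open>Jensen's inequality for \<rho> restricted to xB, of mass m: its factor m^{s-1} meets
  m^{-s} from the normalisation of the average, and 1/m remains. The weight stays inside the
  integral, ready for Fubini.\<close>

lemma translate_average_power_le:
  assumes [measurable]: "B \<in> sets borel" "g \<in> borel_measurable borel" and s: "1 \<le> s"
  shows "ennpowr (translate_average B g x) s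
    \<le> (\<integral>\<^sup>+y. inv_measure B x * (ennpowr (g y) s * indicator B (mul (iv x) y)) \<partial>\<rho>)"
proof -
  define m where "m = left_translate_measure B x"
  define M where "M = density \<rho> (\<lambda>y. indicator B (mul (iv x) y))"
  have m: "emeasure M (space M) = m"
    unfolding M_def m_def left_translate_measure_def by (subst emeasure_density) (auto simp: sets_rho)
  have g: "(\<integral>\<^sup>+y. h y * indicator B (mul (iv x) y) \<partial>\<rho>) = (\<integral>\<^sup>+y. h y \<partial>M)"
    if [measurable]: "h \<in> borel_measurable borel" for h :: "'a \<Rightarrow> ennreal"
    unfolding M_def by (subst nn_integral_density) (auto simp: mult.commute)
  have [measurable_cong]: "sets M = sets borel" by (simp add: M_def sets_rho)
  consider "m = 0" | "m = top" | "m \<noteq> 0" "m < top" by (metis less_top)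
  then show ?thesis
  proof cases
    case 1
    then have "(\<integral>\<^sup>+y. g y \<partial>M) = 0"
      using m by (subst nn_integral_0_iff_AE) (auto intro!: AE_I[where N="space M"])
    then show ?thesis using s by (simp add: translate_average_def g ennpowr_def)
  next
    case 2
    then show ?thesis using s by (simp add: translate_average_def m_def[symmetric] ennpowr_def)
  next
    case 3
    obtain v where v: "m = ennreal v" "v > 0" using 3 by (cases m) (auto simp: less_le)
    have iv: "inverse m = ennreal (inverse v)" using v by (simp add: inverse_ennreal)
    have "ennpowr (translate_average B g x) s = ennpowr ((\<integral>\<^sup>+y. g y \<partial>M) * inverse m) s"
      by (simp add: translate_average_def g m_def divide_ennreal_def)
    also have "\<dots> = ennpowr (\<integral>\<^sup>+y. g y \<partial>M) s * ennpowr (inverse m) s"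
      using s by (intro ennpowr_mult) simp
    also have "\<dots> \<le> (ennpowr m (s - 1) * (\<integral>\<^sup>+y. ennpowr (g y) s \<partial>M)) * ennpowr (inverse m) s"
      unfolding m[symmetric] using 3 m s by (intro mult_right_mono nn_integral_power_mean) auto
    also have "\<dots> = (ennpowr m (s - 1) * ennpowr (inverse m) s) * (\<integral>\<^sup>+y. ennpowr (g y) s \<partial>M)"
      by (simp add: ac_simps)
    also have "ennpowr m (s - 1) * ennpowr (inverse m) s = inverse m"
    proof -
      have "v powr (s - 1) * inverse v powr s = inverse v"
        using v by (simp add: powr_diff inverse_eq_divide powr_divide)
      then show ?thesis unfolding iv using v by (simp add: ennpowr_ennreal ennreal_mult[symmetric])
    qed
    also have "inverse m = inv_measure B x" using 3 by (simp add: inv_measure_def m_def)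
    also have "(\<integral>\<^sup>+y. ennpowr (g y) s \<partial>M) = (\<integral>\<^sup>+y. ennpowr (g y) s * indicator B (mul (iv x) y) \<partial>\<rho>)"
      by (rule g[symmetric]) measurable
    also have "inv_measure B x * \<dots> = (\<integral>\<^sup>+y. inv_measure B x * (ennpowr (g y) s * indicator B (mul (iv x) y)) \<partial>\<rho>)"
      by (rule nn_integral_cmult[symmetric]) measurable
    finally show ?thesis .
  qed
qed

lemma nn_integral_translate_average_power_le:
  assumes [measurable]: "B \<in> sets borel" "g \<in> borel_measurable borel" and s: "1 \<le> s"
  shows "(\<integral>\<^sup>+x. ennpowr (translate_average B g x) s \<partial>\<rho>) \<le> (\<integral>\<^sup>+y. ennpowr (g y) s \<partial>\<rho>)"
proof -
  have "(\<integral>\<^sup>+x. ennpowr (translate_average B g x) s \<partial>\<rho>)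
    \<le> (\<integral>\<^sup>+x. \<integral>\<^sup>+y. inv_measure B x * (ennpowr (g y) s * indicator B (mul (iv x) y)) \<partial>\<rho> \<partial>\<rho>)"
    by (intro nn_integral_mono translate_average_power_le assms)
  also have "\<dots> = (\<integral>\<^sup>+y. \<integral>\<^sup>+x. inv_measure B x * (ennpowr (g y) s * indicator B (mul (iv x) y)) \<partial>\<rho> \<partial>\<rho>)"
    by (rule Fubini_rho) measurable
  also have "\<dots> = (\<integral>\<^sup>+y. ennpowr (g y) s * (\<integral>\<^sup>+x. inv_measure B x * indicator B (mul (iv x) y) \<partial>\<rho>) \<partial>\<rho>)"
    by (subst nn_integral_cmult[symmetric]) (auto simp: ac_simps)
  also have "\<dots> \<le> (\<integral>\<^sup>+y. ennpowr (g y) s * 1 \<partial>\<rho>)"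
    by (intro nn_integral_mono mult_left_mono nn_integral_inv_measure_le_1) auto
  finally show ?thesis by simp
qed

text \<open>The bound holds at every x, because the exceptional null set of y is invisible to the
  integral defining the average.\<close>

lemma translate_average_le:
  assumes [measurable]: "B \<in> sets borel" "g \<in> borel_measurable borel" and "AE y in \<rho>. g y \<le> c"
  shows "translate_average B g x \<le> c"
proof -
  define m where "m = left_translate_measure B x"
  have "(\<integral>\<^sup>+y. g y * indicator B (mul (iv x) y) \<partial>\<rho>) \<le> (\<integral>\<^sup>+y. c * indicator B (mul (iv x) y) \<partial>\<rho>)"
    using assms(3) by (intro nn_integral_mono_AE, elim AE_mp) (auto intro!: AE_I2 mult_right_mono)
  also have "\<dots> = c * m"
    unfolding m_def left_translate_measure_def by (rule nn_integral_cmult) measurable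
  finally have "translate_average B g x \<le> c * m / m"
    unfolding translate_average_def m_def by (rule divide_right_mono_ennreal)
  also have "\<dots> \<le> c"
  proof -
    consider "m = 0" | "m = top" | "m \<noteq> 0" "m \<noteq> top" by blast
    then show ?thesis
      by cases (auto simp: ennreal_mult_divide_eq)
  qed
  finally show ?thesis .
qed

end

section \<open>The averaging operators\<close>

lemma borel_measurable_lebesgue_on_id: "(\<lambda>r::real. r) \<in> borel_measurable (lebesgue_on S)"
  by (intro measurable_restrict_space1 measurable_completion) simp

text \<open>The condition \<open>esssup W (a x) \<le> z\<close> says that the set of r with
  \<open>a x r > z\<close> is a null set, that is, that a certain integral with parameter x
  vanishes. Such integrals are measurable in x.\<close>

lemma measurable_esssup:
  fixes a :: "'a \<Rightarrow> 'b \<Rightarrow> ennreal"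
  assumes "sigma_finite_measure W" and [measurable]: "(\<lambda>(x, r). a x r) \<in> borel_measurable (M \<Otimes>\<^sub>M W)"
  shows "(\<lambda>x. esssup W (a x)) \<in> borel_measurable M"
proof (rule borel_measurableI_le)
  interpret sigma_finite_measure W by fact
  fix z
  have "esssup W (a x) \<le> z \<longleftrightarrow> (\<integral>\<^sup>+r. (if z < a x r then 1 else 0) \<partial>W) = 0" if "x \<in> space M" for x
  proof -
    have [measurable]: "a x \<in> borel_measurable W"
      using measurable_Pair2[OF assms(2) that] by simp
    have "esssup W (a x) \<le> z \<longleftrightarrow> (AE r in W. a x r \<le> z)"
    proof
      assume "esssup W (a x) \<le> z"
      with esssup_AE[of "a x" W] show "AE r in W. a x r \<le> z" by (auto elim!: AE_mp)
    qed (rule esssup_I, measurable)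
    also have "\<dots> \<longleftrightarrow> (\<integral>\<^sup>+r. (if z < a x r then 1 else 0) \<partial>W) = 0"
      by (subst nn_integral_0_iff_AE) (auto simp: not_less intro!: AE_cong split: if_splits)
    finally show ?thesis .
  qed
  then have "{x \<in> space M. esssup W (a x) \<le> z} = {x \<in> space M. (\<integral>\<^sup>+r. (if z < a x r then 1 else 0) \<partial>W) \<le> 0}"
    by auto
  also have "\<dots> \<in> sets M" by measurable
  finally show "{x \<in> space M. esssup W (a x) \<le> z} \<in> sets M" .
qed

text \<open>Wanted for p = \<infinity>, where the constant is
  \<open>ennpowr (weight_norm w) 0\<close>. This is 1 only for a nonzero base, as
  \<open>0 powr 0 = 0\<close>.\<close>

lemma weight_norm_pos: "radius_weight w \<Longrightarrow> 0 < weight_norm w"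
proof (rule ccontr)
  assume w: "radius_weight w" and "\<not> 0 < weight_norm w"
  then have [measurable]: "w \<in> borel_measurable (lebesgue_on {0<..})"
    and "(\<integral>\<^sup>+r. ennreal (w r) \<partial>lebesgue_on {0<..}) = 0"
    by (auto simp: radius_weight_def weight_norm_def)
  then have "AE r in lebesgue_on {0<..}. ennreal (w r) = 0"
    by (subst (asm) nn_integral_0_iff_AE) auto
  moreover have "AE r in lebesgue_on {0<..}. w r \<noteq> 0" using w by (simp add: radius_weight_def)
  moreover have "AE r in lebesgue_on {0<..}. 0 \<le> w r" using w by (auto simp: radius_weight_def)
  ultimately have "AE r in lebesgue_on {0<..}. ennreal (w r) = 0 \<and> w r \<noteq> 0 \<and> 0 \<le> w r"
    by (intro AE_conjI)
  then have "AE r::real in lebesgue_on {0<..}. False"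
    by (rule AE_mp) (auto intro!: AE_I2 simp: ennreal_eq_0_iff)
  then have "emeasure lebesgue {0::real<..} = 0"
    using emeasure_eq_0_AE[of "\<lambda>_. True" "lebesgue_on {0::real<..}"] by (simp add: emeasure_restrict_space greaterThan_def[symmetric])
  moreover have "emeasure lebesgue {0::real<..<1} \<le> emeasure lebesgue {0::real<..}"
    by (rule emeasure_mono) auto
  ultimately show False by simp
qed

section \<open>The norm inequality for a left-invariant distance\<close>

context right_haar
begin

text \<open>Here d is known only through N: the ball around x is the left translate by x of {z. N z
  < r}. For finite q, Jensen over the radii comes before the bound for a single radius, with Fubini
  in between.\<close>

lemma Lq_norm_I_op_le:
  fixes N :: "'a \<Rightarrow> real" and f :: "'a \<Rightarrow> real"
  assumes d: "\<And>x y. d x y = N (mul (iv x) y)" and N [measurable]: "N \<in> borel_measurable borel"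
    and w: "radius_weight w" and f: "f \<in> borel_measurable \<rho>" and p: "1 \<le> p" and pq: "p \<le> q"
  shows "Lq_norm \<rho> q (I_op d \<rho> p w f) \<le>
         ennpowr (weight_norm w) (enn2real (1 / p)) * Lq_norm \<rho> q (\<lambda>x. ennreal \<bar>f x\<bar>)"
proof -
  define g where "g = (\<lambda>y. ennreal \<bar>f y\<bar>)"
  define W where "W = density (lebesgue_on {0<..}) (\<lambda>r. ennreal (w r))"
  define V where "V = weight_norm w"
  define a where "a = average d \<rho> f"
  have [measurable]: "f \<in> borel_measurable borel" using f by (simp cong: measurable_cong_sets add: sets_rho)
  have [measurable]: "g \<in> borel_measurable borel" unfolding g_def by measurable
  have [measurable]: "{z. N z < r} \<in> sets borel" for r by measurable
  have wm [measurable]: "w \<in> borel_measurable (lebesgue_on {0<..})" using w by (simp add: radius_weight_def)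
  have V: "V < \<infinity>" "V \<noteq> 0" using w weight_norm_pos[OF w] by (auto simp: radius_weight_def V_def)
  have sW [measurable_cong]: "sets W = sets (lebesgue_on {0<..})" by (simp add: W_def)
  have WV: "emeasure W (space W) = V"
    unfolding W_def V_def weight_norm_def by (subst emeasure_density) (auto intro!: nn_integral_cong)
  interpret W: finite_measure W by standard (use V WV in auto)
  interpret pair_sigma_finite \<rho> W ..
  have dball: "{y. mul (iv x) y \<in> {z. N z < r}} = dball d x r" for x r
    by (auto simp: dball_def d)
  have a_eq: "a x r = translate_average {z. N z < r} g x" for x r
    unfolding a_def average_def translate_average_def g_def
    by (subst left_translate_measure_eq) (auto simp: dball dball_def d indicator_def intro!: arg_cong2[where f="(/)"] nn_integral_cong)
  \<comment> \<open>The condition \<open>N (mul (iv x) y) < r\<close> is Borel in all three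
    variables. The resulting measurability for Borel sets of radii is then pulled back to
    \<open>W\<close>, whose sigma-algebra consists of Lebesgue sets.\<close>
  have am [measurable]: "(\<lambda>(x, r). a x r) \<in> borel_measurable (\<rho> \<Otimes>\<^sub>M W)"
  proof -
    have "(\<lambda>(x, r). (\<integral>\<^sup>+y. g y * (if N (mul (iv x) y) < r then 1 else 0) \<partial>\<rho>) /
        (\<integral>\<^sup>+y. (if N (mul (iv x) y) < r then 1 else 0) \<partial>\<rho>)) \<in> borel_measurable (borel \<Otimes>\<^sub>M borel)"
      by measurable
    also have "(\<lambda>(x, r). (\<integral>\<^sup>+y. g y * (if N (mul (iv x) y) < r then 1 else 0) \<partial>\<rho>) /
        (\<integral>\<^sup>+y. (if N (mul (iv x) y) < r then 1 else 0) \<partial>\<rho>)) = (\<lambda>(x, r). a x r)"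
      by (simp add: a_eq translate_average_def left_translate_measure_def indicator_def of_bool_def fun_eq_iff)
    finally have [measurable]: "(\<lambda>(x, r). a x r) \<in> borel_measurable (borel \<Otimes>\<^sub>M borel)" .
    have "(\<lambda>r. r) \<in> borel_measurable W"
      using borel_measurable_lebesgue_on_id by (simp cong: measurable_cong_sets add: sW)
    from measurable_compose[OF measurable_snd this]
    have [measurable]: "(\<lambda>z. snd z) \<in> borel_measurable (\<rho> \<Otimes>\<^sub>M W)" .
    have "(\<lambda>z. (fst z, snd z)) \<in> \<rho> \<Otimes>\<^sub>M W \<rightarrow>\<^sub>M borel \<Otimes>\<^sub>M borel"
      by (rule measurable_Pair[OF _ \<open>snd \<in> borel_measurable (\<rho> \<Otimes>\<^sub>M W)\<close>]) measurable
    from measurable_compose[OF this \<open>(\<lambda>(x, r). a x r) \<in> borel_measurable (borel \<Otimes>\<^sub>M borel)\<close>]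
    show ?thesis by simp
  qed
  have am1 [measurable]: "a x \<in> borel_measurable W" for x
    using measurable_Pair2[OF am] by simp
  have am2 [measurable]: "(\<lambda>x. a x r) \<in> borel_measurable \<rho>" for r
    unfolding a_eq translate_average_def by measurable
  have am1' [measurable]: "a x \<in> borel_measurable (lebesgue_on {0<..})" for x
    using am1 by (simp cong: measurable_cong_sets add: sW)
  have norm_f: "Lq_norm \<rho> q (\<lambda>x. ennreal \<bar>f x\<bar>) = Lq_norm \<rho> q g" by (simp add: g_def)
  show ?thesis
  proof (cases "p = \<infinity>")
    case True
    then have q: "q = \<infinity>" using pq by (simp add: top_unique)
    have I: "I_op d \<rho> p w f = (\<lambda>x. esssup W (a x))"
      using True by (simp add: I_op_def[abs_def] W_def a_def fun_eq_iff)
    have le: "a x r \<le> esssup \<rho> g" for x r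
      unfolding a_eq by (rule translate_average_le) (auto intro: esssup_AE)
    have "esssup \<rho> (\<lambda>x. esssup W (a x)) \<le> esssup \<rho> g"
    proof (rule esssup_I)
      show "(\<lambda>x. esssup W (a x)) \<in> borel_measurable \<rho>"
        by (rule measurable_esssup) (auto intro: W.sigma_finite_measure_axioms)
      show "AE x in \<rho>. esssup W (a x) \<le> esssup \<rho> g" using le by (auto intro!: AE_I2 esssup_I)
    qed
    moreover have "ennpowr V 0 = 1" using V by (cases V) (auto simp: ennpowr_ennreal)
    ultimately show ?thesis unfolding norm_f I V_def[symmetric] using True q by (simp add: Lq_norm_def)
  next
    case False
    then obtain P where P: "p = ennreal P" "1 \<le> P" using p by (cases p) auto
    have p1: "enn2real (1 / p) = 1 / P"
    proof -
      have "1 / p = ennreal (1 / P)" using P by (simp add: divide_ennreal[symmetric] flip: ennreal_1)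
      then show ?thesis using P by simp
    qed
    have I: "I_op d \<rho> p w f = (\<lambda>x. ennpowr (\<integral>\<^sup>+r. ennpowr (a x r) P \<partial>W) (1 / P))"
      unfolding I_op_def[abs_def] W_def using P
      by (simp add: fun_eq_iff nn_integral_density a_def[symmetric])
    show ?thesis
    proof (cases "q = \<infinity>")
      case True
      have le: "a x r \<le> esssup \<rho> g" for x r
        unfolding a_eq by (rule translate_average_le) (auto intro: esssup_AE)
      have "esssup \<rho> (\<lambda>x. ennpowr (\<integral>\<^sup>+r. ennpowr (a x r) P \<partial>W) (1 / P)) \<le> ennpowr V (1 / P) * esssup \<rho> g"
      proof (rule esssup_I)
        show "(\<lambda>x. ennpowr (\<integral>\<^sup>+r. ennpowr (a x r) P \<partial>W) (1 / P)) \<in> borel_measurable \<rho>" by measurable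
        have "ennpowr (\<integral>\<^sup>+r. ennpowr (a x r) P \<partial>W) (1 / P) \<le> ennpowr V (1 / P) * esssup \<rho> g" for x
        proof -
          have "(\<integral>\<^sup>+r. ennpowr (a x r) P \<partial>W) \<le> (\<integral>\<^sup>+r. ennpowr (esssup \<rho> g) P \<partial>W)"
            using P le by (intro nn_integral_mono ennpowr_mono) auto
          also have "\<dots> = V * ennpowr (esssup \<rho> g) P" by (simp add: WV mult.commute)
          finally have "ennpowr (\<integral>\<^sup>+r. ennpowr (a x r) P \<partial>W) (1 / P) \<le> ennpowr (V * ennpowr (esssup \<rho> g) P) (1 / P)"
            using P by (intro ennpowr_mono) auto
          also have "\<dots> = ennpowr V (1 / P) * esssup \<rho> g"
            using P by (simp add: ennpowr_mult ennpowr_ennpowr ennpowr_one)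
          finally show ?thesis .
        qed
        then show "AE x in \<rho>. ennpowr (\<integral>\<^sup>+r. ennpowr (a x r) P \<partial>W) (1 / P) \<le> ennpowr V (1 / P) * esssup \<rho> g"
          by simp
      qed
      then show ?thesis unfolding norm_f p1 I using True by (simp add: Lq_norm_def V_def)
    next
      case False
      then obtain Q where Q: "q = ennreal Q" "P \<le> Q" "1 \<le> Q"
        using pq P by (cases q) (auto simp: ennreal_le_iff2)
      \<comment> \<open>The exponent for Jensen over the radii; p \<le> q gives s \<ge> 1.\<close>
      define s where "s = Q / P"
      have s: "1 \<le> s" "P * s = Q" "(1 / P) * Q = s" "s * (1 / Q) = 1 / P" using P Q by (auto simp: s_def field_simps)
      have "(\<integral>\<^sup>+x. ennpowr (ennpowr (\<integral>\<^sup>+r. ennpowr (a x r) P \<partial>W) (1 / P)) Q \<partial>\<rho>) =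
          (\<integral>\<^sup>+x. ennpowr (\<integral>\<^sup>+r. ennpowr (a x r) P \<partial>W) s \<partial>\<rho>)"
        using P Q s by (simp add: ennpowr_ennpowr)
      also have "\<dots> \<le> (\<integral>\<^sup>+x. ennpowr V (s - 1) * (\<integral>\<^sup>+r. ennpowr (a x r) Q \<partial>W) \<partial>\<rho>)"
      proof (rule nn_integral_mono)
        fix x
        have "ennpowr (\<integral>\<^sup>+r. ennpowr (a x r) P \<partial>W) s
          \<le> ennpowr (emeasure W (space W)) (s - 1) * (\<integral>\<^sup>+r. ennpowr (ennpowr (a x r) P) s \<partial>W)"
          using V s by (intro nn_integral_power_mean) (auto simp: WV)
        then show "ennpowr (\<integral>\<^sup>+r. ennpowr (a x r) P \<partial>W) s \<le> ennpowr V (s - 1) * (\<integral>\<^sup>+r. ennpowr (a x r) Q \<partial>W)"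
          using P s by (simp add: ennpowr_ennpowr WV)
      qed
      also have "\<dots> = ennpowr V (s - 1) * (\<integral>\<^sup>+x. \<integral>\<^sup>+r. ennpowr (a x r) Q \<partial>W \<partial>\<rho>)"
        by (rule nn_integral_cmult) measurable
      also have "(\<integral>\<^sup>+x. \<integral>\<^sup>+r. ennpowr (a x r) Q \<partial>W \<partial>\<rho>) = (\<integral>\<^sup>+r. \<integral>\<^sup>+x. ennpowr (a x r) Q \<partial>\<rho> \<partial>W)"
        by (rule Fubini'[symmetric]) measurable
      also have "ennpowr V (s - 1) * \<dots> \<le> ennpowr V (s - 1) * (\<integral>\<^sup>+r. \<integral>\<^sup>+x. ennpowr (g x) Q \<partial>\<rho> \<partial>W)"
        unfolding a_eq using Q
        by (intro mult_left_mono nn_integral_mono[of W] nn_integral_translate_average_power_le) auto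
      also have "\<dots> = (ennpowr V (s - 1) * V) * (\<integral>\<^sup>+x. ennpowr (g x) Q \<partial>\<rho>)" by (simp add: WV ac_simps)
      \<comment> \<open>Jensen contributes V^{s-1}, and integrating the radius-free bound over
        \<open>W\<close> contributes another V. The Q-th root of V^s is V^{1/P}.\<close>
      also have "ennpowr V (s - 1) * V = ennpowr V s"
        using ennpowr_add[of 1 "s - 1" V] s by (simp add: ennpowr_one mult.commute)
      finally have "ennpowr (\<integral>\<^sup>+x. ennpowr (ennpowr (\<integral>\<^sup>+r. ennpowr (a x r) P \<partial>W) (1 / P)) Q \<partial>\<rho>) (1 / Q)
         \<le> ennpowr (ennpowr V s * (\<integral>\<^sup>+x. ennpowr (g x) Q \<partial>\<rho>)) (1 / Q)"
        using Q by (intro ennpowr_mono) auto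
      also have "\<dots> = ennpowr V (1 / P) * ennpowr (\<integral>\<^sup>+x. ennpowr (g x) Q \<partial>\<rho>) (1 / Q)"
        using Q s by (simp only: ennpowr_mult ennpowr_ennpowr divide_pos_pos zero_less_one less_le_trans)
      finally show ?thesis unfolding norm_f p1 I using Q by (simp add: Lq_norm_def V_def)
    qed
  qed
qed

end

section \<open>Charts, tangent vectors and isometries\<close>

lemma chart_inv_chart_map [simp]:
  "is_chart c \<Longrightarrow> p \<in> chart_dom c \<Longrightarrow> chart_inv c (chart_map c p) = p"
  by (simp add: is_chart_def homeomorphism_def)

lemma chart_map_chart_inv:
  "is_chart c \<Longrightarrow> y \<in> chart_map c ` chart_dom c \<Longrightarrow> chart_map c (chart_inv c y) = y"
  unfolding is_chart_def by (blast intro: homeomorphism_apply2)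

lemma chart_inv_in_dom:
  "is_chart c \<Longrightarrow> y \<in> chart_map c ` chart_dom c \<Longrightarrow> chart_inv c y \<in> chart_dom c"
  by auto

lemma chart_image_eq:
  "is_chart c \<Longrightarrow> chart_map c ` (chart_dom c \<inter> U) = chart_map c ` chart_dom c \<inter> chart_inv c -` U"
  by auto

lemma open_chart_image:
  assumes "is_chart c" "open U"
  shows "open (chart_map c ` (chart_dom c \<inter> U))"
  unfolding chart_image_eq[OF assms(1)]
proof (rule continuous_open_preimage)
  show "continuous_on (chart_map c ` chart_dom c) (chart_inv c)" "open (chart_map c ` chart_dom c)"
    using assms(1) unfolding is_chart_def homeomorphism_def by blast+
qed fact

lemma smooth_atlas_chart: "smooth_atlas A \<Longrightarrow> c \<in> A \<Longrightarrow> is_chart c"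
  by (simp add: smooth_atlas_def)

lemma smooth_atlas_cover: "smooth_atlas A \<Longrightarrow> \<exists>c\<in>A. p \<in> chart_dom c"
  by (auto simp: smooth_atlas_def)

section \<open>C^1 maps and the chain rule in charts\<close>

definition C1_map :: "('a::topological_space, 'e::euclidean_space) chart set \<Rightarrow> ('a \<Rightarrow> 'a) \<Rightarrow> bool" where
  "C1_map A F \<longleftrightarrow> continuous_on UNIV F \<and> (\<forall>a\<in>A. \<forall>b\<in>A.
     Ck_on (Suc 0) (chart_map b \<circ> F \<circ> chart_inv a) (chart_map a ` (chart_dom a \<inter> F -` chart_dom b)))"

abbreviation chart_deriv ::
  "('a \<Rightarrow> 'a) \<Rightarrow> ('a, 'e::euclidean_space) chart \<Rightarrow> ('a, 'e) chart \<Rightarrow> 'a \<Rightarrow> 'e \<Rightarrow> 'e" where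
  "chart_deriv F a b p \<equiv> frechet_derivative (chart_map b \<circ> F \<circ> chart_inv a) (at (chart_map a p))"

text \<open>Transition maps are the chart expressions of \<open>id\<close>; through this lemma the
  rules for \<open>chart_deriv\<close> cover coordinate changes as well.\<close>

lemma C1_map_id: "smooth_atlas A \<Longrightarrow> C1_map A id"
  by (auto simp: C1_map_def smooth_atlas_def smooth_on_def simp del: Ck_on.simps)

lemma C1_map_has_derivative:
  assumes "C1_map A F" "a \<in> A" "b \<in> A" "p \<in> chart_dom a" "F p \<in> chart_dom b"
  shows "((chart_map b \<circ> F \<circ> chart_inv a) has_derivative chart_deriv F a b p) (at (chart_map a p))"
proof -
  have "\<forall>x\<in>chart_map a ` (chart_dom a \<inter> F -` chart_dom b). (chart_map b \<circ> F \<circ> chart_inv a) differentiable (at x)"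
    using assms by (simp add: C1_map_def)
  then show ?thesis using assms by (subst frechet_derivative_works[symmetric]) auto
qed

lemma linear_chart_deriv:
  assumes "C1_map A F" "a \<in> A" "b \<in> A" "p \<in> chart_dom a" "F p \<in> chart_dom b"
  shows "linear (chart_deriv F a b p)"
  using C1_map_has_derivative[OF assms] by (rule has_derivative_linear)

lemma open_vimage_C1_map: "C1_map A F \<Longrightarrow> open U \<Longrightarrow> open (F -` U)"
  by (auto simp: C1_map_def intro: open_vimage)

text \<open>The chart expression of the composite agrees with the composite of the chart expressions
  only where F lands in the domain of b. This is an open neighbourhood of the point, which is enough
  for derivatives.\<close>

lemma chart_deriv_chain:
  assumes A: "smooth_atlas A" and F: "C1_map A F" and G: "C1_map A G"
    and abc: "a \<in> A" "b \<in> A" "c \<in> A" and p: "p \<in> chart_dom a" "F p \<in> chart_dom b" "G (F p) \<in> chart_dom c"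
  shows "chart_deriv (G \<circ> F) a c p v = chart_deriv G b c (F p) (chart_deriv F a b p v)"
proof -
  define S where "S = chart_map a ` (chart_dom a \<inter> F -` chart_dom b)"
  note ch = smooth_atlas_chart[OF A abc(1)] smooth_atlas_chart[OF A abc(2)]
  have S: "open S" unfolding S_def
    using ch by (intro open_chart_image open_vimage_C1_map[OF F]) (auto simp: is_chart_def)
  have eq: "(chart_map b \<circ> F \<circ> chart_inv a) (chart_map a p) = chart_map b (F p)" using ch p by simp
  have "((chart_map c \<circ> G \<circ> chart_inv b) \<circ> (chart_map b \<circ> F \<circ> chart_inv a) has_derivative
      (chart_deriv G b c (F p) \<circ> chart_deriv F a b p)) (at (chart_map a p))"
    using diff_chain_at[OF C1_map_has_derivative[OF F abc(1,2) p(1,2)]]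
      C1_map_has_derivative[OF G abc(2,3) p(2,3)] unfolding eq by blast
  then have "((chart_map c \<circ> (G \<circ> F) \<circ> chart_inv a) has_derivative
      (chart_deriv G b c (F p) \<circ> chart_deriv F a b p)) (at (chart_map a p))"
    by (rule has_derivative_transform_within_open[OF _ S]) (use p ch in \<open>auto simp: S_def\<close>)
  then have "chart_deriv (G \<circ> F) a c p = chart_deriv G b c (F p) \<circ> chart_deriv F a b p"
    by (rule frechet_derivative_at[symmetric])
  then show ?thesis by simp
qed

lemma chart_deriv_id:
  assumes "is_chart a" "p \<in> chart_dom a"
  shows "chart_deriv id a a p v = v"
proof -
  have "((\<lambda>x. x) has_derivative (\<lambda>x. x)) (at (chart_map a p))" by (rule has_derivative_ident)
  moreover have "open (chart_map a ` chart_dom a)" using assms by (simp add: is_chart_def)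
  ultimately have "((chart_map a \<circ> id \<circ> chart_inv a) has_derivative (\<lambda>x. x)) (at (chart_map a p))"
    by (rule has_derivative_transform_within_open) (use assms in \<open>auto simp: chart_map_chart_inv\<close>)
  then show ?thesis by (simp only: frechet_derivative_at[symmetric])
qed

section \<open>Coordinate vectors, differentials and Gram matrices\<close>

lemma coord_vector_chart_deriv:
  "coord_vector A c p u = (\<lambda>c'. if c' \<in> A \<and> p \<in> chart_dom c' then chart_deriv id c c' p u else 0)"
  unfolding coord_vector_def comp_id by (rule refl)

lemma coord_vector_self:
  "smooth_atlas A \<Longrightarrow> c \<in> A \<Longrightarrow> p \<in> chart_dom c \<Longrightarrow> coord_vector A c p u c = u"
  unfolding coord_vector_chart_deriv by (simp only: simp_thms if_True chart_deriv_id smooth_atlas_chart)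

text \<open>The transformation law of tangent vectors is the chain rule for three charts around p,
  with \<open>id\<close> as both maps.\<close>

lemma coord_vector_in_tangent_space:
  assumes A: "smooth_atlas A" and c: "c \<in> A" "p \<in> chart_dom c"
  shows "coord_vector A c p u \<in> tangent_space A p"
proof -
  have "chart_deriv id c c'' p u = chart_deriv id c' c'' p (chart_deriv id c c' p u)"
    if "c' \<in> A" "c'' \<in> A" "p \<in> chart_dom c'" "p \<in> chart_dom c''" for c' c''
    using chart_deriv_chain[OF A C1_map_id[OF A] C1_map_id[OF A], of c c' c'' p u] c that by simp
  note * = this[unfolded comp_id]
  show ?thesis
    unfolding tangent_space_def
  proof (intro CollectI conjI ballI impI allI)
    fix c' c'' assume "c' \<in> A" "c'' \<in> A" "p \<in> chart_dom c'" "p \<in> chart_dom c''"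
    with *[of c' c''] show "coord_vector A c p u c'' =
      frechet_derivative (chart_map c'' \<circ> chart_inv c') (at (chart_map c' p)) (coord_vector A c p u c')"
      by (simp only: coord_vector_def simp_thms if_True)
  next
    fix c' assume "c' \<notin> A \<or> p \<notin> chart_dom c'"
    then show "coord_vector A c p u c' = 0" unfolding coord_vector_def by (intro if_not_P) blast
  qed
qed

text \<open>The chart picked by \<open>SOME\<close> in \<open>differential\<close> drops out by
  reading F both as F composed with \<open>id\<close> and as \<open>id\<close> composed with F. The
  rest of the development can then choose charts freely.\<close>

lemma differential_coord_vector:
  assumes A: "smooth_atlas A" and F: "C1_map A F"
    and ab: "a \<in> A" "b \<in> A" and p: "p \<in> chart_dom a" "F p \<in> chart_dom b"
  shows "differential A A F p (coord_vector A a p u) = coord_vector A b (F p) (chart_deriv F a b p u)"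
proof
  fix c'
  define c where "c = (SOME c. c \<in> A \<and> p \<in> chart_dom c)"
  have c: "c \<in> A" "p \<in> chart_dom c"
    using someI_ex[of "\<lambda>c. c \<in> A \<and> p \<in> chart_dom c"] smooth_atlas_cover[OF A, of p] unfolding c_def by blast+
  show "differential A A F p (coord_vector A a p u) c' = coord_vector A b (F p) (chart_deriv F a b p u) c'"
  proof (cases "c' \<in> A \<and> F p \<in> chart_dom c'")
    case True
    have "chart_deriv F c c' p (chart_deriv id a c p u) = chart_deriv (F \<circ> id) a c' p u"
      using chart_deriv_chain[OF A C1_map_id[OF A] F, of a c c' p u] ab c p True by simp
    also have "\<dots> = chart_deriv (id \<circ> F) a c' p u" by simp
    also have "\<dots> = chart_deriv id b c' (F p) (chart_deriv F a b p u)"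
      using chart_deriv_chain[OF A F C1_map_id[OF A], of a b c' p u] ab c p True by simp
    finally show ?thesis
      using True c by (simp add: differential_def Let_def c_def[symmetric] coord_vector_def)
  qed (auto simp: differential_def coord_vector_def)
qed

lemma isometric_coord_vector:
  assumes A: "smooth_atlas A" and F: "C1_map A F" and g: "isometric A g F"
    and ab: "a \<in> A" "b \<in> A" and p: "p \<in> chart_dom a" "F p \<in> chart_dom b"
  shows "g (F p) (coord_vector A b (F p) (chart_deriv F a b p u)) (coord_vector A b (F p) (chart_deriv F a b p v))
    = g p (coord_vector A a p u) (coord_vector A a p v)"
  using g coord_vector_in_tangent_space[OF A ab(1) p(1)]
  unfolding isometric_def differential_coord_vector[OF A F ab p, symmetric] by blast

lemma coord_vector_linear:
  assumes A: "smooth_atlas A" and c: "c \<in> A" "p \<in> chart_dom c"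
  shows "coord_vector A c p (x *\<^sub>R u + y *\<^sub>R v) = (\<lambda>c'. x *\<^sub>R coord_vector A c p u c' + y *\<^sub>R coord_vector A c p v c')"
  using linear_chart_deriv[OF C1_map_id[OF A] c(1) _ c(2)]
  by (auto simp: coord_vector_def fun_eq_iff linear_add linear_cmul)

lemma bilinear_metric_coord_vector:
  assumes A: "smooth_atlas A" and g: "riemannian_metric A g" and c: "c \<in> A" "p \<in> chart_dom c"
  shows "bilinear (\<lambda>u v. g p (coord_vector A c p u) (coord_vector A c p v))"
proof -
  let ?G = "\<lambda>u v. g p (coord_vector A c p u) (coord_vector A c p v)"
  note t = coord_vector_in_tangent_space[OF A c]
  have sym: "?G u v = ?G v u" for u v using g t unfolding riemannian_metric_def by blast
  have lin: "?G (x *\<^sub>R u + y *\<^sub>R u') v = x * ?G u v + y * ?G u' v" for x y u u' v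
    unfolding coord_vector_linear[OF A c] using g t unfolding riemannian_metric_def by blast
  have l: "linear (\<lambda>u. ?G u v)" for v
    using lin[of 1 _ 1 _ v] lin[of _ _ 0 0 v] by (intro linearI) auto
  show ?thesis unfolding bilinear_def using l sym by (simp add: sym[of _ "_::'b"])
qed

lemma metric_gram_matrix:
  fixes A :: "('a::topological_space, real^'n) chart set"
  assumes A: "smooth_atlas A" and g: "riemannian_metric A g" and c: "c \<in> A" "p \<in> chart_dom c"
  shows "g p (coord_vector A c p u) (coord_vector A c p v) = (\<Sum>k\<in>UNIV. \<Sum>l\<in>UNIV. u$k * v$l * gram_matrix A g c p $ k $ l)"
proof -
  let ?G = "\<lambda>u v. g p (coord_vector A c p u) (coord_vector A c p v)"
  note b = bilinear_metric_coord_vector[OF A g c]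
  have "?G u v = ?G (\<Sum>k\<in>UNIV. u$k *\<^sub>R axis k 1) (\<Sum>l\<in>UNIV. v$l *\<^sub>R axis l 1)"
    using basis_expansion[of u] basis_expansion[of v] by (simp add: scalar_mult_eq_scaleR)
  also have "\<dots> = (\<Sum>(k, l)\<in>UNIV \<times> UNIV. ?G (u$k *\<^sub>R axis k 1) (v$l *\<^sub>R axis l 1))"
    by (rule bilinear_sum[OF b])
  also have "\<dots> = (\<Sum>k\<in>UNIV. \<Sum>l\<in>UNIV. u$k * v$l * ?G (axis k 1) (axis l 1))"
    unfolding sum.cartesian_product[symmetric]
    using bilinear_lmul[OF b] bilinear_rmul[OF b] by (intro sum.cong refl) simp
  finally show ?thesis by (simp add: gram_matrix_def)
qed

lemma gram_matrix_isometric: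
  fixes A :: "('a::topological_space, real^'n) chart set"
  assumes A: "smooth_atlas A" and rg: "riemannian_metric A g" and F: "C1_map A F" and g: "isometric A g F"
    and ab: "a \<in> A" "b \<in> A" and p: "p \<in> chart_dom a" "F p \<in> chart_dom b"
  shows "gram_matrix A g a p =
    transpose (matrix (chart_deriv F a b p)) ** gram_matrix A g b (F p) ** matrix (chart_deriv F a b p)"
proof -
  have "gram_matrix A g a p $ i $ j = (\<Sum>k\<in>UNIV. \<Sum>l\<in>UNIV. matrix (chart_deriv F a b p) $ k $ i *
     matrix (chart_deriv F a b p) $ l $ j * gram_matrix A g b (F p) $ k $ l)" for i j
    using metric_gram_matrix[OF A rg ab(2) p(2), of "chart_deriv F a b p (axis i 1)" "chart_deriv F a b p (axis j 1)"]
      isometric_coord_vector[OF A F g ab p, of "axis i 1" "axis j 1"]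
    by (simp add: gram_matrix_def matrix_def)
  moreover have "(transpose J ** G ** J) $ i $ j = (\<Sum>k\<in>UNIV. \<Sum>l\<in>UNIV. J $ k $ i * J $ l $ j * G $ k $ l)"
    for J G :: "real^'n^'n" and i j
    by (subst sum.swap) (simp add: matrix_matrix_mult_def transpose_def sum_distrib_left sum_distrib_right ac_simps)
  ultimately show ?thesis by (simp add: vec_eq_iff)
qed

text \<open>Determinants of G = J^T G' J: the volume density changes by |det J|, the factor of the
  change of variables theorem. In HOL \<open>sqrt\<close> is odd and multiplicative on all reals, so
  signs of determinants do not have to be discussed.\<close>

lemma sqrt_det_gram_matrix_isometric:
  fixes A :: "('a::topological_space, real^'n) chart set"
  assumes "smooth_atlas A" "riemannian_metric A g" "C1_map A F" "isometric A g F"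
    and "a \<in> A" "b \<in> A" "p \<in> chart_dom a" "F p \<in> chart_dom b"
  shows "sqrt (det (gram_matrix A g a p)) =
    \<bar>det (matrix (chart_deriv F a b p))\<bar> * sqrt (det (gram_matrix A g b (F p)))"
proof -
  define J where "J = det (matrix (chart_deriv F a b p))"
  have "det (gram_matrix A g a p) = (J * J) * det (gram_matrix A g b (F p))"
    unfolding gram_matrix_isometric[OF assms] J_def by (simp only: det_mul det_transpose ac_simps)
  then have "sqrt (det (gram_matrix A g a p)) = sqrt (J * J) * sqrt (det (gram_matrix A g b (F p)))"
    by (simp only: real_sqrt_mult[of "J * J"])
  then show ?thesis unfolding J_def[symmetric] by (simp only: real_sqrt_abs2)
qed

lemma continuous_on_gram_matrix:
  fixes A :: "('a::topological_space, real^'n) chart set"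
  assumes "riemannian_metric A g" "c \<in> A"
  shows "continuous_on (chart_map c ` chart_dom c) (\<lambda>y. gram_matrix A g c (chart_inv c y) $ i $ j)"
proof -
  have "Ck_on 0 (\<lambda>y. let p = chart_inv c y in g p (coord_vector A c p (axis i 1)) (coord_vector A c p (axis j 1)))
     (chart_map c ` chart_dom c)"
    using assms unfolding riemannian_metric_def smooth_on_def by blast
  then show ?thesis by (simp add: gram_matrix_def Let_def)
qed

lemma continuous_on_sqrt_det_gram_matrix:
  fixes A :: "('a::topological_space, real^'n) chart set"
  assumes "riemannian_metric A g" "c \<in> A"
  shows "continuous_on (chart_map c ` chart_dom c) (\<lambda>y. sqrt (det (gram_matrix A g c (chart_inv c y))))"
  unfolding det_def using continuous_on_gram_matrix[OF assms]
  by (intro continuous_on_real_sqrt continuous_on_sum continuous_on_mult continuous_on_prod continuous_on_const)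

text \<open>The derivative j' is the same at all points, so the derivative of f along v is that of
  \<psi> along the fixed vector \<open>j' v\<close>. Its continuity is therefore inherited from
  \<psi>.\<close>

lemma Ck_one_compose_affine:
  assumes \<psi>: "Ck_on (Suc 0) \<psi> S'" and S: "open S" and j: "\<And>y. (j has_derivative j') (at y)" "continuous_on S j"
    and sub: "j ` S \<subseteq> S'" and f: "\<And>y. y \<in> S \<Longrightarrow> f y = \<psi> (j y)"
  shows "Ck_on (Suc 0) f S"
proof -
  have d: "(f has_derivative (\<lambda>v. frechet_derivative \<psi> (at (j y)) (j' v))) (at y)" if y: "y \<in> S" for y
  proof -
    have "(\<psi> has_derivative frechet_derivative \<psi> (at (j y))) (at (j y))"
      using \<psi> sub y by (subst frechet_derivative_works[symmetric]) auto
    from diff_chain_at[OF j(1) this]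
    show ?thesis unfolding o_def
      by (rule has_derivative_transform_within_open[OF _ S y]) (simp add: f)
  qed
  then have fd: "frechet_derivative f (at y) v = frechet_derivative \<psi> (at (j y)) (j' v)" if "y \<in> S" for y v
    using frechet_derivative_at[OF d[OF that]] by metis
  have "continuous_on S (\<lambda>y. frechet_derivative \<psi> (at (j y)) (j' v))" for v
    using \<psi> sub by (intro continuous_on_compose2[OF _ j(2)]) auto
  then have "continuous_on S (\<lambda>y. frechet_derivative f (at y) v)" for v
    by (subst continuous_on_cong[OF refl fd]) auto
  with d show ?thesis by (auto simp: differentiable_def)
qed

lemma chart_inv_prod:
  assumes "is_chart c" "is_chart c'" "p \<in> chart_dom c" "p' \<in> chart_dom c'"
  shows "chart_inv (chart_dom c \<times> chart_dom c', map_prod (chart_map c) (chart_map c')) (chart_map c p, chart_map c' p') = (p, p')"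
proof -
  have "inj_on (chart_map c) (chart_dom c)" "inj_on (chart_map c') (chart_dom c')"
    using assms by (auto intro!: inj_on_inverseI[where g="chart_inv c"] inj_on_inverseI[where g="chart_inv c'"])
  then have "inj_on (map_prod (chart_map c) (chart_map c')) (chart_dom c \<times> chart_dom c')"
    by (rule map_prod_inj_on)
  then show ?thesis unfolding chart_inv_def using assms by (auto intro!: inv_into_f_eq)
qed

section \<open>Translations as C^1 maps\<close>

context lie_group
begin

lemma atlas_product_Ck_one:
  assumes "c1 \<in> A" "c2 \<in> A" "c' \<in> A"
  shows "Ck_on (Suc 0) (chart_map c' \<circ> (\<lambda>(x, y). mul x y) \<circ> chart_inv (chart_dom c1 \<times> chart_dom c2, map_prod (chart_map c1) (chart_map c2)))
    (map_prod (chart_map c1) (chart_map c2) ` ((chart_dom c1 \<times> chart_dom c2) \<inter> (\<lambda>(x, y). mul x y) -` chart_dom c'))"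
proof -
  have "(chart_dom c1 \<times> chart_dom c2, map_prod (chart_map c1) (chart_map c2)) \<in> prod_atlas A A"
    using assms unfolding prod_atlas_def by blast
  then show ?thesis using smooth_mult assms(3) unfolding smooth_map_def smooth_on_def by fastforce
qed

lemma continuous_mul: "continuous_on UNIV (\<lambda>(x, y). mul x y)"
  using smooth_mult by (simp add: smooth_map_def)

lemma continuous_left_translation: "continuous_on UNIV (\<lambda>x. mul a x)"
  using continuous_on_compose2[OF continuous_mul, of UNIV "\<lambda>x. (a, x)"]
    continuous_on_Pair[OF continuous_on_const[of UNIV a] continuous_on_id] by simp

lemma continuous_right_translation: "continuous_on UNIV (\<lambda>x. mul x a)"
  using continuous_on_compose2[OF continuous_mul, of UNIV "\<lambda>x. (x, a)"]
    continuous_on_Pair[OF continuous_on_id continuous_on_const[of UNIV a]] by simp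

text \<open>Left translation by a is the multiplication on the slice {a} \<times> G. In a product
  chart this slice is the affine map that puts the coordinates of a in front of y.\<close>

lemma C1_map_left_translation: "C1_map A (\<lambda>x. mul a x)"
  unfolding C1_map_def
proof (intro conjI ballI continuous_left_translation)
  fix c c' assume c: "c \<in> A" "c' \<in> A"
  obtain c1 where c1: "c1 \<in> A" "a \<in> chart_dom c1" using smooth_atlas_cover[OF smooth_atlas] by blast
  have ch: "is_chart c" "is_chart c1" "is_chart c'" using c c1 smooth_atlas_chart[OF smooth_atlas] by auto
  show "Ck_on (Suc 0) (chart_map c' \<circ> (\<lambda>x. mul a x) \<circ> chart_inv c) (chart_map c ` (chart_dom c \<inter> (\<lambda>x. mul a x) -` chart_dom c'))"
  proof (rule Ck_one_compose_affine[OF atlas_product_Ck_one[OF c1(1) c], of _ "\<lambda>y. (chart_map c1 a, y)" "\<lambda>v. (0, v)"])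
    show "open (chart_map c ` (chart_dom c \<inter> (\<lambda>x. mul a x) -` chart_dom c'))"
      using ch by (intro open_chart_image open_vimage continuous_left_translation) (auto simp: is_chart_def)
  qed (use ch c1 in \<open>auto intro!: derivative_eq_intros continuous_intros simp: chart_inv_prod image_iff intro: rev_bexI\<close>)
qed

lemma C1_map_right_translation: "C1_map A (\<lambda>x. mul x a)"
  unfolding C1_map_def
proof (intro conjI ballI continuous_right_translation)
  fix c c' assume c: "c \<in> A" "c' \<in> A"
  obtain c1 where c1: "c1 \<in> A" "a \<in> chart_dom c1" using smooth_atlas_cover[OF smooth_atlas] by blast
  have ch: "is_chart c" "is_chart c1" "is_chart c'" using c c1 smooth_atlas_chart[OF smooth_atlas] by auto
  show "Ck_on (Suc 0) (chart_map c' \<circ> (\<lambda>x. mul x a) \<circ> chart_inv c) (chart_map c ` (chart_dom c \<inter> (\<lambda>x. mul x a) -` chart_dom c'))"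
  proof (rule Ck_one_compose_affine[OF atlas_product_Ck_one[OF c(1) c1(1) c(2)], of _ "\<lambda>y. (y, chart_map c1 a)" "\<lambda>v. (v, 0)"])
    show "open (chart_map c ` (chart_dom c \<inter> (\<lambda>x. mul x a) -` chart_dom c'))"
      using ch by (intro open_chart_image open_vimage continuous_right_translation) (auto simp: is_chart_def)
  qed (use ch c1 in \<open>auto intro!: derivative_eq_intros continuous_intros simp: chart_inv_prod image_iff intro: rev_bexI\<close>)
qed

end

section \<open>Curves and the Riemannian distance\<close>

text \<open>The times at which \<open>velocity\<close> is a genuine derivative, which on a piecewise
  C^1 curve are all but finitely many. Continuity is part of it because differentiability in one
  chart passes to another only while the curve stays in both domains.\<close>

definition regular_at ::
  "('a::topological_space, 'e::euclidean_space) chart set \<Rightarrow> (real \<Rightarrow> 'a) \<Rightarrow> real \<Rightarrow> bool" where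
  "regular_at A \<gamma> t \<longleftrightarrow> isCont \<gamma> t \<and> (\<forall>c\<in>A. \<gamma> t \<in> chart_dom c \<longrightarrow> (chart_map c \<circ> \<gamma>) differentiable (at t))"

lemma velocity_works:
  assumes "regular_at A \<gamma> t" "c \<in> A" "\<gamma> t \<in> chart_dom c"
  shows "((chart_map c \<circ> \<gamma>) has_vector_derivative velocity A \<gamma> t c) (at t)"
  using assms by (auto simp: regular_at_def velocity_def vector_derivative_works)

lemma velocity_eqI:
  assumes "\<And>c. c \<in> A \<Longrightarrow> \<gamma> t \<in> chart_dom c \<Longrightarrow> ((chart_map c \<circ> \<gamma>) has_vector_derivative v c) (at t)"
    and "\<And>c. c \<notin> A \<or> \<gamma> t \<notin> chart_dom c \<Longrightarrow> v c = 0"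
  shows "velocity A \<gamma> t = v"
proof
  fix c
  show "velocity A \<gamma> t c = v c"
  proof (cases "c \<in> A \<and> \<gamma> t \<in> chart_dom c")
    case True
    then show ?thesis unfolding velocity_def using vector_derivative_at[OF assms(1)] by (simp only: simp_thms if_True)
  next
    case False
    then have "v c = 0" by (intro assms(2)) blast
    then show ?thesis unfolding velocity_def if_not_P[OF False] ..
  qed
qed

lemma C1_curve_regular:
  assumes "C1_curve A a b \<gamma>" "t \<in> {a<..<b}"
  shows "regular_at A \<gamma> t"
  unfolding regular_at_def
proof (intro conjI ballI impI)
  show "isCont \<gamma> t" using assms by (auto simp: C1_curve_def intro: continuous_on_interior)
  fix c assume c: "c \<in> A" "\<gamma> t \<in> chart_dom c"
  obtain D where "\<forall>t\<in>{a..b} \<inter> \<gamma> -` chart_dom c. ((chart_map c \<circ> \<gamma>) has_vector_derivative D t) (at t within {a..b})"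
    using assms c unfolding C1_curve_def by blast
  with assms c have "((chart_map c \<circ> \<gamma>) has_vector_derivative D t) (at t within {a..b})" by auto
  then show "(chart_map c \<circ> \<gamma>) differentiable (at t)"
    using at_within_interior[of t "{a..b}"] assms(2) by (simp add: differentiableI_vector)
qed

text \<open>Continuity keeps the curve inside chart a for times near t, where both coordinate
  expressions agree. Derivatives within S include the one-sided ones at the ends of an
  interval.\<close>

lemma has_vector_derivative_C1_map:
  assumes A: "smooth_atlas A" and F: "C1_map A F" and ab: "a \<in> A" "b \<in> A"
    and p: "\<gamma> t \<in> chart_dom a" "F (\<gamma> t) \<in> chart_dom b" and t: "t \<in> S" and cont: "continuous (at t within S) \<gamma>"
    and D: "((chart_map a \<circ> \<gamma>) has_vector_derivative D) (at t within S)"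
  shows "((chart_map b \<circ> (F \<circ> \<gamma>)) has_vector_derivative chart_deriv F a b (\<gamma> t) D) (at t within S)"
proof -
  have ch: "is_chart a" by (rule smooth_atlas_chart[OF A ab(1)])
  have "((chart_map b \<circ> F \<circ> chart_inv a) has_derivative chart_deriv F a b (\<gamma> t)) (at ((chart_map a \<circ> \<gamma>) t) within (chart_map a \<circ> \<gamma>) ` S)"
    using has_derivative_at_withinI[OF C1_map_has_derivative[OF F ab p]] by simp
  from vector_derivative_diff_chain_within[OF D this]
  have "((chart_map b \<circ> F \<circ> chart_inv a) \<circ> (chart_map a \<circ> \<gamma>) has_vector_derivative chart_deriv F a b (\<gamma> t) D) (at t within S)" .
  moreover have "\<forall>\<^sub>F s in at t within S. ((chart_map b \<circ> F \<circ> chart_inv a) \<circ> (chart_map a \<circ> \<gamma>)) s = (chart_map b \<circ> (F \<circ> \<gamma>)) s"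
  proof -
    have "open (chart_dom a)" using ch by (simp add: is_chart_def)
    then have "\<forall>\<^sub>F s in at t within S. \<gamma> s \<in> chart_dom a"
      using cont p(1) unfolding continuous_within by (blast intro: topological_tendstoD)
    then show ?thesis by eventually_elim (simp add: ch)
  qed
  ultimately show ?thesis
    unfolding has_vector_derivative_def
    by (rule has_derivative_transform_eventually) (simp_all add: ch p t)
qed

lemma regular_at_C1_map:
  assumes A: "smooth_atlas A" and F: "C1_map A F" and r: "regular_at A \<gamma> t"
  shows "regular_at A (F \<circ> \<gamma>) t"
  unfolding regular_at_def
proof (intro conjI ballI impI)
  have "continuous_on UNIV F" using F unfolding C1_map_def by blast
  moreover have "\<gamma> \<midarrow>t\<rightarrow> \<gamma> t" using r unfolding regular_at_def isCont_def by blast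
  ultimately have "(\<lambda>s. F (\<gamma> s)) \<midarrow>t\<rightarrow> F (\<gamma> t)" by (rule continuous_on_tendsto_compose) simp_all
  then show "isCont (F \<circ> \<gamma>) t" by (simp only: isCont_def o_def)
  fix b assume b: "b \<in> A" "(F \<circ> \<gamma>) t \<in> chart_dom b"
  obtain a where a: "a \<in> A" "\<gamma> t \<in> chart_dom a" using smooth_atlas_cover[OF A] by blast
  have "((chart_map b \<circ> (F \<circ> \<gamma>)) has_vector_derivative chart_deriv F a b (\<gamma> t) (velocity A \<gamma> t a)) (at t within UNIV)"
    using b a r by (intro has_vector_derivative_C1_map[OF A F a(1) b(1)] velocity_works) (auto simp: regular_at_def)
  then show "(chart_map b \<circ> (F \<circ> \<gamma>)) differentiable (at t)" by (rule differentiableI_vector)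
qed

lemma velocity_C1_map:
  assumes A: "smooth_atlas A" and F: "C1_map A F" and r: "regular_at A \<gamma> t"
    and a: "a \<in> A" "\<gamma> t \<in> chart_dom a" and b: "b \<in> A" "F (\<gamma> t) \<in> chart_dom b"
  shows "velocity A (F \<circ> \<gamma>) t b = chart_deriv F a b (\<gamma> t) (velocity A \<gamma> t a)"
proof -
  have "((chart_map b \<circ> (F \<circ> \<gamma>)) has_vector_derivative chart_deriv F a b (\<gamma> t) (velocity A \<gamma> t a)) (at t within UNIV)"
    using b a r by (intro has_vector_derivative_C1_map[OF A F a(1) b(1)] velocity_works) (auto simp: regular_at_def)
  then show ?thesis using b by (simp add: velocity_def vector_derivative_at)
qed

text \<open>With this the metric can be evaluated on velocities in a single chart; it is the
  transformation rule for velocities under C^1 maps, taken for \<open>id\<close>.\<close>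

lemma velocity_eq_coord_vector:
  assumes A: "smooth_atlas A" and r: "regular_at A \<gamma> t" and a: "a \<in> A" "\<gamma> t \<in> chart_dom a"
  shows "velocity A \<gamma> t = coord_vector A a (\<gamma> t) (velocity A \<gamma> t a)"
proof (rule velocity_eqI)
  fix c assume c: "c \<in> A" "\<gamma> t \<in> chart_dom c"
  then show "((chart_map c \<circ> \<gamma>) has_vector_derivative coord_vector A a (\<gamma> t) (velocity A \<gamma> t a) c) (at t)"
    using velocity_works[OF r c] velocity_C1_map[OF A C1_map_id[OF A] r a c(1)] by (simp add: coord_vector_def)
next
  fix c assume "c \<notin> A \<or> \<gamma> t \<notin> chart_dom c"
  then show "coord_vector A a (\<gamma> t) (velocity A \<gamma> t a) c = 0"
    unfolding coord_vector_def by (intro if_not_P) blast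
qed

abbreviation speed ::
  "('a, 'e::euclidean_space) chart set \<Rightarrow> ('a, 'e) metric \<Rightarrow> (real \<Rightarrow> 'a) \<Rightarrow> real \<Rightarrow> real" where
  "speed A g \<gamma> t \<equiv> sqrt (g (\<gamma> t) (velocity A \<gamma> t) (velocity A \<gamma> t))"

lemma speed_nonneg:
  assumes A: "smooth_atlas A" and g: "riemannian_metric A g" and r: "regular_at A \<gamma> t"
  shows "0 \<le> speed A g \<gamma> t"
proof -
  obtain a where a: "a \<in> A" "\<gamma> t \<in> chart_dom a" using smooth_atlas_cover[OF A] by blast
  define u where "u = velocity A \<gamma> t a"
  have v: "velocity A \<gamma> t = coord_vector A a (\<gamma> t) u"
    unfolding u_def by (rule velocity_eq_coord_vector[OF A r a])
  have "0 \<le> g (\<gamma> t) (coord_vector A a (\<gamma> t) u) (coord_vector A a (\<gamma> t) u)"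
  proof (cases "coord_vector A a (\<gamma> t) u = (\<lambda>c. 0)")
    case True
    then have "u = 0" using coord_vector_self[OF A a, of u] by simp
    then show ?thesis using bilinear_lzero[OF bilinear_metric_coord_vector[OF A g a]] by simp
  next
    case False
    then show ?thesis
      using g coord_vector_in_tangent_space[OF A a, of u] unfolding riemannian_metric_def by (blast intro: less_imp_le)
  qed
  then show ?thesis unfolding v by simp
qed

lemma speed_isometric:
  assumes A: "smooth_atlas A" and F: "C1_map A F" and g: "isometric A g F" and r: "regular_at A \<gamma> t"
  shows "speed A g (F \<circ> \<gamma>) t = speed A g \<gamma> t"
proof -
  obtain a where a: "a \<in> A" "\<gamma> t \<in> chart_dom a" using smooth_atlas_cover[OF A] by blast
  obtain b where b: "b \<in> A" "F (\<gamma> t) \<in> chart_dom b" using smooth_atlas_cover[OF A] by blast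
  have "velocity A (F \<circ> \<gamma>) t = coord_vector A b (F (\<gamma> t)) (chart_deriv F a b (\<gamma> t) (velocity A \<gamma> t a))"
    using velocity_eq_coord_vector[OF A regular_at_C1_map[OF A F r], of b] b velocity_C1_map[OF A F r a b] by simp
  then show ?thesis
    using isometric_coord_vector[OF A F g a(1) b(1) a(2) b(2), of "velocity A \<gamma> t a" "velocity A \<gamma> t a"]
      velocity_eq_coord_vector[OF A r a] by simp
qed

section \<open>Reparametrised curves and images of curves\<close>

lemma has_vector_derivative_affine:
  assumes "((c \<circ> \<gamma>) has_vector_derivative D) (at (k * t + m) within (\<lambda>s. k * s + m) ` S)" "t \<in> S"
    and eq: "\<And>s. s \<in> S \<Longrightarrow> \<gamma>' s = \<gamma> (k * s + m)"
  shows "((c \<circ> \<gamma>') has_vector_derivative k *\<^sub>R D) (at t within S)"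
proof -
  have "((\<lambda>s. k * s + m) has_vector_derivative k) (at t within S)"
    by (auto intro!: derivative_eq_intros simp: has_vector_derivative_def)
  from vector_diff_chain_within[OF this assms(1)]
  have "((c \<circ> \<gamma>) \<circ> (\<lambda>s. k * s + m) has_vector_derivative k *\<^sub>R D) (at t within S)" .
  then show ?thesis
    by (rule has_vector_derivative_transform[OF assms(2), rotated]) (simp add: eq)
qed

lemma C1_curve_affine:
  assumes \<gamma>: "C1_curve A (k * a + m) (k * b + m) \<gamma>" and k: "k > 0"
    and eq: "\<And>s. s \<in> {a..b} \<Longrightarrow> \<gamma>' s = \<gamma> (k * s + m)"
  shows "C1_curve A a b \<gamma>'"
  unfolding C1_curve_def
proof (intro conjI ballI)
  have sub: "(\<lambda>s. k * s + m) ` {a..b} \<subseteq> {k * a + m..k * b + m}" using k by auto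
  have "continuous_on {a..b} (\<lambda>s. \<gamma> (k * s + m))"
    using \<gamma> unfolding C1_curve_def by (intro continuous_on_compose2[where g=\<gamma>, OF _ _ sub] continuous_intros) auto
  then show "continuous_on {a..b} \<gamma>'" using eq by (subst continuous_on_cong[OF refl eq]) auto
  fix c assume "c \<in> A"
  then obtain D where D: "\<forall>t\<in>{k * a + m..k * b + m} \<inter> \<gamma> -` chart_dom c. ((chart_map c \<circ> \<gamma>) has_vector_derivative D t) (at t within {k * a + m..k * b + m})"
    and cont: "continuous_on ({k * a + m..k * b + m} \<inter> \<gamma> -` chart_dom c) D"
    using \<gamma> unfolding C1_curve_def by blast
  show "\<exists>D. (\<forall>t\<in>{a..b} \<inter> \<gamma>' -` chart_dom c. ((chart_map c \<circ> \<gamma>') has_vector_derivative D t) (at t within {a..b})) \<and>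
    continuous_on ({a..b} \<inter> \<gamma>' -` chart_dom c) D"
  proof (intro exI conjI ballI)
    fix t assume t: "t \<in> {a..b} \<inter> \<gamma>' -` chart_dom c"
    have "((chart_map c \<circ> \<gamma>) has_vector_derivative D (k * t + m)) (at (k * t + m) within {k * a + m..k * b + m})"
      using D t eq k by auto
    from has_vector_derivative_within_subset[OF this sub]
    show "((chart_map c \<circ> \<gamma>') has_vector_derivative k *\<^sub>R D (k * t + m)) (at t within {a..b})"
      by (rule has_vector_derivative_affine) (use t eq in auto)
  next
    have "(\<lambda>s. k * s + m) ` ({a..b} \<inter> \<gamma>' -` chart_dom c) \<subseteq> {k * a + m..k * b + m} \<inter> \<gamma> -` chart_dom c"
      using eq k by auto
    then show "continuous_on ({a..b} \<inter> \<gamma>' -` chart_dom c) (\<lambda>t. k *\<^sub>R D (k * t + m))"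
      by (intro continuous_intros continuous_on_compose2[OF cont])
  qed
qed

text \<open>The relation between the curves is assumed on an open set around t because
  \<open>velocity\<close> is a two-sided derivative. The halves of a joined curve satisfy it away
  from the junction.\<close>

lemma speed_affine:
  assumes A: "smooth_atlas A" and g: "riemannian_metric A g" and r: "regular_at A \<gamma> (k * t + m)"
    and I: "open I" "t \<in> I" and eq: "\<And>s. s \<in> I \<Longrightarrow> \<gamma>' s = \<gamma> (k * s + m)" and k: "k > 0"
  shows "speed A g \<gamma>' t = k * speed A g \<gamma> (k * t + m)"
proof -
  let ?p = "\<gamma> (k * t + m)"
  obtain a where a: "a \<in> A" "?p \<in> chart_dom a" using smooth_atlas_cover[OF A] by blast
  have p: "\<gamma>' t = ?p" using eq I by simp
  define u where "u = velocity A \<gamma> (k * t + m) a"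
  have v: "velocity A \<gamma> (k * t + m) = coord_vector A a ?p u"
    unfolding u_def by (rule velocity_eq_coord_vector[OF A r a])
  have "velocity A \<gamma>' t = (\<lambda>c. k *\<^sub>R velocity A \<gamma> (k * t + m) c)"
  proof (rule velocity_eqI)
    fix c assume c: "c \<in> A" "\<gamma>' t \<in> chart_dom c"
    have "((chart_map c \<circ> \<gamma>) has_vector_derivative velocity A \<gamma> (k * t + m) c) (at (k * t + m))"
      using velocity_works[OF r c(1)] c(2) p by simp
    then have "((chart_map c \<circ> \<gamma>') has_vector_derivative k *\<^sub>R velocity A \<gamma> (k * t + m) c) (at t within I)"
      by (intro has_vector_derivative_affine[OF has_vector_derivative_at_within]) (use I eq in auto)
    then show "((chart_map c \<circ> \<gamma>') has_vector_derivative k *\<^sub>R velocity A \<gamma> (k * t + m) c) (at t)"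
      unfolding at_within_open[OF I(2) I(1)] .
  next
    fix c assume "c \<notin> A \<or> \<gamma>' t \<notin> chart_dom c"
    then show "k *\<^sub>R velocity A \<gamma> (k * t + m) c = 0" unfolding velocity_def p by auto
  qed
  also have "\<dots> = coord_vector A a ?p (k *\<^sub>R u)"
    using coord_vector_linear[OF A a, of k u 0 u] unfolding v by simp
  finally have "g (\<gamma>' t) (velocity A \<gamma>' t) (velocity A \<gamma>' t) = k\<^sup>2 * g ?p (coord_vector A a ?p u) (coord_vector A a ?p u)"
    using bilinear_lmul[OF bilinear_metric_coord_vector[OF A g a], of k] bilinear_rmul[OF bilinear_metric_coord_vector[OF A g a], of _ k]
    by (simp add: p power2_eq_square)
  then show ?thesis unfolding v using k by (simp add: real_sqrt_mult)
qed

text \<open>In charts c and c' the derivative of the image curve is J(\<gamma> s) E(s). Since c may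
  have to change along the curve, D is defined without choosing c, and its continuity is proved
  separately at each t.\<close>

lemma C1_curve_C1_map:
  assumes A: "smooth_atlas A" and F: "C1_map A F" and \<gamma>: "C1_curve A a b \<gamma>" and ab: "a < b"
  shows "C1_curve A a b (F \<circ> \<gamma>)"
  unfolding C1_curve_def
proof (intro conjI ballI)
  have c\<gamma>: "continuous_on {a..b} \<gamma>" using \<gamma> by (simp add: C1_curve_def)
  show "continuous_on {a..b} (F \<circ> \<gamma>)"
    using F c\<gamma> by (intro continuous_on_compose) (auto simp: C1_map_def intro: continuous_on_subset)
  fix c' assume c': "c' \<in> A"
  define S where "S = {a..b} \<inter> (F \<circ> \<gamma>) -` chart_dom c'"
  define D where "D = (\<lambda>t. vector_derivative (chart_map c' \<circ> (F \<circ> \<gamma>)) (at t within {a..b}))"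
  have key: "((chart_map c' \<circ> (F \<circ> \<gamma>)) has_vector_derivative D t) (at t within {a..b}) \<and> continuous (at t within S) D"
    if t: "t \<in> S" for t
  proof -
    obtain c where c: "c \<in> A" "\<gamma> t \<in> chart_dom c" using smooth_atlas_cover[OF A] by blast
    obtain E where E: "\<And>t. t \<in> {a..b} \<Longrightarrow> \<gamma> t \<in> chart_dom c \<Longrightarrow> ((chart_map c \<circ> \<gamma>) has_vector_derivative E t) (at t within {a..b})"
      and cE: "continuous_on ({a..b} \<inter> \<gamma> -` chart_dom c) E"
      using \<gamma> c unfolding C1_curve_def by (metis IntI vimageI)
    have ch: "is_chart c" by (rule smooth_atlas_chart[OF A c(1)])
    have d: "((chart_map c' \<circ> (F \<circ> \<gamma>)) has_vector_derivative chart_deriv F c c' (\<gamma> s) (E s)) (at s within {a..b})"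
      if "s \<in> S" "\<gamma> s \<in> chart_dom c" for s
      using that c\<gamma> by (intro has_vector_derivative_C1_map[OF A F c(1) c'] E)
        (auto simp: S_def continuous_on_eq_continuous_within)
    have Ds: "D s = chart_deriv F c c' (\<gamma> s) (E s)" if "s \<in> S" "\<gamma> s \<in> chart_dom c" for s
      unfolding D_def using d[OF that] that ab by (intro vector_derivative_within_closed_interval) (auto simp: S_def)
    \<comment> \<open>The times spent in chart c are relatively open in the interval. Hence W is a
      neighbourhood of t in S on which c may be used throughout.\<close>
    obtain T where T: "open T" "T \<inter> {a..b} = \<gamma> -` chart_dom c \<inter> {a..b}"
      using c\<gamma> ch unfolding continuous_on_open_invariant is_chart_def by blast
    define W where "W = S \<inter> T"
    have W: "s \<in> S" "\<gamma> s \<in> chart_dom c" "s \<in> {a..b}" "F (\<gamma> s) \<in> chart_dom c'" if "s \<in> W" for s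
      using that T(2) unfolding W_def S_def by (blast, blast, blast, auto)
    have "t \<in> T" using T(2) t c(2) unfolding S_def by blast
    then have tW: "t \<in> W" using t unfolding W_def by blast
    have cEW: "continuous_on W E" by (rule continuous_on_subset[OF cE]) (use W in auto)
    have "continuous_on (chart_dom c) (chart_map c)" using ch unfolding is_chart_def homeomorphism_def by blast
    then have c1: "continuous_on W (\<lambda>s. chart_map c (\<gamma> s))"
      using W by (intro continuous_on_compose2[OF _ continuous_on_subset[OF c\<gamma>]]) auto
    have "continuous_on (chart_map c ` (chart_dom c \<inter> F -` chart_dom c')) (\<lambda>y. frechet_derivative (chart_map c' \<circ> F \<circ> chart_inv c) (at y) v)" for v
      using F c(1) c' by (simp add: C1_map_def)
    then have c2: "continuous_on W (\<lambda>s. chart_deriv F c c' (\<gamma> s) v)" for v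
      by (rule continuous_on_compose2[OF _ c1]) (use W in auto)
    \<comment> \<open>A C^1 map provides continuity of its derivative for each fixed direction only;
      expanding the moving direction E s in the basis reduces to that case.\<close>
    have "continuous_on W (\<lambda>s. \<Sum>i\<in>Basis. (E s \<bullet> i) *\<^sub>R chart_deriv F c c' (\<gamma> s) i)"
      by (intro continuous_intros c2 cEW)
    moreover have "D s = (\<Sum>i\<in>Basis. (E s \<bullet> i) *\<^sub>R chart_deriv F c c' (\<gamma> s) i)" if s: "s \<in> W" for s
    proof -
      note l = linear_chart_deriv[OF F c(1) c' W(2,4)[OF s]]
      have "chart_deriv F c c' (\<gamma> s) (E s) = chart_deriv F c c' (\<gamma> s) (\<Sum>i\<in>Basis. (E s \<bullet> i) *\<^sub>R i)"
        by (simp add: euclidean_representation)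
      also have "\<dots> = (\<Sum>i\<in>Basis. (E s \<bullet> i) *\<^sub>R chart_deriv F c c' (\<gamma> s) i)"
        by (simp add: linear_sum[OF l] linear_cmul[OF l])
      finally show ?thesis using Ds W s by simp
    qed
    ultimately have "continuous_on W D" by (subst continuous_on_cong[OF refl]) auto
    then have "continuous (at t within W) D" using tW by (simp add: continuous_on_eq_continuous_within)
    moreover have "at t within W = at t within S"
      using \<open>t \<in> T\<close> T(1) by (rule at_within_nhd) (auto simp: W_def)
    ultimately show ?thesis using d[OF t c(2)] Ds[OF t c(2)] by simp
  qed
  show "\<exists>D. (\<forall>t\<in>{a..b} \<inter> (F \<circ> \<gamma>) -` chart_dom c'. ((chart_map c' \<circ> (F \<circ> \<gamma>)) has_vector_derivative D t) (at t within {a..b})) \<and>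
    continuous_on ({a..b} \<inter> (F \<circ> \<gamma>) -` chart_dom c') D"
    unfolding S_def[symmetric] continuous_on_eq_continuous_within
    by (rule exI[of _ D]) (use key in blast)
qed

lemma finite_interval_adjacent:
  fixes T :: "real set"
  assumes "finite T" "{x, y} \<subseteq> T" "T \<subseteq> {x..y}" "t \<in> {x..y} - T"
  shows "\<exists>a\<in>T. \<exists>b\<in>T. a < b \<and> {a<..<b} \<inter> T = {} \<and> t \<in> {a<..<b}"
proof -
  \<comment> \<open>The neighbours of t in T: the last break point before it and the first one after
    it.\<close>
  define a b where "a = Max (T \<inter> {..t})" and "b = Min (T \<inter> {t..})"
  have ne: "T \<inter> {..t} \<noteq> {}" "T \<inter> {t..} \<noteq> {}" using assms by auto
  have "a \<in> T \<inter> {..t}" "b \<in> T \<inter> {t..}" unfolding a_def b_def using assms ne by (intro Max_in Min_in; simp)+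
  moreover have "t \<notin> T" using assms by simp
  moreover have "s \<notin> T" if "s \<in> {a<..<b}" for s
  proof
    assume "s \<in> T"
    then have "s \<le> a \<or> b \<le> s"
      unfolding a_def b_def using assms(1) by (cases "s \<le> t") auto
    then show False using that by auto
  qed
  ultimately have "a \<in> T" "b \<in> T" "a < t" "t < b" "{a<..<b} \<inter> T = {}" by (auto simp: less_le)
  moreover from this have "t \<in> {a<..<b}" by simp
  ultimately show ?thesis by (metis less_trans)
qed

lemma piecewise_C1_curve_regular:
  assumes "piecewise_C1_curve A \<gamma>"
  obtains T where "finite T" "\<And>t. t \<in> {0..1} - T \<Longrightarrow> regular_at A \<gamma> t"
proof -
  obtain T where T: "finite T" "{0, 1} \<subseteq> T" "T \<subseteq> {0..1}"
    "\<forall>a\<in>T. \<forall>b\<in>T. a < b \<and> {a<..<b} \<inter> T = {} \<longrightarrow> C1_curve A a b \<gamma>"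
    using assms unfolding piecewise_C1_curve_def by blast
  have "regular_at A \<gamma> t" if "t \<in> {0..1} - T" for t
    using finite_interval_adjacent[OF T(1-3) that] T(4) C1_curve_regular by blast
  with T(1) show thesis by (rule that)
qed

lemma piecewise_C1_curve_C1_map:
  assumes "smooth_atlas A" "C1_map A F" "piecewise_C1_curve A \<gamma>"
  shows "piecewise_C1_curve A (F \<circ> \<gamma>)"
  using assms(3) C1_curve_C1_map[OF assms(1,2)] unfolding piecewise_C1_curve_def by meson

text \<open>At a break point the velocity is an unspecified value, and the odd function
  \<open>sqrt\<close> could be negative there; so the integrand is first set to 0 at these finitely
  many times. A non-integrable speed has integral 0.\<close>

lemma curve_length_nonneg:
  assumes A: "smooth_atlas A" and g: "riemannian_metric A g" and \<gamma>: "piecewise_C1_curve A \<gamma>"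
  shows "0 \<le> curve_length A g \<gamma>"
proof -
  obtain T where T: "finite T" "\<And>t. t \<in> {0..1} - T \<Longrightarrow> regular_at A \<gamma> t"
    using \<gamma> by (rule piecewise_C1_curve_regular) blast
  have "curve_length A g \<gamma> = integral {0..1} (\<lambda>t. if t \<in> T then 0 else speed A g \<gamma> t)"
    unfolding curve_length_def by (rule integral_spike[OF negligible_finite[OF T(1)]]) auto
  also have "\<dots> \<ge> 0"
  proof (cases "(\<lambda>t. if t \<in> T then 0 else speed A g \<gamma> t) integrable_on {0..1}")
    case True
    then show ?thesis using speed_nonneg[OF A g] T by (intro integral_nonneg) auto
  qed (simp add: not_integrable_integral)
  finally show ?thesis .
qed

lemma curve_length_isometric:
  assumes A: "smooth_atlas A" and F: "C1_map A F" and g: "isometric A g F" and \<gamma>: "piecewise_C1_curve A \<gamma>"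
  shows "curve_length A g (F \<circ> \<gamma>) = curve_length A g \<gamma>"
proof -
  obtain T where T: "finite T" "\<And>t. t \<in> {0..1} - T \<Longrightarrow> regular_at A \<gamma> t"
    using \<gamma> by (rule piecewise_C1_curve_regular) blast
  show ?thesis
    unfolding curve_length_def
    by (rule integral_spike[OF negligible_finite[OF T(1)]]) (rule speed_isometric[OF A F g T(2), symmetric])
qed

text \<open>Composition with F and with its inverse gives both inclusions between the two sets of
  curve lengths. Equal sets have equal \<open>Inf\<close>, whatever its value.\<close>

lemma riemannian_distance_isometric:
  assumes A: "smooth_atlas A" and F: "C1_map A F" "isometric A g F" and F': "C1_map A F'" "isometric A g F'"
    and inv: "\<And>x. F' (F x) = x" "\<And>x. F (F' x) = x"
  shows "riemannian_distance A g (F x) (F y) = riemannian_distance A g x y"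
proof -
  have sub: "{curve_length A g \<gamma> | \<gamma>. piecewise_C1_curve A \<gamma> \<and> \<gamma> 0 = x \<and> \<gamma> 1 = y} \<subseteq>
      {curve_length A g \<gamma> | \<gamma>. piecewise_C1_curve A \<gamma> \<and> \<gamma> 0 = H x \<and> \<gamma> 1 = H y}"
    if H: "C1_map A H" "isometric A g H" for x y H
  proof clarify
    fix \<gamma> assume \<gamma>: "piecewise_C1_curve A \<gamma>" and "x = \<gamma> 0" "y = \<gamma> 1"
    then show "\<exists>\<gamma>'. curve_length A g \<gamma> = curve_length A g \<gamma>' \<and> piecewise_C1_curve A \<gamma>' \<and> \<gamma>' 0 = H (\<gamma> 0) \<and> \<gamma>' 1 = H (\<gamma> 1)"
      using curve_length_isometric[OF A H \<gamma>] piecewise_C1_curve_C1_map[OF A H(1) \<gamma>]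
      by (intro exI[of _ "H \<circ> \<gamma>"]) auto
  qed
  show ?thesis
    unfolding riemannian_distance_def
    using sub[OF F, of x y] sub[OF F', of "F x" "F y"] unfolding inv by (intro arg_cong[where f=Inf]) blast
qed

lemma piecewise_C1_curve_join:
  assumes "piecewise_C1_curve A \<gamma>1" "piecewise_C1_curve A \<gamma>2" and join: "\<gamma>1 1 = \<gamma>2 0"
  shows "piecewise_C1_curve A (\<gamma>1 +++ \<gamma>2)"
proof -
  obtain T1 where T1: "finite T1" "{0, 1} \<subseteq> T1" "T1 \<subseteq> {0..1}"
    "\<forall>a\<in>T1. \<forall>b\<in>T1. a < b \<and> {a<..<b} \<inter> T1 = {} \<longrightarrow> C1_curve A a b \<gamma>1"
    using assms(1) unfolding piecewise_C1_curve_def by blast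
  obtain T2 where T2: "finite T2" "{0, 1} \<subseteq> T2" "T2 \<subseteq> {0..1}"
    "\<forall>a\<in>T2. \<forall>b\<in>T2. a < b \<and> {a<..<b} \<inter> T2 = {} \<longrightarrow> C1_curve A a b \<gamma>2"
    using assms(2) unfolding piecewise_C1_curve_def by blast
  \<comment> \<open>As 1 lies in T1, the junction 1/2 is a break point, and no interval between
    neighbouring break points straddles it.\<close>
  define T where "T = (\<lambda>t. t / 2) ` T1 \<union> (\<lambda>t. (t + 1) / 2) ` T2"
  have l: "2 * t \<in> T1" if "t \<in> T" "t \<le> 1/2" for t
    using that(1) unfolding T_def
  proof
    assume "t \<in> (\<lambda>t. (t + 1) / 2) ` T2"
    then obtain s where "s \<in> T2" "t = (s + 1) / 2" by blast
    with T2(3) that(2) have "2 * t = 1" by auto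
    with T1(2) show ?thesis by simp
  qed auto
  have r: "2 * t - 1 \<in> T2" if "t \<in> T" "t \<ge> 1/2" for t
    using that(1) unfolding T_def
  proof
    assume "t \<in> (\<lambda>t. t / 2) ` T1"
    then obtain s where "s \<in> T1" "t = s / 2" by blast
    with T1(3) that(2) have "2 * t - 1 = 0" by auto
    with T2(2) show ?thesis by simp
  next
    assume "t \<in> (\<lambda>t. (t + 1) / 2) ` T2"
    then obtain s where s: "s \<in> T2" "t = (s + 1) / 2" by blast
    from s(2) have "2 * t - 1 = s" by simp
    with s(1) show ?thesis by simp
  qed
  have l': "s / 2 \<in> T" if "s \<in> T1" for s using that by (auto simp: T_def)
  have r': "(s + 1) / 2 \<in> T" if "s \<in> T2" for s using that by (auto simp: T_def)
  have half: "1/2 \<in> T" using l'[of 1] T1(2) by simp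
  have "C1_curve A a b (\<gamma>1 +++ \<gamma>2)" if "a \<in> T" "b \<in> T" "a < b" and disj: "{a<..<b} \<inter> T = {}" for a b
  proof (cases "b \<le> 1/2")
    case True
    have "{2 * a<..<2 * b} \<inter> T1 = {}"
    proof safe
      fix s assume "s \<in> {2 * a<..<2 * b}" "s \<in> T1"
      then have "s / 2 \<in> {a<..<b} \<inter> T" using l' by auto
      with disj show "s \<in> {}" by simp
    qed
    then have "C1_curve A (2 * a + 0) (2 * b + 0) \<gamma>1"
      using that True T1(4)[THEN bspec, THEN bspec, of "2 * a" "2 * b"] l[of a] l[of b] by simp
    then show ?thesis by (rule C1_curve_affine) (use True in \<open>auto simp: joinpaths_def\<close>)
  next
    case False
    have a: "a \<ge> 1/2"
    proof (rule ccontr)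
      assume "\<not> a \<ge> 1/2"
      then have "1/2 \<in> {a<..<b} \<inter> T" using False half by auto
      with disj show False by simp
    qed
    have "{2 * a - 1<..<2 * b - 1} \<inter> T2 = {}"
    proof safe
      fix s assume "s \<in> {2 * a - 1<..<2 * b - 1}" "s \<in> T2"
      then have "(s + 1) / 2 \<in> {a<..<b} \<inter> T" using r' by auto
      with disj show "s \<in> {}" by simp
    qed
    then have "C1_curve A (2 * a + (-1)) (2 * b + (-1)) \<gamma>2"
      using that False a T2(4)[THEN bspec, THEN bspec, of "2 * a - 1" "2 * b - 1"] r[of a] r[of b] by simp
    \<comment> \<open>At 1/2 the joined path takes its value from the first curve;
      \<open>join\<close> makes it an affine copy of the second one on the closed interval.\<close>
    moreover have "(\<gamma>1 +++ \<gamma>2) s = \<gamma>2 (2 * s + (-1))" if "s \<in> {a..b}" for s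
    proof (cases "s \<le> 1/2")
      case True
      then have s: "s = 1/2" using a that by auto
      show ?thesis unfolding s using join by (simp add: joinpaths_def)
    qed (simp add: joinpaths_def)
    ultimately show ?thesis by (intro C1_curve_affine[of A 2 a "-1" b \<gamma>2]) auto
  qed
  moreover have "finite T" using T1 T2 by (simp add: T_def)
  moreover have "{0, 1} \<subseteq> T" using l'[of 0] r'[of 1] T1(2) T2(2) by auto
  moreover have "T \<subseteq> {0..1}" using T1(3) T2(3) by (auto simp: T_def)
  ultimately show ?thesis unfolding piecewise_C1_curve_def by blast
qed

text \<open>Affine substitution in the direction from the joined curve to its halves: integrability
  of the former yields that of the latter.\<close>

lemma has_integral_reparam:
  fixes s s' :: "real \<Rightarrow> real"
  assumes int: "(s' has_integral I) {a..b}" and k: "k > 0" and X: "finite X"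
    and eq: "\<And>t. t \<in> {a..b} - X \<Longrightarrow> s' t = k * s (k * t + m)"
  shows "(s has_integral I) {k * a + m..k * b + m}"
proof -
  have "((\<lambda>x. s' ((1/k) *\<^sub>R x + (- m/k))) has_integral (I /\<^sub>R (1/k) ^ DIM(real)))
     (cbox ((a - (-m/k)) /\<^sub>R (1/k)) ((b - (-m/k)) /\<^sub>R (1/k)))"
    using int k by (intro has_integral_affinity') auto
  also have "I /\<^sub>R (1/k) ^ DIM(real) = k * I" by simp
  also have "cbox ((a - (-m/k)) /\<^sub>R (1/k)) ((b - (-m/k)) /\<^sub>R (1/k)) = {k * a + m..k * b + m}"
    using k by (simp add: field_simps)
  finally have "((\<lambda>x. s' (x/k - m/k)) has_integral k * I) {k * a + m..k * b + m}" by simp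
  from has_integral_mult_right[OF this, of "1/k"]
  have *: "((\<lambda>x. (1/k) * s' (x/k - m/k)) has_integral I) {k * a + m..k * b + m}" using k by simp
  show ?thesis
  proof (rule has_integral_spike_finite[OF _ _ *])
    show "finite ((\<lambda>t. k * t + m) ` X)" using X by simp
    fix x assume x: "x \<in> {k * a + m..k * b + m} - (\<lambda>t. k * t + m) ` X"
    have kx: "k * (x/k - m/k) + m = x" using k by (simp add: field_simps)
    have "x/k - m/k \<notin> X" using x kx by (metis DiffD2 image_eqI)
    moreover have "x/k - m/k \<in> {a..b}" using x k by (auto simp: field_simps)
    ultimately have "s' (x/k - m/k) = k * s x" using eq[of "x/k - m/k"] kx by simp
    then show "s x = (1/k) * s' (x/k - m/k)" using k by simp
  qed
qed

text \<open>If the speed of the joined curve is not integrable, its length is \<open>0\<close>, so that no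
  integrability has to be proved.\<close>

lemma curve_length_join_le:
  assumes A: "smooth_atlas A" and g: "riemannian_metric A g"
    and \<gamma>1: "piecewise_C1_curve A \<gamma>1" and \<gamma>2: "piecewise_C1_curve A \<gamma>2"
  shows "curve_length A g (\<gamma>1 +++ \<gamma>2) \<le> curve_length A g \<gamma>1 + curve_length A g \<gamma>2"
proof (cases "speed A g (\<gamma>1 +++ \<gamma>2) integrable_on {0..1}")
  case False
  then have "curve_length A g (\<gamma>1 +++ \<gamma>2) = 0" unfolding curve_length_def by (rule not_integrable_integral)
  then show ?thesis using curve_length_nonneg[OF A g \<gamma>1] curve_length_nonneg[OF A g \<gamma>2] by simp
next
  case True
  let ?s = "speed A g (\<gamma>1 +++ \<gamma>2)"
  obtain X1 where X1: "finite X1" "\<And>t. t \<in> {0..1} - X1 \<Longrightarrow> regular_at A \<gamma>1 t"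
    using \<gamma>1 by (rule piecewise_C1_curve_regular) blast
  obtain X2 where X2: "finite X2" "\<And>t. t \<in> {0..1} - X2 \<Longrightarrow> regular_at A \<gamma>2 t"
    using \<gamma>2 by (rule piecewise_C1_curve_regular) blast
  have "?s integrable_on {0..1/2}" "?s integrable_on {1/2..1}"
    using True by (auto intro: integrable_on_subinterval)
  then have i: "(?s has_integral integral {0..1/2} ?s) {0..1/2}" "(?s has_integral integral {1/2..1} ?s) {1/2..1}"
    by (auto intro: integrable_integral)
  have "(speed A g \<gamma>1 has_integral integral {0..1/2} ?s) {2 * 0 + 0..2 * (1/2) + 0}"
  \<comment> \<open>The exceptional set consists of the rescaled break points and of the junction,
    around which the joined curve is not a copy of one half.\<close>
  proof (rule has_integral_reparam[OF i(1), where X="insert (1/2) ((\<lambda>t. t/2) ` X1)"])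
    fix t assume t: "t \<in> {0..1/2} - insert (1/2) ((\<lambda>t. t/2) ` X1)"
    have "2 * t \<notin> X1"
    proof
      assume "2 * t \<in> X1"
      then have "(2 * t) / 2 \<in> (\<lambda>t. t/2) ` X1" by (rule imageI)
      with t show False by simp
    qed
    with t have "regular_at A \<gamma>1 (2 * t + 0)" by (intro X1(2)) auto
    then show "?s t = 2 * speed A g \<gamma>1 (2 * t + 0)"
      by (rule speed_affine[OF A g, where I="{..<1/2}"]) (use t in \<open>auto simp: joinpaths_def\<close>)
  qed (use X1 in auto)
  then have L1: "curve_length A g \<gamma>1 = integral {0..1/2} ?s"
    unfolding curve_length_def by (intro integral_unique) simp
  have "(speed A g \<gamma>2 has_integral integral {1/2..1} ?s) {2 * (1/2) + (-1)..2 * 1 + (-1)}"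
  proof (rule has_integral_reparam[OF i(2), where X="insert (1/2) ((\<lambda>t. (t + 1)/2) ` X2)"])
    fix t assume t: "t \<in> {1/2..1} - insert (1/2) ((\<lambda>t. (t + 1)/2) ` X2)"
    have "2 * t + (-1) \<notin> X2"
    proof
      assume "2 * t + (-1) \<in> X2"
      then have "((2 * t + (-1)) + 1)/2 \<in> (\<lambda>t. (t + 1)/2) ` X2" by (rule imageI)
      with t show False by simp
    qed
    with t have "regular_at A \<gamma>2 (2 * t + (-1))" by (intro X2(2)) auto
    then show "?s t = 2 * speed A g \<gamma>2 (2 * t + (-1))"
      by (rule speed_affine[OF A g, where I="{1/2<..}"]) (use t in \<open>auto simp: joinpaths_def\<close>)
  qed (use X2 in auto)
  then have L2: "curve_length A g \<gamma>2 = integral {1/2..1} ?s"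
    unfolding curve_length_def by (intro integral_unique) simp
  have "curve_length A g (\<gamma>1 +++ \<gamma>2) = integral {0..1/2} ?s + integral {1/2..1} ?s"
    unfolding curve_length_def using True by (intro Henstock_Kurzweil_Integration.integral_combine[symmetric]) auto
  then show ?thesis using L1 L2 by simp
qed

text \<open>Near p the entries of the Gram matrix are bounded, so a straight segment in coordinates
  has length at most a constant times its Euclidean length. This is the only comparison between d
  and the topology that the openness of balls relies on.\<close>

lemma chart_segment:
  fixes A :: "('a::topological_space, real^'n) chart set"
  assumes A: "smooth_atlas A" and g: "riemannian_metric A g" and c: "c \<in> A" "p \<in> chart_dom c"
  obtains \<delta> K where "\<delta> > 0" "K \<ge> 0"
    "\<And>z. z \<in> ball (chart_map c p) \<delta> \<Longrightarrow> \<exists>\<sigma>. piecewise_C1_curve A \<sigma> \<and> \<sigma> 0 = p \<and> \<sigma> 1 = chart_inv c z \<and>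
       curve_length A g \<sigma> \<le> K * dist (chart_map c p) z"
proof -
  define y0 where "y0 = chart_map c p"
  define Y where "Y = chart_map c ` chart_dom c"
  define h where "h = (\<lambda>y. \<Sum>k\<in>UNIV. \<Sum>l\<in>UNIV. \<bar>gram_matrix A g c (chart_inv c y) $ k $ l\<bar>)"
  \<comment> \<open>The summand 1 makes {h < M} an open neighbourhood of y0, by continuity of
    h.\<close>
  define M where "M = h y0 + 1"
  have ch: "is_chart c" by (rule smooth_atlas_chart[OF A c(1)])
  have Y: "open Y" "continuous_on Y (chart_inv c)" "y0 \<in> Y"
    using ch c(2) unfolding Y_def is_chart_def homeomorphism_def y0_def by blast+
  have "continuous_on Y h"
    unfolding h_def Y_def by (intro continuous_on_sum continuous_on_rabs continuous_on_gram_matrix[OF g c(1)])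
  then have "open (Y \<inter> h -` {..<M})" using Y by (intro continuous_open_preimage) auto
  moreover have "y0 \<in> Y \<inter> h -` {..<M}" using Y by (simp add: M_def)
  ultimately obtain \<delta> where \<delta>: "\<delta> > 0" "ball y0 \<delta> \<subseteq> Y \<inter> h -` {..<M}" by (rule openE)
  have M: "M \<ge> 0" unfolding M_def h_def by (auto intro!: add_nonneg_nonneg sum_nonneg)
  show thesis
  proof (rule that[OF \<delta>(1), of "sqrt M"])
    show "0 \<le> sqrt M" using M by simp
    fix z assume "z \<in> ball (chart_map c p) \<delta>"
    then have z: "z \<in> ball y0 \<delta>" by (simp add: y0_def)
    define u where "u = z - y0"
    define l where "l = (\<lambda>t::real. y0 + t *\<^sub>R u)"
    define \<sigma> where "\<sigma> = (\<lambda>t. chart_inv c (l t))"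
    have lb: "l t \<in> ball y0 \<delta>" if "t \<in> {0..1}" for t
    proof -
      have "(1 - t) *\<^sub>R y0 + t *\<^sub>R z \<in> ball y0 \<delta>"
        using that z \<delta>(1) by (intro convexD[OF convex_ball]) auto
      moreover have "(1 - t) *\<^sub>R y0 + t *\<^sub>R z = l t" by (simp add: l_def u_def algebra_simps)
      ultimately show ?thesis by simp
    qed
    then have "l t \<in> Y \<inter> h -` {..<M}" if "t \<in> {0..1}" for t using that \<delta>(2) by blast
    then have lY: "l t \<in> Y" and lM: "h (l t) < M" if "t \<in> {0..1}" for t using that by auto
    have lcont: "continuous_on S l" for S unfolding l_def by (intro continuous_intros)
    have \<sigma>: "\<sigma> t \<in> chart_dom c" "chart_map c (\<sigma> t) = l t" if "t \<in> {0..1}" for t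
      using lY[OF that] chart_inv_in_dom[OF ch] chart_map_chart_inv[OF ch] unfolding \<sigma>_def Y_def by auto
    have cont: "continuous_on {0..1} \<sigma>"
      unfolding \<sigma>_def using lY by (intro continuous_on_compose2[OF Y(2) lcont]) auto
    have dl: "(l has_vector_derivative u) (at t within S)" for t S
      unfolding l_def by (auto intro!: derivative_eq_intros simp: has_vector_derivative_def)
    have dc: "((chart_map c \<circ> \<sigma>) has_vector_derivative u) (at t within {0..1})" if "t \<in> {0..1}" for t
      by (rule has_vector_derivative_transform[OF that _ dl]) (simp add: \<sigma>)
    have C1: "C1_curve A 0 1 \<sigma>"
      unfolding C1_curve_def
    proof (intro conjI ballI cont)
      fix c' assume c': "c' \<in> A"
      let ?D = "\<lambda>t. frechet_derivative (chart_map c' \<circ> id \<circ> chart_inv c) (at (chart_map c (\<sigma> t))) u"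
      have D: "((chart_map c' \<circ> \<sigma>) has_vector_derivative ?D t) (at t within {0..1})"
        if t: "t \<in> {0..1} \<inter> \<sigma> -` chart_dom c'" for t
        using has_vector_derivative_C1_map[OF A C1_map_id[OF A] c(1) c', of \<sigma> t "{0..1}" u] t dc cont \<sigma>
        by (auto simp: continuous_on_eq_continuous_within)
      have cD: "continuous_on ({0..1} \<inter> \<sigma> -` chart_dom c') ?D"
      proof -
        have "continuous_on (chart_map c ` (chart_dom c \<inter> id -` chart_dom c')) (\<lambda>y. frechet_derivative (chart_map c' \<circ> id \<circ> chart_inv c) (at y) u)"
          using C1_map_id[OF A] c(1) c' by (simp add: C1_map_def)
        moreover have "continuous_on ({0..1} \<inter> \<sigma> -` chart_dom c') (\<lambda>t. chart_map c (\<sigma> t))"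
          by (subst continuous_on_cong[OF refl, of _ _ l]) (auto simp: \<sigma> lcont)
        moreover have "(\<lambda>t. chart_map c (\<sigma> t)) ` ({0..1} \<inter> \<sigma> -` chart_dom c') \<subseteq> chart_map c ` (chart_dom c \<inter> id -` chart_dom c')"
          using \<sigma>(1) by auto
        ultimately show ?thesis by (rule continuous_on_compose2)
      qed
      show "\<exists>D. (\<forall>t\<in>{0..1} \<inter> \<sigma> -` chart_dom c'. ((chart_map c' \<circ> \<sigma>) has_vector_derivative D t) (at t within {0..1})) \<and>
        continuous_on ({0..1} \<inter> \<sigma> -` chart_dom c') D"
        by (intro exI[of _ ?D] conjI ballI D cD)
    qed
    have "piecewise_C1_curve A \<sigma>"
      unfolding piecewise_C1_curve_def
    proof (intro exI[of _ "{0, 1}"] conjI ballI impI)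
      fix a b :: real assume "a \<in> {0, 1}" "b \<in> {0, 1}" "a < b \<and> {a<..<b} \<inter> {0, 1} = {}"
      then have "a = 0" "b = 1" by auto
      with C1 show "C1_curve A a b \<sigma>" by simp
    qed auto
    moreover have "\<sigma> 0 = p" using ch c by (simp add: \<sigma>_def l_def y0_def)
    moreover have "\<sigma> 1 = chart_inv c z" by (simp add: \<sigma>_def l_def u_def)
    moreover have "curve_length A g \<sigma> \<le> sqrt M * dist (chart_map c p) z"
    proof -
      \<comment> \<open>In chart c the velocity is the constant u. Bounding each product of two
        components of u by |u|^2 leaves the sum h of the absolute Gram entries, which is below M
        along the segment.\<close>
      have sp: "speed A g \<sigma> t \<le> sqrt M * norm u" if t: "t \<in> {0..1} - {0, 1}" for t
      proof -
        have t': "t \<in> {0<..<1}" "t \<in> {0..1}" using t by auto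
        note r = C1_curve_regular[OF C1 t'(1)]
        have "((chart_map c \<circ> \<sigma>) has_vector_derivative u) (at t)"
          using dc[OF t'(2)] at_within_interior[of t "{0..1}"] t'(1) by simp
        then have "velocity A \<sigma> t c = u"
          using \<sigma>(1)[OF t'(2)] c(1) by (simp add: velocity_def vector_derivative_at)
        with velocity_eq_coord_vector[OF A r c(1) \<sigma>(1)[OF t'(2)]]
        have v: "velocity A \<sigma> t = coord_vector A c (\<sigma> t) u" by simp
        have "g (\<sigma> t) (velocity A \<sigma> t) (velocity A \<sigma> t) = (\<Sum>k\<in>UNIV. \<Sum>j\<in>UNIV. u$k * u$j * gram_matrix A g c (\<sigma> t) $ k $ j)"
          unfolding v by (rule metric_gram_matrix[OF A g c(1) \<sigma>(1)[OF t'(2)]])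
        also have "\<dots> \<le> (\<Sum>k\<in>UNIV. \<Sum>j\<in>UNIV. (norm u)\<^sup>2 * \<bar>gram_matrix A g c (\<sigma> t) $ k $ j\<bar>)"
        proof (intro sum_mono)
          fix k j
          have "u$k * u$j * gram_matrix A g c (\<sigma> t) $ k $ j \<le> \<bar>u$k\<bar> * \<bar>u$j\<bar> * \<bar>gram_matrix A g c (\<sigma> t) $ k $ j\<bar>"
            by (metis abs_ge_self abs_mult)
          also have "\<dots> \<le> (norm u * norm u) * \<bar>gram_matrix A g c (\<sigma> t) $ k $ j\<bar>"
            by (intro mult_right_mono mult_mono component_le_norm_cart) auto
          finally show "u$k * u$j * gram_matrix A g c (\<sigma> t) $ k $ j \<le> (norm u)\<^sup>2 * \<bar>gram_matrix A g c (\<sigma> t) $ k $ j\<bar>"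
            by (simp add: power2_eq_square)
        qed
        also have "\<dots> = (norm u)\<^sup>2 * h (l t)" by (simp add: h_def \<sigma>_def sum_distrib_left)
        also have "\<dots> \<le> (norm u)\<^sup>2 * M" using lM[OF t'(2)] by (intro mult_left_mono) auto
        finally have "speed A g \<sigma> t \<le> sqrt ((norm u)\<^sup>2 * M)" by (rule real_sqrt_le_mono)
        then show ?thesis by (simp add: real_sqrt_mult mult.commute)
      qed
      have Mu: "0 \<le> sqrt M * norm u" using M by simp
      have "curve_length A g \<sigma> = integral {0..1} (\<lambda>t. if t \<in> {0, 1} then 0 else speed A g \<sigma> t)"
        unfolding curve_length_def by (rule integral_spike[of "{0, 1}"]) auto
      also have "\<dots> \<le> sqrt M * norm u"
      proof (cases "(\<lambda>t. if t \<in> {0, 1} then 0 else speed A g \<sigma> t) integrable_on {0..1}")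
        case True
        then have "integral {0..1} (\<lambda>t. if t \<in> {0, 1} then 0 else speed A g \<sigma> t) \<le> integral {0..1} (\<lambda>t::real. sqrt M * norm u)"
          by (rule integral_le) (use sp Mu in auto)
        then show ?thesis by simp
      qed (use Mu in \<open>simp add: not_integrable_integral\<close>)
      finally show ?thesis by (simp add: u_def y0_def dist_norm norm_minus_commute)
    qed
    ultimately show "\<exists>\<sigma>. piecewise_C1_curve A \<sigma> \<and> \<sigma> 0 = p \<and> \<sigma> 1 = chart_inv c z \<and>
       curve_length A g \<sigma> \<le> sqrt M * dist (chart_map c p) z" by blast
  qed
qed

section \<open>Openness of balls and measurability of the distance\<close>

abbreviation reachable :: "('a::topological_space, 'e::euclidean_space) chart set \<Rightarrow> 'a \<Rightarrow> 'a \<Rightarrow> bool" where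
  "reachable A x y \<equiv> \<exists>\<gamma>. piecewise_C1_curve A \<gamma> \<and> \<gamma> 0 = x \<and> \<gamma> 1 = y"

text \<open>A curve from x to y of length below r still has length below r after a short coordinate
  segment at y is joined to it. For reachable y the infimum is over a nonempty set, so such a curve
  exists.\<close>

lemma open_reachable_ball:
  fixes A :: "('a::topological_space, real^'n) chart set"
  assumes A: "smooth_atlas A" and g: "riemannian_metric A g"
  shows "open {y. reachable A x y \<and> riemannian_distance A g x y < r}"
proof (subst open_subopen, intro ballI)
  fix y assume y: "y \<in> {y. reachable A x y \<and> riemannian_distance A g x y < r}"
  then obtain \<gamma> where \<gamma>: "piecewise_C1_curve A \<gamma>" "\<gamma> 0 = x" "\<gamma> 1 = y" "curve_length A g \<gamma> < r"
    unfolding riemannian_distance_def by (force dest: cInf_lessD[rotated])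
  obtain c where c: "c \<in> A" "y \<in> chart_dom c" using smooth_atlas_cover[OF A] by blast
  have ch: "is_chart c" by (rule smooth_atlas_chart[OF A c(1)])
  obtain \<delta> K where \<delta>: "\<delta> > 0" and K: "K \<ge> 0" and seg:
    "\<And>z. z \<in> ball (chart_map c y) \<delta> \<Longrightarrow> \<exists>\<sigma>. piecewise_C1_curve A \<sigma> \<and> \<sigma> 0 = y \<and> \<sigma> 1 = chart_inv c z \<and>
       curve_length A g \<sigma> \<le> K * dist (chart_map c y) z"
    using chart_segment[OF A g c] by metis
  \<comment> \<open>The denominator is K + 1 because K may be 0. Within this radius the added
    segment is shorter than the slack r minus the length of \<gamma>.\<close>
  define \<epsilon> where "\<epsilon> = min \<delta> ((r - curve_length A g \<gamma>) / (K + 1))"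
  have \<epsilon>: "\<epsilon> > 0" using \<delta> K \<gamma>(4) by (simp add: \<epsilon>_def)
  define U where "U = chart_dom c \<inter> chart_map c -` ball (chart_map c y) \<epsilon>"
  have "open U"
    unfolding U_def
  proof (rule continuous_open_preimage)
    show "continuous_on (chart_dom c) (chart_map c)" "open (chart_dom c)"
      using ch unfolding is_chart_def homeomorphism_def by blast+
  qed simp
  moreover have "y \<in> U" using c \<epsilon> by (simp add: U_def)
  moreover have "U \<subseteq> {y. reachable A x y \<and> riemannian_distance A g x y < r}"
  proof
    fix z assume z: "z \<in> U"
    then have zd: "z \<in> chart_dom c" and zb: "dist (chart_map c y) (chart_map c z) < \<epsilon>" by (auto simp: U_def)
    obtain \<sigma> where \<sigma>: "piecewise_C1_curve A \<sigma>" "\<sigma> 0 = y" "\<sigma> 1 = z"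
      "curve_length A g \<sigma> \<le> K * dist (chart_map c y) (chart_map c z)"
      using seg[of "chart_map c z"] zb ch zd by (auto simp: \<epsilon>_def)
    have "K * dist (chart_map c y) (chart_map c z) \<le> (K + 1) * dist (chart_map c y) (chart_map c z)"
      by (intro mult_right_mono) auto
    also have "\<dots> < (K + 1) * \<epsilon>" using zb K by (intro mult_strict_left_mono) auto
    also have "\<dots> \<le> (K + 1) * ((r - curve_length A g \<gamma>) / (K + 1))"
      using K by (intro mult_left_mono) (auto simp: \<epsilon>_def)
    also have "\<dots> = r - curve_length A g \<gamma>" using K by simp
    finally have len: "curve_length A g (\<gamma> +++ \<sigma>) < r"
      using curve_length_join_le[OF A g \<gamma>(1) \<sigma>(1)] \<sigma>(4) by simp
    have j: "piecewise_C1_curve A (\<gamma> +++ \<sigma>)" "(\<gamma> +++ \<sigma>) 0 = x" "(\<gamma> +++ \<sigma>) 1 = z"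
      using piecewise_C1_curve_join[OF \<gamma>(1) \<sigma>(1)] \<gamma> \<sigma> by (auto simp: joinpaths_def)
    have "riemannian_distance A g x z \<le> curve_length A g (\<gamma> +++ \<sigma>)"
      unfolding riemannian_distance_def
    proof (rule cInf_lower)
      show "bdd_below {curve_length A g \<gamma> |\<gamma>. piecewise_C1_curve A \<gamma> \<and> \<gamma> 0 = x \<and> \<gamma> 1 = z}"
        using curve_length_nonneg[OF A g] by (intro bdd_belowI[of _ 0]) auto
    qed (use j in blast)
    with len j show "z \<in> {y. reachable A x y \<and> riemannian_distance A g x y < r}" by auto
  qed
  ultimately show "\<exists>T. open T \<and> y \<in> T \<and> T \<subseteq> {y. reachable A x y \<and> riemannian_distance A g x y < r}" by blast
qed

text \<open>At points that no curve from \<open>x\<close> reaches, the distance is the unspecified constant \<open>Inf {}\<close>;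
  hence measurability does not need connectedness.\<close>

lemma borel_measurable_riemannian_distance:
  fixes A :: "('a::topological_space, real^'n) chart set"
  assumes A: "smooth_atlas A" and g: "riemannian_metric A g"
  shows "(\<lambda>y. riemannian_distance A g x y) \<in> borel_measurable borel"
  unfolding borel_measurable_iff_less
proof
  fix r
  let ?P = "{y. reachable A x y}"
  have "?P = (\<Union>n::nat. {y. reachable A x y \<and> riemannian_distance A g x y < real n})"
    using reals_Archimedean2 by auto
  also have "open \<dots>" using open_reachable_ball[OF A g] by blast
  finally have P: "open ?P" .
  have unreach: "riemannian_distance A g x y = Inf {}" if "y \<notin> ?P" for y
    unfolding riemannian_distance_def using that by (intro arg_cong[where f=Inf]) blast
  have "{y. riemannian_distance A g x y < r} = {y. reachable A x y \<and> riemannian_distance A g x y < r} \<union>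
      (if Inf {} < r then - ?P else {})"
  proof (rule set_eqI)
    fix y
    show "y \<in> {y. riemannian_distance A g x y < r} \<longleftrightarrow>
        y \<in> {y. reachable A x y \<and> riemannian_distance A g x y < r} \<union> (if Inf {} < r then - ?P else {})"
    proof (cases "y \<in> ?P")
      case False
      from unreach[OF False] False show ?thesis by (cases "Inf {} < r") auto
    qed auto
  qed
  also have "\<dots> \<in> sets borel" using P open_reachable_ball[OF A g, of x r] by auto
  finally show "{y \<in> space borel. riemannian_distance A g x y < r} \<in> sets borel" by simp
qed

section \<open>Change of variables\<close>

text \<open>The change of variables theorem of the library requires the index type of the coordinates to
  be well-ordered. We transport it to an arbitrary finite index type \<open>'n\<close> along the well-ordered
  copy \<open>'n idx\<close>.\<close>

typedef 'n idx = "{..<CARD('n::finite)}"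
  by (rule exI[of _ 0]) simp

instantiation idx :: (finite) wellorder
begin

definition "x \<le> y \<longleftrightarrow> Rep_idx x \<le> Rep_idx y"
definition "x < y \<longleftrightarrow> Rep_idx x < Rep_idx y"

instance
proof
  fix P :: "'a idx \<Rightarrow> bool" and a
  assume *: "\<And>x. (\<And>y. y < x \<Longrightarrow> P y) \<Longrightarrow> P x"
  show "P a"
    by (induction "Rep_idx a" arbitrary: a rule: less_induct) (auto intro: * simp: less_idx_def)
qed (auto simp: less_eq_idx_def less_idx_def Rep_idx_inject)

end

instance idx :: (finite) finite
proof
  have "(UNIV :: 'a idx set) = Abs_idx ` {..<CARD('a)}"
    by (metis Abs_idx_cases UNIV_eq_I imageI)
  then show "finite (UNIV :: 'a idx set)" by (metis finite_imageI finite_lessThan)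
qed

lemma bij_idx: "\<exists>r :: 'n::finite idx \<Rightarrow> 'n. bij r"
proof (rule finite_same_card_bij)
  show "card (UNIV :: 'n idx set) = card (UNIV :: 'n set)"
    using type_definition.card[OF type_definition_idx] by simp
qed simp_all

section \<open>Relabelling coordinates\<close>

definition reindex :: "('m::finite \<Rightarrow> 'n::finite) \<Rightarrow> real^'n \<Rightarrow> real^'m" where
  "reindex r x = (\<chi> i. x $ r i)"

lemma linear_reindex: "linear (reindex r)"
  by (rule linearI) (simp_all add: reindex_def vec_eq_iff)

lemma measurable_reindex [measurable]: "reindex r \<in> borel_measurable borel"
  using linear_reindex by (intro borel_measurable_continuous_onI linear_continuous_on) (simp add: linear_conv_bounded_linear)

lemma reindex_inv: "bij r \<Longrightarrow> reindex (inv r) (reindex r x) = x" "bij r \<Longrightarrow> reindex r (reindex (inv r) y) = y"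
  by (simp_all add: reindex_def vec_eq_iff bij_is_surj surj_f_inv_f bij_is_inj)

lemma prod_Basis_cart: "(\<Prod>b\<in>(Basis :: (real^'n) set). f b) = (\<Prod>i\<in>UNIV. f (axis i 1))"
  by (simp add: Basis_vec_def axis_eq_axis prod.UNION_disjoint)

text \<open>Lebesgue measure is determined by its values on boxes; relabelling maps boxes to boxes
  and only permutes the side lengths.\<close>

lemma distr_lborel_reindex:
  fixes r :: "'m::finite \<Rightarrow> 'n::finite"
  assumes r: "bij r"
  shows "distr lborel borel (reindex r) = (lborel :: (real^'m) measure)"
proof (rule lborel_eqI[symmetric])
  fix l u :: "real^'m" assume lu: "\<And>b. b \<in> Basis \<Longrightarrow> l \<bullet> b \<le> u \<bullet> b"
  have "l $ i \<le> u $ i" for i using lu[of "axis i 1"] by (simp add: cart_eq_inner_axis axis_in_Basis_iff)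
  then have lu': "reindex (inv r) l \<bullet> b \<le> reindex (inv r) u \<bullet> b" if "b \<in> Basis" for b
    using that by (auto simp: Basis_vec_def inner_axis reindex_def)
  have "reindex r -` box l u = box (reindex (inv r) l) (reindex (inv r) u)"
    using r by (auto simp: mem_box_cart reindex_def bij_is_surj surj_f_inv_f bij_is_inj)
      (metis bij_inv_eq_iff)+
  then have "emeasure (distr lborel borel (reindex r)) (box l u) = emeasure lborel (box (reindex (inv r) l) (reindex (inv r) u))"
    by (subst emeasure_distr) auto
  also have "\<dots> = (\<Prod>b\<in>Basis. (reindex (inv r) u - reindex (inv r) l) \<bullet> b)"
    using lu' by (rule emeasure_lborel_box)
  also have "(\<Prod>b\<in>Basis. (reindex (inv r) u - reindex (inv r) l) \<bullet> b) = (\<Prod>j\<in>UNIV. u $ inv r j - l $ inv r j)"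
    by (simp add: prod_Basis_cart inner_axis reindex_def)
  also have "\<dots> = (\<Prod>i\<in>UNIV. u $ i - l $ i)"
    using bij_imp_bij_inv[OF r] by (rule prod.reindex_bij_betw)
  also have "\<dots> = (\<Prod>b\<in>Basis. (u - l) \<bullet> b)"
    by (simp add: prod_Basis_cart inner_axis)
  finally show "emeasure (distr lborel borel (reindex r)) (box l u) = (\<Prod>b\<in>Basis. (u - l) \<bullet> b)" .
qed simp

lemma nn_integral_reindex:
  fixes r :: "'m::finite \<Rightarrow> 'n::finite"
  assumes r: "bij r" and F: "F \<in> borel_measurable borel"
  shows "(\<integral>\<^sup>+x. F x \<partial>lborel) = (\<integral>\<^sup>+z. F (reindex (inv r) z) \<partial>lborel)"
proof -
  have "(\<integral>\<^sup>+x. F x \<partial>lborel) = (\<integral>\<^sup>+x. F x \<partial>distr lborel borel (reindex (inv r)))"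
    by (simp add: distr_lborel_reindex bij_imp_bij_inv r)
  also have "\<dots> = (\<integral>\<^sup>+z. F (reindex (inv r) z) \<partial>lborel)" using F by (subst nn_integral_distr) auto
  finally show ?thesis .
qed

text \<open>Conjugation by r is a sign-preserving bijection between the permutations of the two
  index types, so the Leibniz sums agree term by term.\<close>

lemma det_reindex:
  fixes M :: "real^'n^'n" and r :: "'m::finite \<Rightarrow> 'n"
  assumes r: "bij r"
  shows "det (\<chi> i j. M $ r i $ r j) = det M"
proof -
  have bb: "bij_betw r UNIV UNIV" "bij_betw (inv r) UNIV UNIV" using r by (auto intro: bij_imp_bij_inv)
  have ap: "map_permutation UNIV r p (r i) = r (p i)" for p i
    using r by (intro map_permutation_apply) (auto simp: bij_def)
  have "det (\<chi> i j. M $ r i $ r j) = (\<Sum>p | p permutes (UNIV :: 'm set). of_int (sign p) * (\<Prod>i\<in>UNIV. M $ r i $ r (p i)))"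
    by (simp add: det_def)
  also have "\<dots> = (\<Sum>p | p permutes (UNIV :: 'n set). of_int (sign p) * (\<Prod>i\<in>UNIV. M $ i $ p i))"
  proof (rule sum.reindex_bij_witness[where i="map_permutation UNIV (inv r)" and j="map_permutation UNIV r"])
    fix p assume "p \<in> {p. p permutes (UNIV :: 'm set)}"
    then have p: "p permutes UNIV" by simp
    show "map_permutation UNIV (inv r) (map_permutation UNIV r p) = p"
      using r p by (intro map_permutation_compose_inv[OF bb(1)]) (auto simp: bij_is_inj)
    show "map_permutation UNIV r p \<in> {p. p permutes UNIV}"
      using map_permutation_permutes[OF bb(1) p] by simp
    have "sign (map_permutation UNIV r p) = sign p"
      using r p by (intro sign_map_permutation) (auto simp: bij_def)
    moreover have "(\<Prod>i\<in>UNIV. M $ i $ map_permutation UNIV r p i) = (\<Prod>i\<in>UNIV. M $ r i $ map_permutation UNIV r p (r i))"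
      by (rule prod.reindex_bij_betw[OF bb(1), symmetric])
    ultimately show "of_int (sign (map_permutation UNIV r p)) * (\<Prod>i\<in>UNIV. M $ i $ map_permutation UNIV r p i) =
        of_int (sign p) * (\<Prod>i\<in>UNIV. M $ r i $ r (p i))"
      by (simp add: ap)
  next
    fix p assume "p \<in> {p. p permutes (UNIV :: 'n set)}"
    then have p: "p permutes UNIV" by simp
    show "map_permutation UNIV r (map_permutation UNIV (inv r) p) = p"
      using r p by (intro map_permutation_compose_inv[OF bb(2)]) (auto simp: bij_is_surj surj_f_inv_f)
    show "map_permutation UNIV (inv r) p \<in> {p. p permutes UNIV}"
      using map_permutation_permutes[OF bb(2) p] by simp
  qed
  also have "\<dots> = det M" by (simp add: det_def)
  finally show ?thesis .
qed

lemma det_matrix_reindex: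
  fixes r :: "'m::finite \<Rightarrow> 'n::finite" and L :: "real^'n \<Rightarrow> real^'n"
  assumes r: "bij r"
  shows "det (matrix (\<lambda>v. reindex r (L (reindex (inv r) v)))) = det (matrix L)"
proof -
  have ax: "reindex (inv r) (axis j 1) = axis (r j) 1" for j
    using r by (auto simp: reindex_def axis_def vec_eq_iff bij_is_inj bij_is_surj surj_f_inv_f)
  have "matrix (\<lambda>v. reindex r (L (reindex (inv r) v))) = (\<chi> i j. matrix L $ r i $ r j)"
    by (simp add: matrix_def ax vec_eq_iff) (simp add: reindex_def)
  then show ?thesis using det_reindex[OF r] by simp
qed

text \<open>A bridge between \<open>has_integral\<close>, in which the change of variables is
  phrased, and the nonnegative integrals that define the Riemannian measure. Being an equivalence,
  it transfers divergence too.\<close>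

lemma nn_integral_lborel_iff_has_integral:
  fixes f :: "'e::euclidean_space \<Rightarrow> real"
  assumes "\<And>x. x \<in> S \<Longrightarrow> 0 \<le> f x" "(\<lambda>x. if x \<in> S then f x else 0) \<in> borel_measurable borel" "0 \<le> b"
  shows "(\<integral>\<^sup>+x. ennreal (f x) * indicator S x \<partial>lborel) = ennreal b \<longleftrightarrow> (f has_integral b) S"
proof
  assume "(\<integral>\<^sup>+x. ennreal (f x) * indicator S x \<partial>lborel) = ennreal b"
  also have "(\<integral>\<^sup>+x. ennreal (f x) * indicator S x \<partial>lborel) = (\<integral>\<^sup>+x. ennreal (if x \<in> S then f x else 0) \<partial>lborel)"
    by (intro nn_integral_cong) auto
  finally have "((\<lambda>x. if x \<in> S then f x else 0) has_integral b) UNIV"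
    using assms by (intro nn_integral_has_integral) auto
  then show "(f has_integral b) S" by (simp only: has_integral_restrict_UNIV)
next
  assume "(f has_integral b) S"
  then show "(\<integral>\<^sup>+x. ennreal (f x) * indicator S x \<partial>lborel) = ennreal b"
    using assms by (intro nn_integral_has_integral_lebesgue') auto
qed

text \<open>Both sides attain the same finite values b, and a side that attains none is \<infinity>;
  together this is equality in \<open>ennreal\<close>.\<close>

lemma nn_integral_change_of_variables_wellorder:
  fixes \<phi> \<psi> :: "real^'m::{finite,wellorder} \<Rightarrow> real^'m::_" and f :: "real^'m::_ \<Rightarrow> real"
  assumes \<phi>: "\<And>x. x \<in> S \<Longrightarrow> (\<phi> has_derivative \<phi>' x) (at x within S)"
    and \<psi>: "\<And>y. y \<in> T \<Longrightarrow> (\<psi> has_derivative \<psi>' y) (at y within T)"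
    and f: "\<And>y. y \<in> T \<Longrightarrow> 0 \<le> f y"
    and ST: "\<And>x. x \<in> S \<Longrightarrow> \<phi> x \<in> T \<and> \<psi> (\<phi> x) = x"
    and TS: "\<And>y. y \<in> T \<Longrightarrow> \<psi> y \<in> S \<and> \<phi> (\<psi> y) = y"
    and id: "\<And>y. y \<in> T \<Longrightarrow> \<psi>' y \<circ> \<phi>' (\<psi> y) = id"
    and mT: "(\<lambda>y. if y \<in> T then f y else 0) \<in> borel_measurable borel"
    and mS: "(\<lambda>x. if x \<in> S then \<bar>det (matrix (\<phi>' x))\<bar> * f (\<phi> x) else 0) \<in> borel_measurable borel"
  shows "(\<integral>\<^sup>+x. ennreal (\<bar>det (matrix (\<phi>' x))\<bar> * f (\<phi> x)) * indicator S x \<partial>lborel) = (\<integral>\<^sup>+y. ennreal (f y) * indicator T y \<partial>lborel)"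
    (is "?R = ?L")
proof -
  have key: "?R = ennreal b \<longleftrightarrow> ?L = ennreal b" if "0 \<le> b" for b
  proof -
    have "?R = ennreal b \<longleftrightarrow> ((\<lambda>x. \<bar>det (matrix (\<phi>' x))\<bar> * f (\<phi> x)) has_integral b) S"
      by (rule nn_integral_lborel_iff_has_integral[OF _ mS that]) (use f ST in simp)
    also have "\<dots> \<longleftrightarrow> (f has_integral b) T"
      by (rule cov_invertible_nonneg_eq[of S \<phi> \<phi>' T \<psi> \<psi>' f b]) fact+
    also have "\<dots> \<longleftrightarrow> ?L = ennreal b"
      by (rule nn_integral_lborel_iff_has_integral[OF f mT that, symmetric])
    finally show ?thesis .
  qed
  show ?thesis
  proof (cases ?R rule: ennreal_cases)
    case (real b)
    with key[of b] show ?thesis by simp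
  next
    case top
    then show ?thesis
    proof (cases ?L rule: ennreal_cases)
      case (real b)
      with key[of b] show ?thesis by simp
    qed simp
  qed
qed

text \<open>All data are conjugated with a relabelling of coordinates, which preserves Lebesgue
  measure and the determinant of the derivative.\<close>

lemma nn_integral_change_of_variables:
  fixes \<phi> \<psi> :: "real^'n \<Rightarrow> real^'n" and f :: "real^'n \<Rightarrow> real"
  assumes \<phi>: "\<And>x. x \<in> S \<Longrightarrow> (\<phi> has_derivative \<phi>' x) (at x within S)"
    and \<psi>: "\<And>y. y \<in> T \<Longrightarrow> (\<psi> has_derivative \<psi>' y) (at y within T)"
    and f: "\<And>y. y \<in> T \<Longrightarrow> 0 \<le> f y"
    and ST: "\<And>x. x \<in> S \<Longrightarrow> \<phi> x \<in> T \<and> \<psi> (\<phi> x) = x"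
    and TS: "\<And>y. y \<in> T \<Longrightarrow> \<psi> y \<in> S \<and> \<phi> (\<psi> y) = y"
    and id: "\<And>y. y \<in> T \<Longrightarrow> \<psi>' y \<circ> \<phi>' (\<psi> y) = id"
    and mT: "(\<lambda>y. if y \<in> T then f y else 0) \<in> borel_measurable borel"
    and mS: "(\<lambda>x. if x \<in> S then \<bar>det (matrix (\<phi>' x))\<bar> * f (\<phi> x) else 0) \<in> borel_measurable borel"
  shows "(\<integral>\<^sup>+x. ennreal (\<bar>det (matrix (\<phi>' x))\<bar> * f (\<phi> x)) * indicator S x \<partial>lborel) = (\<integral>\<^sup>+y. ennreal (f y) * indicator T y \<partial>lborel)"
proof -
  obtain r :: "'n idx \<Rightarrow> 'n" where r: "bij r" using bij_idx by blast
  let ?k = "reindex r" and ?k' = "reindex (inv r)"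
  let ?\<phi>' = "\<lambda>z v. ?k (\<phi>' (?k' z) (?k' v))" and ?\<psi>' = "\<lambda>z v. ?k (\<psi>' (?k' z) (?k' v))"
  have bl: "bounded_linear ?k" "bounded_linear ?k'" using linear_reindex by (auto simp: linear_conv_bounded_linear)
  have conj: "((\<lambda>z. ?k (F (?k' z))) has_derivative (\<lambda>v. ?k (F' (?k' v)))) (at z within ?k' -` X)"
    if "(F has_derivative F') (at (?k' z) within X)" for F F' z X
  proof -
    have "(F has_derivative F') (at (?k' z) within ?k' ` (?k' -` X))"
      using that by (rule has_derivative_subset) auto
    from diff_chain_within[OF bounded_linear_imp_has_derivative[OF bl(2)] this]
    have "(F \<circ> ?k' has_derivative F' \<circ> ?k') (at z within ?k' -` X)" .
    from bounded_linear.has_derivative[OF bl(1) this]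
    show ?thesis by (simp add: o_def)
  qed
  have meas: "(\<lambda>x. ennreal (h x) * indicator X x) \<in> borel_measurable borel"
    if "(\<lambda>x. if x \<in> X then h x else 0) \<in> borel_measurable borel" for X and h :: "real^'n \<Rightarrow> real"
  proof -
    have "(\<lambda>x. ennreal (h x) * indicator X x) = (\<lambda>x. ennreal (if x \<in> X then h x else 0))" by (auto simp: fun_eq_iff)
    then show ?thesis using that by simp
  qed
  have "(\<integral>\<^sup>+z. ennreal (\<bar>det (matrix (?\<phi>' z))\<bar> * (\<lambda>y. f (?k' y)) (?k (\<phi> (?k' z)))) * indicator (?k' -` S) z \<partial>lborel) =
      (\<integral>\<^sup>+z. ennreal ((\<lambda>y. f (?k' y)) z) * indicator (?k' -` T) z \<partial>lborel)"
  proof (rule nn_integral_change_of_variables_wellorder[where \<psi>="\<lambda>z. ?k (\<psi> (?k' z))" and \<psi>'="?\<psi>'"])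
    fix z assume "z \<in> ?k' -` S"
    then show "((\<lambda>z. ?k (\<phi> (?k' z))) has_derivative ?\<phi>' z) (at z within ?k' -` S)" by (intro conj \<phi>) simp
  next
    fix z assume "z \<in> ?k' -` T"
    then show "((\<lambda>z. ?k (\<psi> (?k' z))) has_derivative ?\<psi>' z) (at z within ?k' -` T)" by (intro conj \<psi>) simp
  next
    fix z assume z: "z \<in> ?k' -` T"
    then have "\<psi>' (?k' z) (\<phi>' (\<psi> (?k' z)) v) = v" for v using id[of "?k' z"] by (metis comp_apply id_apply vimageE)
    then show "?\<psi>' z \<circ> ?\<phi>' (?k (\<psi> (?k' z))) = Fun.id" using r by (auto simp: reindex_inv fun_eq_iff)
  next
    show "(\<lambda>y. if y \<in> ?k' -` T then f (?k' y) else 0) \<in> borel_measurable borel"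
      using measurable_compose[OF measurable_reindex mT, of "inv r"] by simp
    show "(\<lambda>x. if x \<in> ?k' -` S then \<bar>det (matrix (?\<phi>' x))\<bar> * f (?k' (?k (\<phi> (?k' x)))) else 0) \<in> borel_measurable borel"
      using measurable_compose[OF measurable_reindex mS, of "inv r"] by (simp add: reindex_inv[OF r] det_matrix_reindex[OF r] cong: if_cong)
  qed (use f ST TS r in \<open>auto simp: reindex_inv\<close>)
  also have "\<dots> = (\<integral>\<^sup>+y. ennreal (f y) * indicator T y \<partial>lborel)"
    by (subst nn_integral_reindex[OF r meas[OF mT]]) (auto intro!: nn_integral_cong simp: indicator_def)
  also have "(\<integral>\<^sup>+z. ennreal (\<bar>det (matrix (?\<phi>' z))\<bar> * (\<lambda>y. f (?k' y)) (?k (\<phi> (?k' z)))) * indicator (?k' -` S) z \<partial>lborel) =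
      (\<integral>\<^sup>+x. ennreal (\<bar>det (matrix (\<phi>' x))\<bar> * f (\<phi> x)) * indicator S x \<partial>lborel)"
    by (subst nn_integral_reindex[OF r meas[OF mS]])
      (auto intro!: nn_integral_cong simp: indicator_def reindex_inv[OF r] det_matrix_reindex[OF r])
  finally show ?thesis .
qed

section \<open>The Riemannian measure\<close>

text \<open>A countable subcover, made disjoint, cuts U into pieces that each lie in one member of
  the cover; countable additivity adds them up.\<close>

lemma measure_eqI_open_cover:
  fixes M N :: "'a::second_countable_topology measure"
  assumes M: "sets M = sets borel" and N: "sets N = sets borel"
    and op: "\<And>V. V \<in> \<F> \<Longrightarrow> open V" and cover: "\<Union>\<F> = UNIV"
    and eq: "\<And>V U. V \<in> \<F> \<Longrightarrow> U \<in> sets borel \<Longrightarrow> U \<subseteq> V \<Longrightarrow> emeasure M U = emeasure N U"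
  shows "M = N"
proof (rule measure_eqI)
  fix U assume U: "U \<in> sets M"
  obtain \<F>' where \<F>': "\<F>' \<subseteq> \<F>" "countable \<F>'" "\<Union>\<F>' = \<Union>\<F>"
    using Lindelof[of \<F>] op by blast
  then have ne: "\<F>' \<noteq> {}" using cover by auto
  define B where "B = from_nat_into \<F>'"
  have B: "range B = \<F>'" unfolding B_def using range_from_nat_into[OF ne \<F>'(2)] .
  then have "open (B n)" for n using op \<F>'(1) by blast
  then have Bb [measurable]: "disjointed B n \<inter> U \<in> sets borel" for n
    using U M by (auto simp: disjointed_def)
  have dis: "disjoint_family (\<lambda>n. disjointed B n \<inter> U)"
    using disjoint_family_disjointed[of B] by (auto simp: disjoint_family_on_def)
  have "(\<Union>n. disjointed B n) = UNIV" using UN_disjointed_eq[of B] B \<F>'(3) cover by simp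
  then have UU: "(\<Union>n. disjointed B n \<inter> U) = U" by blast
  have "emeasure M (disjointed B n \<inter> U) = emeasure N (disjointed B n \<inter> U)" for n
  proof -
    have "B n \<in> \<F>" using B \<F>'(1) by blast
    moreover have "disjointed B n \<inter> U \<subseteq> B n" using disjointed_subset[of B n] by blast
    ultimately show ?thesis by (intro eq[of "B n"] Bb)
  qed
  moreover have "range (\<lambda>n. disjointed B n \<inter> U) \<subseteq> sets borel" using Bb by blast
  ultimately show "emeasure M U = emeasure N U"
    using suminf_emeasure[OF _ dis, of M] suminf_emeasure[OF _ dis, of N] by (simp only: M N UU simp_thms)
qed (simp add: M N)

lemma chart_image_in_borel:
  assumes ch: "is_chart c" and U: "U \<in> sets borel" "U \<subseteq> chart_dom c"
  shows "chart_map c ` U \<in> sets borel"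
proof -
  let ?Y = "chart_map c ` chart_dom c"
  have Y: "open ?Y" "continuous_on ?Y (chart_inv c)"
    using ch unfolding is_chart_def homeomorphism_def by blast+
  have "chart_inv c \<in> borel_measurable (restrict_space borel ?Y)"
    using Y(2) by (rule borel_measurable_continuous_on_restrict)
  from measurable_sets[OF this U(1)]
  have "chart_inv c -` U \<inter> ?Y \<in> sets borel"
    using Y(1) by (simp add: sets_restrict_space_iff space_restrict_space)
  also have "chart_inv c -` U \<inter> ?Y = chart_map c ` U" using ch U(2) by auto
  finally show ?thesis .
qed

text \<open>The change of variables asks for a nonnegative integrand. Truncating the density at 0
  provides one, and \<open>ennreal\<close> does not see the truncation.\<close>

lemma ennreal_max_0_left: "ennreal (max 0 x) = ennreal x"
  by (simp add: max_def ennreal_neg)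

text \<open>The cover consists of the sets on which both the point and its preimage under F stay in
  one chart each. For U inside such a set both measures are coordinate integrals, and the densities
  differ by the Jacobian.\<close>

lemma distr_riemannian_measure_isometric:
  fixes A :: "('a::second_countable_topology, real^'n) chart set"
  assumes A: "smooth_atlas A" and g: "riemannian_metric A g" and \<rho>: "riemannian_measure A g \<rho>"
    and F: "C1_map A F" "isometric A g F" and F': "C1_map A F'"
    and inv: "\<And>x. F' (F x) = x" "\<And>x. F (F' x) = x"
  shows "distr \<rho> borel F = \<rho>"
proof (rule measure_eqI_open_cover[where \<F>="{F' -` chart_dom c \<inter> chart_dom c' | c c'. c \<in> A \<and> c' \<in> A}"])
  have sets: "sets \<rho> = sets borel" using \<rho> by (simp add: riemannian_measure_def)
  show "sets (distr \<rho> borel F) = sets borel" "sets \<rho> = sets borel" using sets by simp_all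
  have "F \<in> borel_measurable borel"
    using F(1) by (intro borel_measurable_continuous_onI) (simp add: C1_map_def)
  then have Fm: "F \<in> \<rho> \<rightarrow>\<^sub>M borel" by (simp cong: measurable_cong_sets add: sets)
  fix V assume V: "V \<in> {F' -` chart_dom c \<inter> chart_dom c' | c c'. c \<in> A \<and> c' \<in> A}"
  then obtain a b where ab: "a \<in> A" "b \<in> A" and V_eq: "V = F' -` chart_dom a \<inter> chart_dom b" by blast
  have ch: "is_chart a" "is_chart b" using smooth_atlas_chart[OF A ab(1)] smooth_atlas_chart[OF A ab(2)] .
  show "open V"
    unfolding V_eq using ch by (intro open_Int open_vimage_C1_map[OF F']) (auto simp: is_chart_def)
  fix U assume U: "U \<in> sets borel" "U \<subseteq> V"
  define W where "W = F -` U"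
  define D where "D = (\<lambda>c y. sqrt (det (gram_matrix A g c (chart_inv c y))))"
  let ?\<phi> = "chart_map b \<circ> F \<circ> chart_inv a" and ?\<psi> = "chart_map a \<circ> F' \<circ> chart_inv b"
  have U': "U \<subseteq> chart_dom b" using U V_eq by auto
  have W: "W \<subseteq> chart_dom a" "W \<in> sets borel"
  proof -
    show "W \<subseteq> chart_dom a"
    proof
      fix x assume "x \<in> W"
      then have "F x \<in> V" using U W_def by blast
      then show "x \<in> chart_dom a" by (simp add: V_eq inv)
    qed
    show "W \<in> sets borel"
      using measurable_sets[OF \<open>F \<in> borel_measurable borel\<close> U(1)] by (simp add: W_def)
  qed
  have FW: "F x \<in> U" if "x \<in> W" for x using that by (simp add: W_def)
  have F'U: "F' y \<in> W" if "y \<in> U" for y using that by (simp add: W_def inv)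
  have Dcont: "continuous_on (chart_map c ` X) (\<lambda>y. max 0 (D c y))" if "c \<in> A" "X \<subseteq> chart_dom c" for c X
    unfolding D_def using that
    by (intro continuous_on_max continuous_on_const continuous_on_subset[OF continuous_on_sqrt_det_gram_matrix[OF g]]) auto
  have DS: "\<bar>det (matrix (frechet_derivative ?\<phi> (at y)))\<bar> * max 0 (D b (?\<phi> y)) = max 0 (D a y)"
    if y: "y \<in> chart_map a ` W" for y
  proof -
    obtain x where x: "x \<in> W" "y = chart_map a x" using y by blast
    have xa: "x \<in> chart_dom a" "F x \<in> chart_dom b" using x W FW U' by auto
    have "D a y = \<bar>det (matrix (frechet_derivative ?\<phi> (at y)))\<bar> * D b (?\<phi> y)"
      using sqrt_det_gram_matrix_isometric[OF A g F ab xa] x xa ch by (simp add: D_def)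
    then show ?thesis by (simp add: max_def zero_le_mult_iff)
  qed
  have "emeasure \<rho> W = (\<integral>\<^sup>+y\<in>chart_map a ` W. ennreal (D a y) \<partial>lborel)"
    unfolding D_def using \<rho> ab(1) W by (simp add: riemannian_measure_def)
  also have "\<dots> = (\<integral>\<^sup>+y. ennreal (\<bar>det (matrix (frechet_derivative ?\<phi> (at y)))\<bar> * max 0 (D b (?\<phi> y))) * indicator (chart_map a ` W) y \<partial>lborel)"
    using DS by (intro nn_integral_cong) (simp add: indicator_def ennreal_max_0_left)
  also have "\<dots> = (\<integral>\<^sup>+y. ennreal (max 0 (D b y)) * indicator (chart_map b ` U) y \<partial>lborel)"
  proof (rule nn_integral_change_of_variables[where \<psi>="?\<psi>" and \<psi>'="\<lambda>y. frechet_derivative ?\<psi> (at y)"])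
    fix y assume "y \<in> chart_map a ` W"
    then obtain x where x: "x \<in> W" "y = chart_map a x" by blast
    have xa: "x \<in> chart_dom a" "F x \<in> chart_dom b" using x W FW U' by auto
    show "(?\<phi> has_derivative frechet_derivative ?\<phi> (at y)) (at y within chart_map a ` W)"
      unfolding x(2) by (rule has_derivative_at_withinI[OF C1_map_has_derivative[OF F(1) ab xa]])
    show "?\<phi> y \<in> chart_map b ` U \<and> ?\<psi> (?\<phi> y) = y"
      using x xa ch FW by (auto simp: inv)
  next
    fix y assume "y \<in> chart_map b ` U"
    then obtain x where x: "x \<in> U" "y = chart_map b x" by blast
    have xb: "x \<in> chart_dom b" "F' x \<in> chart_dom a" using x W F'U U' by auto
    show "(?\<psi> has_derivative frechet_derivative ?\<psi> (at y)) (at y within chart_map b ` U)"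
      unfolding x(2) by (rule has_derivative_at_withinI[OF C1_map_has_derivative[OF F' ab(2,1) xb]])
    show "?\<psi> y \<in> chart_map a ` W \<and> ?\<phi> (?\<psi> y) = y"
      using x xb ch F'U by (auto simp: inv)
    have "frechet_derivative ?\<psi> (at y) (frechet_derivative ?\<phi> (at (?\<psi> y)) v) = v" for v
    proof -
      have "chart_deriv (F' \<circ> F) a a (F' x) v = chart_deriv F' b a (F (F' x)) (chart_deriv F a b (F' x) v)"
        using xb by (intro chart_deriv_chain[OF A F(1) F' ab(1,2,1)]) (simp_all add: inv)
      moreover have "F' \<circ> F = id" by (simp add: fun_eq_iff inv)
      ultimately show ?thesis
        using chart_deriv_id[OF ch(1) xb(2)] x xb ch by (simp add: inv)
    qed
    then show "frechet_derivative ?\<psi> (at y) \<circ> frechet_derivative ?\<phi> (at (?\<psi> y)) = id" by (simp add: fun_eq_iff)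
  next
    show "(\<lambda>y. if y \<in> chart_map b ` U then max 0 (D b y) else 0) \<in> borel_measurable borel"
      using chart_image_in_borel[OF ch(2) U(1) U'] Dcont[OF ab(2) U']
      by (intro borel_measurable_continuous_on_if continuous_on_const)
    have "(\<lambda>y. if y \<in> chart_map a ` W then max 0 (D a y) else 0) \<in> borel_measurable borel"
      using chart_image_in_borel[OF ch(1) W(2,1)] Dcont[OF ab(1) W(1)]
      by (intro borel_measurable_continuous_on_if continuous_on_const)
    \<comment> \<open>The transformed integrand coincides with the truncated density in chart a,
      whose continuity is known; measurability of the Jacobian is not a separate task.\<close>
    also have "(\<lambda>y. if y \<in> chart_map a ` W then max 0 (D a y) else 0) =
        (\<lambda>y. if y \<in> chart_map a ` W then \<bar>det (matrix (frechet_derivative ?\<phi> (at y)))\<bar> * max 0 (D b (?\<phi> y)) else 0)"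
      by (intro ext if_cong refl DS[symmetric])
    finally show "\<dots> \<in> borel_measurable borel" .
  qed simp
  also have "\<dots> = (\<integral>\<^sup>+y\<in>chart_map b ` U. ennreal (D b y) \<partial>lborel)" by (simp add: ennreal_max_0_left)
  also have "\<dots> = emeasure \<rho> U"
    unfolding D_def using \<rho> ab(2) U(1) U' by (simp add: riemannian_measure_def)
  finally show "emeasure (distr \<rho> borel F) U = emeasure \<rho> U"
    using emeasure_distr[OF Fm U(1)] sets_eq_imp_space_eq[OF sets] by (simp add: W_def)
next
  have "x \<in> \<Union>{F' -` chart_dom c \<inter> chart_dom c' | c c'. c \<in> A \<and> c' \<in> A}" for x
  proof -
    obtain c c' where "c \<in> A" "F' x \<in> chart_dom c" "c' \<in> A" "x \<in> chart_dom c'"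
      using smooth_atlas_cover[OF A] by meson
    then show ?thesis by (intro UnionI[of "F' -` chart_dom c \<inter> chart_dom c'"]) (blast, simp)
  qed
  then show "\<Union>{F' -` chart_dom c \<inter> chart_dom c' | c c'. c \<in> A \<and> c' \<in> A} = UNIV" by (intro set_eqI iffI UNIV_I)
qed

text \<open>The density is continuous, hence bounded on a small coordinate ball, which has finite
  Lebesgue measure.\<close>

lemma riemannian_measure_locally_finite:
  fixes A :: "('a::topological_space, real^'n) chart set"
  assumes A: "smooth_atlas A" and g: "riemannian_metric A g" and \<rho>: "riemannian_measure A g \<rho>"
  shows "\<exists>V. open V \<and> p \<in> V \<and> emeasure \<rho> V \<noteq> \<infinity>"
proof -
  obtain c where c: "c \<in> A" "p \<in> chart_dom c" using smooth_atlas_cover[OF A] by blast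
  have ch: "is_chart c" by (rule smooth_atlas_chart[OF A c(1)])
  let ?Y = "chart_map c ` chart_dom c"
  define D where "D = (\<lambda>y. sqrt (det (gram_matrix A g c (chart_inv c y))))"
  have Y: "open ?Y" "open (chart_dom c)" "continuous_on (chart_dom c) (chart_map c)"
    using ch unfolding is_chart_def homeomorphism_def by blast+
  define K where "K = D (chart_map c p) + 1"
  have "open (?Y \<inter> D -` {..<K})"
    unfolding D_def using Y by (intro continuous_open_preimage continuous_on_sqrt_det_gram_matrix[OF g c(1)]) auto
  moreover have "chart_map c p \<in> ?Y \<inter> D -` {..<K}" using c by (simp add: K_def)
  ultimately obtain \<delta> where \<delta>: "\<delta> > 0" "ball (chart_map c p) \<delta> \<subseteq> ?Y \<inter> D -` {..<K}" by (rule openE)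
  define V where "V = chart_dom c \<inter> chart_map c -` ball (chart_map c p) \<delta>"
  have V: "open V" unfolding V_def using Y(3,2) by (rule continuous_open_preimage) simp
  have cV: "chart_map c ` V \<subseteq> ball (chart_map c p) \<delta>" by (auto simp: V_def)
  have "V \<subseteq> chart_dom c" by (auto simp: V_def)
  moreover have "V \<in> sets borel" using V by simp
  ultimately have "emeasure \<rho> V = (\<integral>\<^sup>+y\<in>chart_map c ` V. ennreal (D y) \<partial>lborel)"
    unfolding D_def using \<rho> c(1) by (simp add: riemannian_measure_def)
  also have "\<dots> \<le> (\<integral>\<^sup>+y. ennreal K * indicator (ball (chart_map c p) \<delta>) y \<partial>lborel)"
  proof (rule nn_integral_mono)
    fix y
    show "ennreal (D y) * indicator (chart_map c ` V) y \<le> ennreal K * indicator (ball (chart_map c p) \<delta>) y"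
    proof (cases "y \<in> chart_map c ` V")
      case True
      then have "y \<in> ball (chart_map c p) \<delta>" using cV by blast
      moreover from this have "D y < K" using \<delta>(2) by blast
      ultimately show ?thesis using True by (simp add: ennreal_leI)
    qed simp
  qed
  also have "\<dots> = ennreal K * emeasure lborel (ball (chart_map c p) \<delta>)" by (rule nn_integral_cmult_indicator) simp
  also have "\<dots> < \<infinity>"
    using emeasure_bounded_finite[OF bounded_ball, of "chart_map c p" \<delta>] by (simp add: ennreal_mult_less_top)
  finally have "emeasure \<rho> V \<noteq> \<infinity>" by simp
  moreover have "p \<in> V" using c \<delta>(1) by (simp add: V_def)
  ultimately show ?thesis using V by blast
qed

text \<open>By Lindelof's theorem countably many open sets of finite measure already cover the
  manifold.\<close>

lemma sigma_finite_riemannian_measure: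
  fixes A :: "('a::second_countable_topology, real^'n) chart set"
  assumes A: "smooth_atlas A" and g: "riemannian_metric A g" and \<rho>: "riemannian_measure A g \<rho>"
  shows "sigma_finite_measure \<rho>"
proof
  have sets: "sets \<rho> = sets borel" using \<rho> by (simp add: riemannian_measure_def)
  define \<F> where "\<F> = {V. open V \<and> emeasure \<rho> V \<noteq> \<infinity>}"
  obtain \<F>' where \<F>': "\<F>' \<subseteq> \<F>" "countable \<F>'" "\<Union>\<F>' = \<Union>\<F>"
    using Lindelof[of \<F>] unfolding \<F>_def by blast
  have "\<Union>\<F> = UNIV"
    using riemannian_measure_locally_finite[OF A g \<rho>] unfolding \<F>_def by blast
  with \<F>' sets_eq_imp_space_eq[OF sets]
  show "\<exists>A. countable A \<and> A \<subseteq> sets \<rho> \<and> \<Union>A = space \<rho> \<and> (\<forall>a\<in>A. emeasure \<rho> a \<noteq> \<infinity>)"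
    by (intro exI[of _ \<F>']) (auto simp: \<F>_def sets)
qed

section \<open>Invariance on the Lie group and conclusion\<close>

context lie_group
begin

lemma riemannian_distance_left_invariant:
  assumes "left_invariant mul A g"
  shows "riemannian_distance A g (mul a x) (mul a y) = riemannian_distance A g x y"
  using assms unfolding left_invariant_def
  by (intro riemannian_distance_isometric[OF smooth_atlas, where F'="\<lambda>x. mul (iv a) x"] C1_map_left_translation)
    (auto simp: assoc[symmetric] left_inverse right_inverse)

end

text \<open>Right translation by a is a C^1 isometry whose inverse is the translation by a^{-1}, so
  the transformation result for isometries applies to it.\<close>

lemma right_haar_riemannian_measure:
  fixes A :: "('a::{t2_space, second_countable_topology}, real^'n) chart set"
  assumes "lie_group mul e iv A" and g: "riemannian_metric A g" "right_invariant mul A g"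
    and \<rho>: "riemannian_measure A g \<rho>"
  shows "right_haar mul e iv \<rho>"
proof -
  interpret lie_group mul e iv A by fact
  interpret sigma_finite_measure \<rho> by (rule sigma_finite_riemannian_measure[OF smooth_atlas g(1) \<rho>])
  have sets: "sets \<rho> = sets borel" using \<rho> by (simp add: riemannian_measure_def)
  show ?thesis
  proof
    show "continuous_on UNIV iv" using smooth_inverse by (simp add: smooth_map_def)
    fix U and a assume U: "U \<in> sets (borel :: 'a measure)"
    have "distr \<rho> borel (\<lambda>x. mul x a) = \<rho>"
      using g(2) unfolding right_invariant_def
      by (intro distr_riemannian_measure_isometric[OF smooth_atlas g(1) \<rho>, where F'="\<lambda>x. mul x (iv a)"] C1_map_right_translation)
        (auto simp: assoc left_inverse right_inverse)
    moreover have "(\<lambda>x. mul x a) \<in> \<rho> \<rightarrow>\<^sub>M borel"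
      using borel_measurable_continuous_onI[OF continuous_right_translation] by (simp cong: measurable_cong_sets add: sets)
    ultimately show "emeasure \<rho> ((\<lambda>x. mul x a) -` U) = emeasure \<rho> U"
      using emeasure_distr[OF _ U, of "\<lambda>x. mul x a" \<rho>] sets_eq_imp_space_eq[OF sets] by simp
  qed (fact sets, fact continuous_mul)
qed

theorem theorem4p2:
  fixes mul :: "'a \<Rightarrow> 'a \<Rightarrow> 'a::{t2_space, second_countable_topology}"
    and e :: 'a and iv :: "'a \<Rightarrow> 'a"
    and A :: "('a, real^'n) chart set"
    and gL gR :: "('a, real^'n) metric"
    and d :: "'a \<Rightarrow> 'a \<Rightarrow> real" and \<rho> :: "'a measure"
    and w :: "real \<Rightarrow> real" and f :: "'a \<Rightarrow> real" and p q :: ennreal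
  assumes "lie_group mul e iv A"
    and "connected (UNIV :: 'a set)" and "\<not> compact (UNIV :: 'a set)"
    and "riemannian_metric A gL" and "left_invariant mul A gL"
    and "riemannian_metric A gR" and "right_invariant mul A gR"
    and "\<forall>u\<in>tangent_space A e. \<forall>v\<in>tangent_space A e. gL e u v = gR e u v"
    and "d = riemannian_distance A gL" and "riemannian_measure A gR \<rho>"
    and "radius_weight w"
    and "f \<in> F_loc d \<rho>"
    and "1 \<le> p" and "p \<le> q"
  shows "Lq_norm \<rho> q (I_op d \<rho> p w f) \<le>
         ennpowr (weight_norm w) (enn2real (1 / p)) * Lq_norm \<rho> q (\<lambda>x. ennreal \<bar>f x\<bar>)"
proof -
  interpret lie_group mul e iv A by fact
  interpret right_haar mul e iv \<rho>
    using assms by (intro right_haar_riemannian_measure[of mul e iv A gR])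
  \<comment> \<open>Left translation by x^{-1} carries the centre x to e, which expresses d through
    N(z) = d(e, z).\<close>
  have d: "d x y = riemannian_distance A gL e (mul (iv x) y)" for x y
    using riemannian_distance_left_invariant[OF assms(5), of "iv x" x y] by (simp add: assms(9) left_inverse)
  show ?thesis
    using assms borel_measurable_riemannian_distance[OF smooth_atlas, of gL e]
    by (intro Lq_norm_I_op_le[where N="riemannian_distance A gL e"] d) (auto simp: F_loc_def)
qed

end
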